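(* The $28$ functions $B_1,\dots,B_{28}$ are nonnegative, belong to $\mathbb S_3^2(\Delta_{WS_3})$, form a basis of $\mathbb S_3^2(\Delta_{WS_3})$, and satisfy $\sum_{i=1}^{28}B_i(x)=1$ for all $x\in\Delta$.
   Context: Let $\Delta=\langle p_1,p_2,p_3\rangle\subset\mathbb R^2$ be a nondegenerate triangle with area $|\Delta|$. Define the points $p_{1,2}=\tfrac23p_2+\tfrac13p_3$, $p_{1,3}=\tfrac13p_2+\tfrac23p_3$, $p_{2,1}=\tfrac23p_1+\tfrac13p_3$, $p_{2,3}=\tfrac13p_1+\tfrac23p_3$, $p_{3,1}=\tfrac23p_1+\tfrac13p_2$, $p_{3,2}=\tfrac13p_1+\tfrac23p_2$. The split $\Delta_{WS_3}$ is the partition of $\Delta$ into polygons obtained by drawing all line segments joining pairs of the nine points $p_k,p_{k,l}$. $\mathbb S_3^2(\Delta_{WS_3})$ is the space of functions in $C^2(\Delta)$ whose restriction to each polygon of $\Delta_{WS_3}$ is a bivariate polynomial of total degree $\le 3$. Simplex splines: for a multiset $\Xi=\{\xi_1,\dots,\xi_6\}$ of points of $\mathbb R^2$ whose convex hull has positive area, choose any simplex $\sigma=\langle\bar\xi_1,\dots,\bar\xi_6\rangle\subset\mathbb R^5$ of positive volume with $\pi(\bar\xi_i)=\xi_i$, where $\pi$ is the projection onto the first two coordinates, and set $M_\Xi(x)=\mathrm{vol}_3(\sigma\cap\pi^{-1}(x))/\mathrm{vol}_5(\sigma)$ (independent of the choice of $\sigma$; a piecewise cubic with unit integral supported on the convex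 hull of $\Xi$). The basis functions are $B_i=w_iM_{\Xi_i}$, regarded as functions on $\Delta$ with values on $\partial\Delta$ defined by continuity from the interior of $\Delta$, with knot multisets $\Xi_1=\{p_1,p_1,p_1,p_1,p_{3,1},p_{2,1}\}$, $\Xi_2=\{p_2,p_2,p_2,p_2,p_{3,2},p_{1,2}\}$, $\Xi_3=\{p_3,p_3,p_3,p_3,p_{1,3},p_{2,3}\}$, $\Xi_4=\{p_1,p_1,p_1,p_{3,1},p_{3,2},p_{2,1}\}$, $\Xi_5=\{p_1,p_1,p_1,p_{2,1},p_{2,3},p_{3,1}\}$, $\Xi_6=\{p_2,p_2,p_2,p_{1,2},p_{1,3},p_{3,2}\}$, $\Xi_7=\{p_2,p_2,p_2,p_{3,2},p_{3,1},p_{1,2}\}$, $\Xi_8=\{p_3,p_3,p_3,p_{2,3},p_{2,1},p_{1,3}\}$, $\Xi_9=\{p_3,p_3,p_3,p_{1,3},p_{1,2},p_{2,3}\}$, $\Xi_{10}=\{p_1,p_1,p_{3,1},p_{3,2},p_2,p_{2,1}\}$, $\Xi_{11}=\{p_1,p_1,p_{2,1},p_{2,3},p_3,p_{3,1}\}$, $\Xi_{12}=\{p_2,p_2,p_{1,2},p_{1,3},p_3,p_{3,2}\}$, $\Xi_{13}=\{p_2,p_2,p_{3,2},p_{3,1},p_1,p_{1,2}\}$, $\Xi_{14}=\{p_3,p_3,p_{2,3},p_{2,1},p_1,p_{1,3}\}$, $\Xi_{15}=\{p_3,p_3,p_{1,3},p_{1,2},p_2,p_{2,3}\}$, $\Xi_{16}=\{p_1,p_1,p_{3,1},p_{3,2},p_{2,1},p_{2,3}\}$,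 $\Xi_{17}=\{p_2,p_2,p_{3,2},p_{3,1},p_{1,2},p_{1,3}\}$, $\Xi_{18}=\{p_3,p_3,p_{1,3},p_{1,2},p_{2,3},p_{2,1}\}$, $\Xi_{19}=\{p_1,p_2,p_{3,1},p_{3,2},p_{2,1},p_{1,2}\}$, $\Xi_{20}=\{p_2,p_3,p_{1,2},p_{1,3},p_{3,2},p_{2,3}\}$, $\Xi_{21}=\{p_3,p_1,p_{2,3},p_{2,1},p_{1,3},p_{3,1}\}$, $\Xi_{22}=\{p_1,p_{3,1},p_{3,2},p_{1,2},p_{2,3},p_{2,1}\}$, $\Xi_{23}=\{p_1,p_{2,1},p_{2,3},p_{1,3},p_{3,2},p_{3,1}\}$, $\Xi_{24}=\{p_2,p_{1,2},p_{1,3},p_{2,3},p_{3,1},p_{3,2}\}$, $\Xi_{25}=\{p_2,p_{3,1},p_{3,2},p_{1,2},p_{1,3},p_{2,1}\}$, $\Xi_{26}=\{p_3,p_{2,3},p_{2,1},p_{3,1},p_{1,2},p_{1,3}\}$, $\Xi_{27}=\{p_3,p_{1,2},p_{1,3},p_{2,3},p_{2,1},p_{3,2}\}$, $\Xi_{28}=\{p_{3,1},p_{3,2},p_{1,2},p_{1,3},p_{2,3},p_{2,1}\}$, and weights $w_i=\frac{|\Delta|}{15}c_i$ where $c_i=\tfrac16$ for $i=1,2,3$; $c_i=\tfrac13$ for $i=4,\dots,9$; $c_i=\tfrac12$ for $i=10,\dots,15$; $c_i=\tfrac23$ for $i=16,17,18$; $c_i=\tfrac56$ for $i=19,20,21$;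 $c_i=\tfrac23$ for $i=22,\dots,27$; $c_{28}=1$. *)

theory Defs
  imports "HOL-Analysis.Analysis"
begin

type_synonym pt = "real^2"

definition tri :: "pt \<Rightarrow> pt \<Rightarrow> pt \<Rightarrow> pt set" where
  "tri p1 p2 p3 = convex hull {p1, p2, p3}"

definition area :: "pt \<Rightarrow> pt \<Rightarrow> pt \<Rightarrow> real" where
  "area p1 p2 p3 = measure lborel (tri p1 p2 p3)"

definition p12 :: "pt \<Rightarrow> pt \<Rightarrow> pt \<Rightarrow> pt" where "p12 p1 p2 p3 = (2/3) *\<^sub>R p2 + (1/3) *\<^sub>R p3"
definition p13 :: "pt \<Rightarrow> pt \<Rightarrow> pt \<Rightarrow> pt" where "p13 p1 p2 p3 = (1/3) *\<^sub>R p2 + (2/3) *\<^sub>R p3"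
definition p21 :: "pt \<Rightarrow> pt \<Rightarrow> pt \<Rightarrow> pt" where "p21 p1 p2 p3 = (2/3) *\<^sub>R p1 + (1/3) *\<^sub>R p3"
definition p23 :: "pt \<Rightarrow> pt \<Rightarrow> pt \<Rightarrow> pt" where "p23 p1 p2 p3 = (1/3) *\<^sub>R p1 + (2/3) *\<^sub>R p3"
definition p31 :: "pt \<Rightarrow> pt \<Rightarrow> pt \<Rightarrow> pt" where "p31 p1 p2 p3 = (2/3) *\<^sub>R p1 + (1/3) *\<^sub>R p2"
definition p32 :: "pt \<Rightarrow> pt \<Rightarrow> pt \<Rightarrow> pt" where "p32 p1 p2 p3 = (1/3) *\<^sub>R p1 + (2/3) *\<^sub>R p2"

definition ws_points :: "pt \<Rightarrow> pt \<Rightarrow> pt \<Rightarrow> pt set" where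
  "ws_points p1 p2 p3 = {p1, p2, p3, p12 p1 p2 p3, p13 p1 p2 p3, p21 p1 p2 p3,
                         p23 p1 p2 p3, p31 p1 p2 p3, p32 p1 p2 p3}"

definition ws_segments :: "pt \<Rightarrow> pt \<Rightarrow> pt \<Rightarrow> pt set" where
  "ws_segments p1 p2 p3 =
     \<Union>{closed_segment a b | a b. a \<in> ws_points p1 p2 p3 \<and> b \<in> ws_points p1 p2 p3}"

definition ws_polygons :: "pt \<Rightarrow> pt \<Rightarrow> pt \<Rightarrow> pt set set" where
  "ws_polygons p1 p2 p3 = closure ` components (tri p1 p2 p3 - ws_segments p1 p2 p3)"

definition cubic_poly :: "(pt \<Rightarrow> real) \<Rightarrow> bool" where
  "cubic_poly q \<longleftrightarrow> (\<exists>c :: nat \<Rightarrow> nat \<Rightarrow> real.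
      \<forall>x. q x = (\<Sum>i\<le>3. \<Sum>j\<le>3 - i. c i j * (x$1)^i * (x$2)^j))"

definition partial :: "2 \<Rightarrow> (pt \<Rightarrow> real) \<Rightarrow> pt \<Rightarrow> real" where
  "partial k g x = frechet_derivative g (at x) (axis k 1)"

definition C2_open :: "pt set \<Rightarrow> (pt \<Rightarrow> real) \<Rightarrow> bool" where
  "C2_open U g \<longleftrightarrow> open U \<and>
     (\<forall>x\<in>U. g differentiable (at x)) \<and>
     (\<forall>k. \<forall>x\<in>U. partial k g differentiable (at x)) \<and>
     (\<forall>k l. continuous_on U (partial l (partial k g)))"

definition C2_on :: "pt set \<Rightarrow> (pt \<Rightarrow> real) \<Rightarrow> bool" where
  "C2_on T f \<longleftrightarrow> (\<exists>g U. T \<subseteq> U \<and> C2_open U g \<and> (\<forall>x\<in>T. g x = f x))"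

text \<open>The spline space S_3^2(Delta_WS3) (only values on the triangle matter).\<close>
definition S32_WS3 :: "pt \<Rightarrow> pt \<Rightarrow> pt \<Rightarrow> (pt \<Rightarrow> real) set" where
  "S32_WS3 p1 p2 p3 = {f. C2_on (tri p1 p2 p3) f \<and>
      (\<forall>P\<in>ws_polygons p1 p2 p3. \<exists>q. cubic_poly q \<and> (\<forall>x\<in>P. f x = q x))}"

text \<open>Simplex spline with knot multiset given as a list of 6 points. R^5 is
  represented as real^2 \<times> real^3, the projection being the first component.
  The lifting is chosen by Hilbert choice (the value is independent of it).\<close>
definition lifted_simplex :: "pt list \<Rightarrow> (real^3) list \<Rightarrow> (pt \<times> (real^3)) set" where
  "lifted_simplex xs zs = convex hull set (zip xs zs)"

definition simplex_spline :: "pt list \<Rightarrow> pt \<Rightarrow> real" where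
  "simplex_spline xs x =
     (let zs = (SOME zs. length zs = length xs \<and> measure lborel (lifted_simplex xs zs) > 0);
          \<sigma> = lifted_simplex xs zs
      in measure lborel {z. (x, z) \<in> \<sigma>} / measure lborel \<sigma>)"

definition ws_knots :: "pt \<Rightarrow> pt \<Rightarrow> pt \<Rightarrow> nat \<Rightarrow> pt list" where
  "ws_knots p1 p2 p3 i =
    (let q12 = p12 p1 p2 p3; q13 = p13 p1 p2 p3; q21 = p21 p1 p2 p3;
         q23 = p23 p1 p2 p3; q31 = p31 p1 p2 p3; q32 = p32 p1 p2 p3 in
     [[p1,p1,p1,p1,q31,q21], [p2,p2,p2,p2,q32,q12], [p3,p3,p3,p3,q13,q23],
      [p1,p1,p1,q31,q32,q21], [p1,p1,p1,q21,q23,q31], [p2,p2,p2,q12,q13,q32],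
      [p2,p2,p2,q32,q31,q12], [p3,p3,p3,q23,q21,q13], [p3,p3,p3,q13,q12,q23],
      [p1,p1,q31,q32,p2,q21], [p1,p1,q21,q23,p3,q31], [p2,p2,q12,q13,p3,q32],
      [p2,p2,q32,q31,p1,q12], [p3,p3,q23,q21,p1,q13], [p3,p3,q13,q12,p2,q23],
      [p1,p1,q31,q32,q21,q23], [p2,p2,q32,q31,q12,q13], [p3,p3,q13,q12,q23,q21],
      [p1,p2,q31,q32,q21,q12], [p2,p3,q12,q13,q32,q23], [p3,p1,q23,q21,q13,q31],
      [p1,q31,q32,q12,q23,q21], [p1,q21,q23,q13,q32,q31], [p2,q12,q13,q23,q31,q32],
      [p2,q31,q32,q12,q13,q21], [p3,q23,q21,q31,q12,q13], [p3,q12,q13,q23,q21,q32],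
      [q31,q32,q12,q13,q23,q21]] ! (i - 1))"

definition ws_c :: "nat \<Rightarrow> real" where
  "ws_c i = (if i \<le> 3 then 1/6 else if i \<le> 9 then 1/3 else if i \<le> 15 then 1/2
             else if i \<le> 18 then 2/3 else if i \<le> 21 then 5/6 else if i \<le> 27 then 2/3 else 1)"

text \<open>B_i = w_i M_{Xi_i} on the triangle; boundary values by continuity from the
  interior; 0 outside the triangle (irrelevant).\<close>
definition ws_B :: "pt \<Rightarrow> pt \<Rightarrow> pt \<Rightarrow> nat \<Rightarrow> pt \<Rightarrow> real" where
  "ws_B p1 p2 p3 i x =
    (let T = tri p1 p2 p3; w = area p1 p2 p3 / 15 * ws_c i;
         M = simplex_spline (ws_knots p1 p2 p3 i) in
     if x \<in> interior T then w * M x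
     else if x \<in> T then Lim (at x within interior T) (\<lambda>y. w * M y)
     else 0)"

end

(* All segments between the nine points lie on the edges or on 18 chords of the triangle, and at most
   four chords meet in an interior point. The cubes of four pairwise independent linear forms are
   linearly independent, so the third-order jump of a C^2 cubic spline is constant along every chord:
   the spline space consists of the sums of a cubic polynomial and multiples of the truncated cubes of
   the 18 chords.

   In barycentric coordinates a simplex spline is a normalised volume of a three-dimensional slice.
   Splitting a slice by a plane gives the knot insertion formula, and linear elimination in finitely
   many instances of it expresses every basis function through splines with a fourfold knot at a vertex
   of the triangle, which are truncated cubes, and the spline with three double knots, which is the
   product of the barycentric coordinates. All claims then follow from the explicit invertible
   coefficient matrix. *)

theory Submission
  imports Defs
begin

section \<open>Bivariate cubic polynomials\<close>

text \<open>Four is the critical number of concurrent chords: binary cubic forms have dimension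
  four, so a fifth chord through a point would allow jumps that change there and cancel each other.
  With constant jumps the space has dimension at most 10 + 18 = 28. The elementary functions are
  chosen to match. Each vertex admits nine truncated cubes, one for each choice of a knot on either
  adjacent side; of these 27, six repeat a chord through a vertex with reversed sign, and three are
  the cubes of the barycentric coordinates. Modulo the 18 chords, these nine and the product of the
  coordinates give exactly the ten cubics, so the coefficient matrix is square. The weights cancel
  the areas in the spline formula and leave rational arithmetic. The 28 knot multisets form seven
  orbits under renaming the vertices; one value per orbit is computed. All identities are derived in
  the open triangle and reach the boundary by continuity, because the resulting formulas define C^2
  functions on the whole plane.\<close>

lemma cubic_poly_iff:
  "cubic_poly q \<longleftrightarrow> (\<exists>a0 a1 a2 a3 a4 a5 a6 a7 a8 a9. \<forall>x. q x = a0 + a1 * x$1 + a2 * x$2 + a3 * (x$1)^2 + a4 * (x$1 * x$2)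
     + a5 * (x$2)^2 + a6 * (x$1)^3 + a7 * ((x$1)^2 * x$2) + a8 * (x$1 * (x$2)^2) + a9 * (x$2)^3)"
proof -
  have s: "(\<Sum>i\<le>3. \<Sum>j\<le>3 - i. c i j * u^i * v^j) = c 0 0 + c 1 0 * u + c 0 1 * v + c 2 0 * u^2 + c 1 1 * (u * v)
     + c 0 2 * v^2 + c 3 0 * u^3 + c 2 1 * (u^2 * v) + c 1 2 * (u * v^2) + c 0 3 * v^3" for c :: "nat \<Rightarrow> nat \<Rightarrow> real" and u v
    by (simp add: numeral_eq_Suc algebra_simps)
  show ?thesis unfolding cubic_poly_def s
  proof (intro iffI; elim exE)
    fix a0 a1 a2 a3 a4 a5 a6 a7 a8 a9
    assume "\<forall>x. q x = a0 + a1 * x$1 + a2 * x$2 + a3 * (x$1)^2 + a4 * (x$1 * x$2)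
     + a5 * (x$2)^2 + a6 * (x$1)^3 + a7 * ((x$1)^2 * x$2) + a8 * (x$1 * (x$2)^2) + a9 * (x$2)^3"
    then show "\<exists>c :: nat \<Rightarrow> nat \<Rightarrow> real. \<forall>x. q x = c 0 0 + c 1 0 * x$1 + c 0 1 * x$2 + c 2 0 * (x$1)^2 + c 1 1 * (x$1 * x$2)
     + c 0 2 * (x$2)^2 + c 3 0 * (x$1)^3 + c 2 1 * ((x$1)^2 * x$2) + c 1 2 * (x$1 * (x$2)^2) + c 0 3 * (x$2)^3"
      by (intro exI[of _ "\<lambda>i j. [[a0, a2, a5, a9], [a1, a4, a8], [a3, a7], [a6]] ! i ! j"]) (simp add: numeral_eq_Suc)
  qed blast
qed

lemma cubic_poly_add:
  assumes "cubic_poly p" "cubic_poly q" shows "cubic_poly (\<lambda>x. p x + q x)"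
proof -
  obtain c d where "\<And>x. p x = (\<Sum>i\<le>3. \<Sum>j\<le>3 - i. c i j * (x$1)^i * (x$2)^j)" "\<And>x. q x = (\<Sum>i\<le>3. \<Sum>j\<le>3 - i. d i j * (x$1)^i * (x$2)^j)"
    using assms unfolding cubic_poly_def by blast
  then show ?thesis unfolding cubic_poly_def
    by (intro exI[of _ "\<lambda>i j. c i j + d i j"]) (simp add: sum.distrib algebra_simps)
qed

lemma cubic_poly_cmult:
  assumes "cubic_poly p" shows "cubic_poly (\<lambda>x. k * p x)"
proof -
  obtain c where "\<And>x. p x = (\<Sum>i\<le>3. \<Sum>j\<le>3 - i. c i j * (x$1)^i * (x$2)^j)"
    using assms unfolding cubic_poly_def by blast
  then show ?thesis unfolding cubic_poly_def
    by (intro exI[of _ "\<lambda>i j. k * c i j"]) (simp add: sum_distrib_left algebra_simps)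
qed

lemma cubic_poly_zero: "cubic_poly (\<lambda>x. 0)"
  unfolding cubic_poly_def by (intro exI[of _ "\<lambda>i j. 0"]) simp

lemma cubic_poly_diff: "cubic_poly p \<Longrightarrow> cubic_poly q \<Longrightarrow> cubic_poly (\<lambda>x. p x - q x)"
  using cubic_poly_add[of p "\<lambda>x. -1 * q x"] cubic_poly_cmult[of q "-1"] by simp

lemma cubic_poly_sum:
  assumes "\<And>i. i \<in> I \<Longrightarrow> cubic_poly (p i)" shows "cubic_poly (\<lambda>x. \<Sum>i\<in>I. p i x)"
  using assms by (induction I rule: infinite_finite_induct) (auto intro: cubic_poly_zero cubic_poly_add)

lemma cubic_poly_mult3:
  "cubic_poly (\<lambda>x. (a + b * x$1 + c * x$2) * (a' + b' * x$1 + c' * x$2) * (a'' + b'' * x$1 + c'' * x$2))"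
  unfolding cubic_poly_iff
  by (rule exI[of _ "a*a'*a''"], rule exI[of _ "b*a'*a'' + a*b'*a'' + a*a'*b''"], rule exI[of _ "c*a'*a'' + a*c'*a'' + a*a'*c''"],
      rule exI[of _ "a*b'*b'' + b*a'*b'' + b*b'*a''"],
      rule exI[of _ "a*b'*c'' + a*c'*b'' + b*a'*c'' + c*a'*b'' + b*c'*a'' + c*b'*a''"],
      rule exI[of _ "a*c'*c'' + c*a'*c'' + c*c'*a''"], rule exI[of _ "b*b'*b''"],
      rule exI[of _ "b*b'*c'' + b*c'*b'' + c*b'*b''"], rule exI[of _ "b*c'*c'' + c*b'*c'' + c*c'*b''"], rule exI[of _ "c*c'*c''"])
     (simp add: algebra_simps power2_eq_square power3_eq_cube)

lemma cubic_poly_affine_cube: "cubic_poly (\<lambda>x. (n \<bullet> x + c) ^ 3)"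
  using cubic_poly_mult3[of c "n$1" "n$2" c "n$1" "n$2" c "n$1" "n$2"]
  by (simp add: inner_vec_def sum_2 power3_eq_cube add_ac)

lemma cubic_poly_continuous: "cubic_poly q \<Longrightarrow> continuous_on S q"
proof -
  assume "cubic_poly q"
  then obtain c where "q = (\<lambda>x. \<Sum>i\<le>3. \<Sum>j\<le>3 - i. c i j * (x$1)^i * (x$2)^j)" unfolding cubic_poly_def by blast
  then show ?thesis by (simp add: continuous_intros)
qed

lemma cubic_poly_on_line:
  assumes "cubic_poly q"
  obtains b0 b1 b2 b3 where "\<And>t. q (z + t *\<^sub>R w) = b0 + b1 * t + b2 * t^2 + b3 * t^3"
proof -
  obtain a0 a1 a2 a3 a4 a5 a6 a7 a8 a9 where q: "\<And>x. q x = a0 + a1 * x$1 + a2 * x$2 + a3 * (x$1)^2 + a4 * (x$1 * x$2)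
     + a5 * (x$2)^2 + a6 * (x$1)^3 + a7 * ((x$1)^2 * x$2) + a8 * (x$1 * (x$2)^2) + a9 * (x$2)^3"
    using assms unfolding cubic_poly_iff by blast
  let ?u = "z$1" and ?v = "z$2" and ?r = "w$1" and ?s = "w$2"
  show ?thesis
    by (rule that[of "q z"
      "a1*?r + a2*?s + a3*(2*?u*?r) + a4*(?u*?s + ?r*?v) + a5*(2*?v*?s) + a6*(3*?u^2*?r) + a7*(?u^2*?s + 2*?u*?r*?v) + a8*(?r*?v^2 + 2*?u*?v*?s) + a9*(3*?v^2*?s)"
      "a3*?r^2 + a4*(?r*?s) + a5*?s^2 + a6*(3*?u*?r^2) + a7*(?r^2*?v + 2*?u*?r*?s) + a8*(?u*?s^2 + 2*?r*?v*?s) + a9*(3*?v*?s^2)"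
      "a6*?r^3 + a7*(?r^2*?s) + a8*(?r*?s^2) + a9*?s^3"])
      (simp add: q algebra_simps power2_eq_square power3_eq_cube)
qed

text \<open>The third difference annihilates all monomials of degree below three and is constant on
  the cubic part. This independence of the base point later makes the jump coefficient the same at
  all points of a line.\<close>

lemma cubic_poly_third_difference:
  assumes "cubic_poly q"
  obtains k where "\<And>z. q (z + 3 *\<^sub>R w) - 3 * q (z + 2 *\<^sub>R w) + 3 * q (z + w) - q z = k"
proof -
  obtain a0 a1 a2 a3 a4 a5 a6 a7 a8 a9 where q: "\<And>x. q x = a0 + a1 * x$1 + a2 * x$2 + a3 * (x$1)^2 + a4 * (x$1 * x$2)
     + a5 * (x$2)^2 + a6 * (x$1)^3 + a7 * ((x$1)^2 * x$2) + a8 * (x$1 * (x$2)^2) + a9 * (x$2)^3"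
    using assms unfolding cubic_poly_iff by blast
  let ?r = "w$1" and ?s = "w$2"
  show ?thesis
    by (rule that[of "6 * (a6*?r^3 + a7*(?r^2*?s) + a8*(?r*?s^2) + a9*?s^3)"])
      (simp add: q algebra_simps power2_eq_square power3_eq_cube)
qed

lemma cubic_coefficients_zero:
  fixes b0 b1 b2 b3 :: real
  assumes "0 < d" "\<And>t. 0 < t \<Longrightarrow> t < d \<Longrightarrow> b0 + b1 * t + b2 * t^2 + b3 * t^3 = 0"
  shows "b0 = 0 \<and> b1 = 0 \<and> b2 = 0 \<and> b3 = 0"
proof -
  \<comment> \<open>Four equidistant sample points inside the interval determine the four
    coefficients.\<close>
  define s where "s = d / 5"
  have s: "0 < s" using assms by (simp add: s_def)
  have e: "b0 + k * (b1 * s) + k^2 * (b2 * s^2) + k^3 * (b3 * s^3) = 0" if "0 < k" "k < 5" for k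
  proof -
    have "0 < k * s" "k * s < d" using that s by (simp_all add: s_def)
    from assms(2)[OF this] show ?thesis by (simp add: power_mult_distrib algebra_simps)
  qed
  have "b0 = 0 \<and> b1 * s = 0 \<and> b2 * s^2 = 0 \<and> b3 * s^3 = 0"
  proof -
    have "b0 + b1 * s + b2 * s^2 + b3 * s^3 = 0" "b0 + 2 * (b1 * s) + 4 * (b2 * s^2) + 8 * (b3 * s^3) = 0"
      "b0 + 3 * (b1 * s) + 9 * (b2 * s^2) + 27 * (b3 * s^3) = 0" "b0 + 4 * (b1 * s) + 16 * (b2 * s^2) + 64 * (b3 * s^3) = 0"
      using e[of 1] e[of 2] e[of 3] e[of 4] by simp_all
    then show ?thesis by (intro conjI; linarith)
  qed
  then show ?thesis using s by simp
qed

text \<open>On a line through a point of \<open>S\<close> the polynomial vanishes on a short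
  interval, so its four coefficients on that line are zero.\<close>

lemma cubic_poly_eq_zero:
  assumes q: "cubic_poly q" and S: "open S" "S \<noteq> {}" "\<And>x. x \<in> S \<Longrightarrow> q x = 0"
  shows "q y = 0"
proof -
  obtain x where x: "x \<in> S" using S by blast
  obtain b0 b1 b2 b3 where b: "\<And>t. q (x + t *\<^sub>R (y - x)) = b0 + b1 * t + b2 * t^2 + b3 * t^3"
    using cubic_poly_on_line[OF q] by blast
  have "((\<lambda>t. x + t *\<^sub>R (y - x)) \<longlongrightarrow> x + 0 *\<^sub>R (y - x)) (at_right 0)" by (intro tendsto_intros)
  then have "\<forall>\<^sub>F t in at_right 0. x + t *\<^sub>R (y - x) \<in> S"
    using S x by (intro topological_tendstoD) auto
  then obtain d where "0 < d" "\<And>t. 0 < t \<Longrightarrow> t < d \<Longrightarrow> x + t *\<^sub>R (y - x) \<in> S"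
    unfolding eventually_at_right_field by auto
  then have "b0 = 0 \<and> b1 = 0 \<and> b2 = 0 \<and> b3 = 0"
    using S(3) b by (intro cubic_coefficients_zero[of d]) metis+
  then show ?thesis using b[of 1] by simp
qed

lemma cubic_poly_eqI:
  assumes "cubic_poly p" "cubic_poly q" "open S" "S \<noteq> {}" "\<And>x. x \<in> S \<Longrightarrow> p x = q x"
  shows "p = q"
proof
  fix y
  have "p y - q y = 0" by (rule cubic_poly_eq_zero[OF cubic_poly_diff, of p q S]) (use assms in auto)
  then show "p y = q y" by simp
qed

section \<open>Restriction to lines and the jump across one line\<close>

lemma directional_derivative:
  assumes "g differentiable (at (z + t *\<^sub>R w))"
  shows "((\<lambda>t. g (z + t *\<^sub>R w)) has_real_derivative (w$1 * partial 1 g (z + t *\<^sub>R w) + w$2 * partial 2 g (z + t *\<^sub>R w))) (at t)"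
proof -
  let ?y = "z + t *\<^sub>R w" and ?D = "frechet_derivative g (at (z + t *\<^sub>R w))"
  have D: "(g has_derivative ?D) (at ?y)" using assms frechet_derivative_works by blast
  then have lin: "linear ?D" by (rule has_derivative_linear)
  have w: "w = w$1 *\<^sub>R axis 1 1 + w$2 *\<^sub>R axis 2 1" by (simp add: vec_eq_iff forall_2 axis_def)
  have "L w = w$1 * L (axis 1 1) + w$2 * L (axis 2 1)" if L: "linear L" for L :: "pt \<Rightarrow> real"
  proof -
    have "L w = L (w$1 *\<^sub>R axis 1 1 + w$2 *\<^sub>R axis 2 1)" by (rule arg_cong[OF w])
    also have "\<dots> = w$1 * L (axis 1 1) + w$2 * L (axis 2 1)" by (simp add: linear_add[OF L] linear_scale[OF L])
    finally show ?thesis .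
  qed
  from this[OF lin] have "?D w = w$1 * partial 1 g ?y + w$2 * partial 2 g ?y"
    unfolding partial_def .
  moreover have "((\<lambda>t. g (z + t *\<^sub>R w)) has_derivative (\<lambda>s. ?D (s *\<^sub>R w))) (at t)"
    by (rule has_derivative_compose[where f = "\<lambda>t. z + t *\<^sub>R w" and g = g, OF _ D]) (auto intro!: derivative_eq_intros)
  moreover have "(\<lambda>s. ?D (s *\<^sub>R w)) = (*) (?D w)" using lin by (simp add: linear_scale fun_eq_iff)
  ultimately show ?thesis unfolding has_field_derivative_def by simp
qed

text \<open>\<open>C2_open\<close> speaks of partial derivatives only; along a line they combine to
  two ordinary derivatives, the form in which one-sided polynomials can be compared.\<close>

lemma C2_on_line:
  assumes C2: "C2_open U g" and z: "z \<in> U"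
  obtains g1 g2 d where "0 < d"
    "\<And>t. \<bar>t\<bar> < d \<Longrightarrow> ((\<lambda>t. g (z + t *\<^sub>R w)) has_real_derivative g1 t) (at t)"
    "\<And>t. \<bar>t\<bar> < d \<Longrightarrow> (g1 has_real_derivative g2 t) (at t)" "isCont g2 0"
proof -
  have U: "open U" and d1: "\<And>x. x \<in> U \<Longrightarrow> g differentiable (at x)"
    and d2: "\<And>k x. x \<in> U \<Longrightarrow> partial k g differentiable (at x)"
    and c: "\<And>k l. continuous_on U (partial l (partial k g))" using C2 unfolding C2_open_def by auto
  define g1 where "g1 = (\<lambda>t. w$1 * partial 1 g (z + t *\<^sub>R w) + w$2 * partial 2 g (z + t *\<^sub>R w))"
  define h where "h = (\<lambda>k t. w$1 * partial 1 (partial k g) (z + t *\<^sub>R w) + w$2 * partial 2 (partial k g) (z + t *\<^sub>R w))"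
  define g2 where "g2 = (\<lambda>t. w$1 * h 1 t + w$2 * h 2 t)"
  have "((\<lambda>t. z + t *\<^sub>R w) \<longlongrightarrow> z + 0 *\<^sub>R w) (nhds 0)" by (intro tendsto_intros filterlim_ident)
  then have "\<forall>\<^sub>F t in nhds 0. z + t *\<^sub>R w \<in> U" using U z by (intro topological_tendstoD) auto
  then obtain d where d: "0 < d" "\<And>t. \<bar>t\<bar> < d \<Longrightarrow> z + t *\<^sub>R w \<in> U"
    unfolding eventually_nhds_metric by (auto simp: dist_real_def)
  show ?thesis
  proof (rule that[OF d(1), of g1 g2])
    fix t :: real assume t: "\<bar>t\<bar> < d"
    show "((\<lambda>t. g (z + t *\<^sub>R w)) has_real_derivative g1 t) (at t)"
      unfolding g1_def by (intro directional_derivative d1 d t)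
    show "(g1 has_real_derivative g2 t) (at t)"
      unfolding g1_def g2_def h_def by (intro DERIV_add DERIV_cmult directional_derivative d2 d t)
  next
    have "isCont (\<lambda>t. partial l (partial k g) (z + t *\<^sub>R w)) 0" for k l
    proof -
      have "isCont (partial l (partial k g)) (z + 0 *\<^sub>R w)" using c U z by (simp add: continuous_on_eq_continuous_at)
      moreover have "isCont (\<lambda>t. z + t *\<^sub>R w) 0" by (intro continuous_intros)
      ultimately show ?thesis by (rule isCont_o2[rotated])
    qed
    then show "isCont g2 0" unfolding g2_def h_def by (intro continuous_intros)
  qed
qed

lemma isCont_one_sided:
  fixes h P :: "real \<Rightarrow> real"
  assumes "isCont h 0" "isCont P 0" "0 < d"
    and "(\<forall>t. 0 < t \<longrightarrow> t < d \<longrightarrow> h t = P t) \<or> (\<forall>t. -d < t \<longrightarrow> t < 0 \<longrightarrow> h t = P t)"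
  shows "h 0 = P 0"
proof -
  have l: "(h \<longlongrightarrow> h 0) F" "(P \<longlongrightarrow> P 0) F" if "F \<le> at 0" for F
    using assms(1,2) that tendsto_mono unfolding isCont_def by blast+
  from assms(4) show ?thesis
  proof
    assume *: "\<forall>t. 0 < t \<longrightarrow> t < d \<longrightarrow> h t = P t"
    have "\<forall>\<^sub>F t in at_right 0. h t = P t" unfolding eventually_at_right_field using * assms(3) by auto
    then have "(P \<longlongrightarrow> h 0) (at_right 0)" using l(1)[of "at_right 0"] by (simp add: at_le tendsto_cong)
    then show ?thesis using l(2)[of "at_right 0"] tendsto_unique[of "at_right (0::real)"] by (simp add: at_le)
  next
    assume *: "\<forall>t. -d < t \<longrightarrow> t < 0 \<longrightarrow> h t = P t"
    have "\<forall>\<^sub>F t in at_left 0. h t = P t" unfolding eventually_at_left_field using * assms(3) by (intro exI[of _ "-d"]) auto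
    then have "(P \<longlongrightarrow> h 0) (at_left 0)" using l(1)[of "at_left 0"] by (simp add: at_le tendsto_cong)
    then show ?thesis using l(2)[of "at_left 0"] tendsto_unique[of "at_left (0::real)"] by (simp add: at_le)
  qed
qed

text \<open>Agreement with a cubic on one side alone fixes its value and first two derivatives at
  the end point. Hence the cubics on the two sides of a line can differ only in
  \<open>b3\<close>.\<close>

lemma C2_one_sided_coefficients:
  fixes h :: "real \<Rightarrow> real"
  assumes d: "0 < d" and h: "\<And>t. \<bar>t\<bar> < d \<Longrightarrow> (h has_real_derivative h1 t) (at t)"
    "\<And>t. \<bar>t\<bar> < d \<Longrightarrow> (h1 has_real_derivative h2 t) (at t)" "isCont h2 0"
    and S: "S = {0<..<d} \<or> S = {-d<..<0}"
    and eq: "\<And>t. t \<in> S \<Longrightarrow> h t = b0 + b1 * t + b2 * t^2 + b3 * t^3"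
  shows "b0 = h 0 \<and> b1 = h1 0 \<and> 2 * b2 = h2 0"
proof -
  have S': "open S" "\<And>t. t \<in> S \<Longrightarrow> \<bar>t\<bar> < d" using S by auto
  have side: "k 0 = P 0" if "isCont k 0" "isCont P 0" "\<And>t. t \<in> S \<Longrightarrow> k t = P t" for k P :: "real \<Rightarrow> real"
    using S that by (intro isCont_one_sided[of k P d] d) auto
  have 1: "h1 t = b1 + 2 * b2 * t + 3 * b3 * t^2" if t: "t \<in> S" for t
  proof -
    have "((\<lambda>t. b0 + b1 * t + b2 * t^2 + b3 * t^3) has_real_derivative h1 t) (at t)"
      by (rule has_field_derivative_transform_within_open[OF h(1)[OF S'(2)[OF t]] S'(1) t]) (rule eq)
    moreover have "((\<lambda>t. b0 + b1 * t + b2 * t^2 + b3 * t^3) has_real_derivative b1 + 2 * b2 * t + 3 * b3 * t^2) (at t)"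
      by (auto intro!: derivative_eq_intros)
    ultimately show ?thesis by (rule DERIV_unique)
  qed
  have 2: "h2 t = 2 * b2 + 6 * b3 * t" if t: "t \<in> S" for t
  proof -
    have "((\<lambda>t. b1 + 2 * b2 * t + 3 * b3 * t^2) has_real_derivative h2 t) (at t)"
      by (rule has_field_derivative_transform_within_open[OF h(2)[OF S'(2)[OF t]] S'(1) t]) (rule 1)
    moreover have "((\<lambda>t. b1 + 2 * b2 * t + 3 * b3 * t^2) has_real_derivative 2 * b2 + 6 * b3 * t) (at t)"
      by (auto intro!: derivative_eq_intros)
    ultimately show ?thesis by (rule DERIV_unique)
  qed
  have c: "isCont h 0" "isCont h1 0" using h(1)[of 0] h(2)[of 0] d by (auto intro: DERIV_isCont)
  show ?thesis
    using side[OF c(1) _ eq] side[OF c(2) _ 1] side[OF h(3) _ 2] by (simp add: continuous_intros)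
qed

definition tpow :: "real \<Rightarrow> real" where "tpow t = (max 0 t) ^ 3"

text \<open>On each normal line the two cubics differ by a multiple of \<open>t^3\<close>; the third
  difference of \<open>q - r\<close> shows that the multiple does not depend on the foot
  point.\<close>

lemma C2_across_line:
  fixes n :: pt
  assumes C2: "C2_open U g" and e: "0 < e" "ball x e \<subseteq> U" and n: "n \<noteq> 0" and x: "n \<bullet> x + c = 0"
    and q: "cubic_poly q" "\<And>y. y \<in> ball x e \<Longrightarrow> 0 < n \<bullet> y + c \<Longrightarrow> g y = q y"
    and r: "cubic_poly r" "\<And>y. y \<in> ball x e \<Longrightarrow> n \<bullet> y + c < 0 \<Longrightarrow> g y = r y"
  obtains k where "\<forall>\<^sub>F y in nhds x. g y = r y + k * tpow (n \<bullet> y + c)"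
proof -
  \<comment> \<open>With this scaling \<open>t\<close> is the increment of the affine form along
    \<open>w\<close>.\<close>
  define w where "w = (1 / (n \<bullet> n)) *\<^sub>R n"
  have nw: "n \<bullet> w = 1" using n by (simp add: w_def)
  let ?l = "\<lambda>y. n \<bullet> y + c" and ?d = "\<lambda>y. q y - r y"
  have lw: "?l (z + t *\<^sub>R w) = ?l z + t" for z t by (simp add: inner_add_right nw)
  obtain K where K: "\<And>z. ?d (z + 3 *\<^sub>R w) - 3 * ?d (z + 2 *\<^sub>R w) + 3 * ?d (z + w) - ?d z = K"
    using cubic_poly_third_difference[OF cubic_poly_diff[OF q(1) r(1)]] by blast
  have key: "g z = r z \<and> ?d (z + t *\<^sub>R w) = K / 6 * t^3" if z: "z \<in> ball x e" "?l z = 0" for z t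
  proof -
    have zU: "z \<in> U" using z(1) e(2) by blast
    obtain g1 g2 d where d: "0 < d" 
      "\<And>t. \<bar>t\<bar> < d \<Longrightarrow> ((\<lambda>t. g (z + t *\<^sub>R w)) has_real_derivative g1 t) (at t)"
      "\<And>t. \<bar>t\<bar> < d \<Longrightarrow> (g1 has_real_derivative g2 t) (at t)" "isCont g2 0"
      by (rule C2_on_line[OF C2 zU, of w]) (rule that)
    have "((\<lambda>t. z + t *\<^sub>R w) \<longlongrightarrow> z + 0 *\<^sub>R w) (nhds 0)" by (intro tendsto_intros filterlim_ident)
    then have "\<forall>\<^sub>F t in nhds 0. z + t *\<^sub>R w \<in> ball x e" using z by (intro topological_tendstoD) auto
    then obtain d' where d': "0 < d'" "\<And>t. \<bar>t\<bar> < d' \<Longrightarrow> z + t *\<^sub>R w \<in> ball x e"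
      unfolding eventually_nhds_metric by (auto simp: dist_real_def)
    define m where "m = min d d'"
    have m: "0 < m" using d d' by (simp add: m_def)
    obtain a0 a1 a2 a3 where a: "\<And>t. q (z + t *\<^sub>R w) = a0 + a1 * t + a2 * t^2 + a3 * t^3" using cubic_poly_on_line[OF q(1)] by blast
    obtain b0 b1 b2 b3 where b: "\<And>t. r (z + t *\<^sub>R w) = b0 + b1 * t + b2 * t^2 + b3 * t^3" using cubic_poly_on_line[OF r(1)] by blast
    have A: "a0 = g (z + 0 *\<^sub>R w) \<and> a1 = g1 0 \<and> 2 * a2 = g2 0"
    proof (rule C2_one_sided_coefficients[OF m, where S = "{0<..<m}" and ?b3.0 = a3])
      fix t assume "t \<in> {0<..<m}"
      then show "g (z + t *\<^sub>R w) = a0 + a1 * t + a2 * t^2 + a3 * t^3"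
        using q(2)[of "z + t *\<^sub>R w"] d'(2)[of t] z(2) unfolding lw a by (simp add: m_def)
    qed (use d in \<open>auto simp: m_def\<close>)
    have B: "b0 = g (z + 0 *\<^sub>R w) \<and> b1 = g1 0 \<and> 2 * b2 = g2 0"
    proof (rule C2_one_sided_coefficients[OF m, where S = "{-m<..<0}" and ?b3.0 = b3])
      fix t assume t: "t \<in> {-m<..<0}"
      then have "\<bar>t\<bar> < d'" by (auto simp: m_def)
      with t show "g (z + t *\<^sub>R w) = b0 + b1 * t + b2 * t^2 + b3 * t^3"
        using r(2)[of "z + t *\<^sub>R w"] d'(2)[of t] z(2) unfolding lw b by simp
    qed (use d in \<open>auto simp: m_def\<close>)
    have D: "?d (z + t *\<^sub>R w) = (a3 - b3) * t^3" for t using A B unfolding a b by (simp add: algebra_simps)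
    \<comment> \<open>The third difference of \<open>t^3\<close> at 0 is 27 - 24 + 3 = 6.\<close>
    have "6 * (a3 - b3) = K" using K[of z] D[of 3] D[of 2] D[of 1] D[of 0] by simp
    then show ?thesis using D[of t] b[of 0] B by auto
  qed
  \<comment> \<open>The foot of the perpendicular from \<open>y\<close> stays in the ball for
    \<open>y\<close> near \<open>x\<close>.\<close>
  have "((\<lambda>y. y - ?l y *\<^sub>R w) \<longlongrightarrow> x - ?l x *\<^sub>R w) (nhds x)" by (intro tendsto_intros filterlim_ident)
  then have ev: "\<forall>\<^sub>F y in nhds x. y - ?l y *\<^sub>R w \<in> ball x e" using x e by (intro topological_tendstoD) auto
  have ev2: "\<forall>\<^sub>F y in nhds x. y \<in> ball x e" using e by (intro eventually_nhds_in_open) auto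
  have "\<forall>\<^sub>F y in nhds x. g y = r y + K / 6 * tpow (?l y)"
    using ev ev2
  proof eventually_elim
    case (elim y)
    let ?z = "y - ?l y *\<^sub>R w"
    have z: "?l ?z = 0" by (simp add: inner_diff_right nw)
    have k: "g ?z = r ?z" "q y - r y = K / 6 * (?l y)^3" using key[OF elim(1) z, of "?l y"] by simp_all
    consider "?l y > 0" | "?l y < 0" | "?l y = 0" by linarith
    then show ?case
    proof cases
      case 1 then show ?thesis using k(2) q(2)[OF elim(2)] by (simp add: tpow_def)
    next
      case 2 then show ?thesis using r(2)[OF elim(2)] by (simp add: tpow_def)
    next
      case 3 then show ?thesis using k(1) by (simp add: tpow_def)
    qed
  qed
  then show ?thesis by (rule that)
qed

section \<open>Piecewise cubics on families of lines\<close>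

definition cross2 :: "pt \<Rightarrow> pt \<Rightarrow> real" where
  "cross2 u v = u$1 * v$2 - u$2 * v$1"

definition perp :: "pt \<Rightarrow> pt" where "perp v = vector [- v$2, v$1]"

lemma inner_perp: "u \<bullet> perp v = - cross2 u v" "perp v \<bullet> u = - cross2 u v"
  by (simp_all add: perp_def cross2_def inner_vec_def sum_2 vector_2 algebra_simps)

lemma tpow_simps: "0 \<le> t \<Longrightarrow> tpow t = t^3" "t \<le> 0 \<Longrightarrow> tpow t = 0"
  by (simp_all add: tpow_def)

lemma cross2_cancel:
  assumes "cross2 u v \<noteq> 0" "u \<bullet> z = 0" "v \<bullet> z = 0" shows "z = 0"
proof -
  have uv: "u$1 * z$1 + u$2 * z$2 = 0" "v$1 * z$1 + v$2 * z$2 = 0"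
    using assms by (simp_all add: inner_vec_def sum_2)
  have "cross2 u v * z$1 = v$2 * (u$1 * z$1 + u$2 * z$2) - u$2 * (v$1 * z$1 + v$2 * z$2)"
    "cross2 u v * z$2 = u$1 * (v$1 * z$1 + v$2 * z$2) - v$1 * (u$1 * z$1 + u$2 * z$2)"
    by (simp_all add: cross2_def algebra_simps)
  then have "z$1 = 0" "z$2 = 0" using assms(1) unfolding uv by simp_all
  then show ?thesis by (simp add: vec_eq_iff forall_2)
qed

text \<open>Polarising the cubic form isolates one summand: every other linear form is
  annihilated by one of the three directions.\<close>

lemma cubes_independent:
  assumes fin: "finite I" and card: "card I \<le> 4"
    and ind: "\<And>i j. i \<in> I \<Longrightarrow> j \<in> I \<Longrightarrow> i \<noteq> j \<Longrightarrow> cross2 (n i) (n j) \<noteq> 0"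
    and nz: "\<And>i. i \<in> I \<Longrightarrow> n i \<noteq> 0"
    and zero: "\<And>v. (\<Sum>i\<in>I. b i * (n i \<bullet> v)^3) = 0" and i: "i \<in> I"
  shows "b i = 0"
proof -
  have pol: "(\<Sum>i\<in>I. b i * ((n i \<bullet> u) * (n i \<bullet> v) * (n i \<bullet> w))) = 0" for u v w
  proof -
    have "b i * ((n i \<bullet> u) * (n i \<bullet> v) * (n i \<bullet> w)) = (b i * (n i \<bullet> (u + v + w))^3 - b i * (n i \<bullet> (u + v))^3
       - b i * (n i \<bullet> (u + w))^3 - b i * (n i \<bullet> (v + w))^3 + b i * (n i \<bullet> u)^3 + b i * (n i \<bullet> v)^3 + b i * (n i \<bullet> w)^3) / 6" for i
      by (simp add: inner_add_right power3_eq_cube algebra_simps)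
    then have "(\<Sum>i\<in>I. b i * ((n i \<bullet> u) * (n i \<bullet> v) * (n i \<bullet> w))) = ((\<Sum>i\<in>I. b i * (n i \<bullet> (u + v + w))^3) - (\<Sum>i\<in>I. b i * (n i \<bullet> (u + v))^3)
       - (\<Sum>i\<in>I. b i * (n i \<bullet> (u + w))^3) - (\<Sum>i\<in>I. b i * (n i \<bullet> (v + w))^3) + (\<Sum>i\<in>I. b i * (n i \<bullet> u)^3)
       + (\<Sum>i\<in>I. b i * (n i \<bullet> v)^3) + (\<Sum>i\<in>I. b i * (n i \<bullet> w)^3)) / 6"
      by (simp only: sum.distrib sum_subtractf sum_divide_distrib[symmetric])
    then show ?thesis unfolding zero by simp
  qed
  have "card (I - {i}) \<le> 3" using i fin card by simp
  then obtain xs where xs: "set xs = I - {i}" "length xs \<le> 3"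
    using finite_distinct_list[of "I - {i}"] fin distinct_card by (metis finite_Diff)
  have "\<exists>v. n i \<bullet> v \<noteq> 0 \<and> (k < length xs \<longrightarrow> n (xs!k) \<bullet> v = 0)" for k
  proof (cases "k < length xs")
    case True
    then have j: "xs!k \<in> I" "xs!k \<noteq> i" using xs(1) nth_mem[OF True] by auto
    have "n i \<bullet> perp (n (xs!k)) \<noteq> 0" using ind[OF i j(1)] j(2) by (simp add: inner_perp)
    moreover have "n (xs!k) \<bullet> perp (n (xs!k)) = 0" by (simp add: inner_perp cross2_def)
    ultimately show ?thesis by blast
  next
    case False
    then show ?thesis using nz[OF i] by (intro exI[of _ "n i"]) simp
  qed
  then obtain v where v: "\<And>k. n i \<bullet> v k \<noteq> 0" "\<And>k. k < length xs \<Longrightarrow> n (xs!k) \<bullet> v k = 0" by metis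
  have kill: "(n j \<bullet> v 0) * (n j \<bullet> v 1) * (n j \<bullet> v 2) = 0" if "j \<in> I - {i}" for j
  proof -
    obtain k where "k < length xs" "j = xs!k" using \<open>j \<in> I - {i}\<close> xs(1) by (metis in_set_conv_nth)
    moreover from this xs(2) have "k = 0 \<or> k = 1 \<or> k = 2" by linarith
    ultimately show ?thesis using v(2)[of k] by auto
  qed
  have "0 = (\<Sum>j\<in>I. b j * ((n j \<bullet> v 0) * (n j \<bullet> v 1) * (n j \<bullet> v 2)))" by (rule pol[symmetric])
  also have "\<dots> = b i * ((n i \<bullet> v 0) * (n i \<bullet> v 1) * (n i \<bullet> v 2))"
  proof -
    have "(\<Sum>j\<in>I - {i}. b j * ((n j \<bullet> v 0) * (n j \<bullet> v 1) * (n j \<bullet> v 2))) = 0"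
      by (intro sum.neutral ballI) (simp only: kill mult_zero_right)
    then show ?thesis by (subst sum.remove[OF fin i]) simp
  qed
  finally show ?thesis using v(1) by simp
qed

text \<open>Parallel chords occur, so transversality is demanded only at common points. It also
  prevents one line from being listed under two indices.\<close>

locale line_family =
  fixes I :: "'i set" and n :: "'i \<Rightarrow> pt" and c :: "'i \<Rightarrow> real"
  assumes fin: "finite I" and normal_nonzero: "\<And>i. i \<in> I \<Longrightarrow> n i \<noteq> 0"
    and transversal: "\<And>i j x. i \<in> I \<Longrightarrow> j \<in> I \<Longrightarrow> i \<noteq> j \<Longrightarrow> n i \<bullet> x + c i = 0 \<Longrightarrow> n j \<bullet> x + c j = 0
      \<Longrightarrow> cross2 (n i) (n j) \<noteq> 0"
begin

definition l :: "'i \<Rightarrow> pt \<Rightarrow> real" where "l i x = n i \<bullet> x + c i"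

definition tsum :: "('i \<Rightarrow> real) \<Rightarrow> pt \<Rightarrow> real" where "tsum a y = (\<Sum>i\<in>I. a i * tpow (l i y))"

text \<open>The sum contains all lines, also those that miss \<open>x\<close>; near \<open>x\<close>
  their truncated cubes are polynomials, so only the coefficients of lines through \<open>x\<close>
  are determined.\<close>

definition local_form :: "(pt \<Rightarrow> real) \<Rightarrow> pt \<Rightarrow> (pt \<Rightarrow> real) \<Rightarrow> ('i \<Rightarrow> real) \<Rightarrow> bool" where
  "local_form f x p a \<longleftrightarrow> cubic_poly p \<and> (\<forall>\<^sub>F y in nhds x. f y = p y + tsum a y)"

lemma l_tendsto: "(l i \<longlongrightarrow> l i x) (nhds x)"
  unfolding l_def by (intro tendsto_intros filterlim_ident)

lemma l_continuous: "continuous_on S (l i)"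
  unfolding l_def by (intro continuous_intros)

lemma tsum_continuous: "continuous_on S (tsum a)"
  unfolding tsum_def tpow_def l_def by (intro continuous_intros)

lemma l_cube: "cubic_poly (\<lambda>y. l i y ^ 3)"
  unfolding l_def by (rule cubic_poly_affine_cube)

lemma l_add: "l i (x + v) = l i x + n i \<bullet> v"
  by (simp add: l_def inner_add_right)

lemma eventually_sign:
  assumes "l i x \<noteq> 0"
  shows "\<forall>\<^sub>F y in nhds x. (0 < l i y \<longleftrightarrow> 0 < l i x) \<and> l i y \<noteq> 0"
proof (cases "0 < l i x")
  case True
  then show ?thesis using order_tendstoD(1)[OF l_tendsto True] by (auto elim: eventually_mono)
next
  case False
  then have "l i x < 0" using assms by simp
  from order_tendstoD(2)[OF l_tendsto this] show ?thesis using False by (auto elim: eventually_mono)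
qed

lemma inactive_polynomial:
  assumes "J \<subseteq> I" "\<And>i. i \<in> J \<Longrightarrow> l i x \<noteq> 0"
  obtains r where "cubic_poly r" "\<forall>\<^sub>F y in nhds x. (\<Sum>i\<in>J. a i * tpow (l i y)) = r y"
proof -
  have finJ: "finite J" using assms(1) fin by (rule finite_subset)
  have "\<forall>\<^sub>F y in nhds x. \<forall>i\<in>J. (0 < l i y \<longleftrightarrow> 0 < l i x) \<and> l i y \<noteq> 0"
    using assms(2) eventually_sign finJ by (simp add: eventually_ball_finite)
  then have "\<forall>\<^sub>F y in nhds x. (\<Sum>i\<in>J. a i * tpow (l i y)) = (\<Sum>i\<in>J. if 0 < l i x then a i * l i y ^ 3 else 0)"
    by (rule eventually_mono) (auto intro!: sum.cong simp: tpow_simps)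
  moreover have "cubic_poly (\<lambda>y. \<Sum>i\<in>J. if 0 < l i x then a i * l i y ^ 3 else 0)"
  proof (rule cubic_poly_sum)
    fix i show "cubic_poly (\<lambda>y. if 0 < l i x then a i * l i y ^ 3 else 0)"
      by (cases "0 < l i x") (simp_all add: cubic_poly_cmult l_cube cubic_poly_zero)
  qed
  ultimately show ?thesis using that by blast
qed

lemma tsum_split:
  assumes "J \<subseteq> I" shows "tsum a y = (\<Sum>i\<in>J. a i * tpow (l i y)) + (\<Sum>i\<in>I - J. a i * tpow (l i y))"
  unfolding tsum_def using sum.subset_diff[OF assms fin] by (simp add: add.commute)

text \<open>Sliding from \<open>x\<close> along line \<open>i\<close> reaches a point that no other
  line meets. There the negative side shows that the polynomial part vanishes identically, and the
  positive side leaves only the cube with factor \<open>a i\<close>.\<close>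

lemma local_form_coefficients_zero:
  assumes p: "cubic_poly p" and z: "\<forall>\<^sub>F y in nhds x. p y + tsum a y = 0" and i: "i \<in> I" "l i x = 0"
  shows "a i = 0"
proof -
  have nu: "n i \<bullet> perp (n i) = 0" by (simp add: inner_perp cross2_def)
  let ?x = "\<lambda>t. x + t *\<^sub>R perp (n i)"
  have lim: "(?x \<longlongrightarrow> x) (at_right 0)" 
  proof -
    have "(?x \<longlongrightarrow> x + 0 *\<^sub>R perp (n i)) (at_right 0)" by (intro tendsto_intros)
    then show ?thesis by simp
  qed
  have ev1: "\<forall>\<^sub>F t in at_right 0. \<forall>\<^sub>F y in nhds (?x t). p y + tsum a y = 0"
    by (rule eventually_compose_filterlim[OF _ lim]) (simp add: eventually_eventually z)
  have ev2: "\<forall>\<^sub>F t in at_right 0. \<forall>j\<in>I - {i}. l j (?x t) \<noteq> 0"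
  proof (intro eventually_ball_finite ballI)
    fix j assume j: "j \<in> I - {i}"
    show "\<forall>\<^sub>F t in at_right 0. l j (?x t) \<noteq> 0"
    proof (cases "l j x = 0")
      case True
      then have "n j \<bullet> perp (n i) \<noteq> 0"
        using transversal[of j i x] j i by (simp add: inner_perp l_def)
      then show ?thesis using eventually_at_right_less[of "0::real"] True
        by (auto elim!: eventually_mono simp: l_add)
    next
      case False
      have "\<forall>\<^sub>F t in at_right 0. (0 < l j (?x t) \<longleftrightarrow> 0 < l j x) \<and> l j (?x t) \<noteq> 0"
        using eventually_sign[OF False] lim by (rule eventually_compose_filterlim)
      then show ?thesis by (rule eventually_mono) simp
    qed
  qed (use fin in simp)
  obtain t where t: "\<forall>\<^sub>F y in nhds (?x t). p y + tsum a y = 0" "\<forall>j\<in>I - {i}. l j (?x t) \<noteq> 0"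
    using eventually_happens[OF eventually_conj[OF ev1 ev2]] by auto
  let ?z = "?x t"
  have lz: "l i ?z = 0" using i nu by (simp add: l_add)
  obtain r where r: "cubic_poly r" "\<forall>\<^sub>F y in nhds ?z. (\<Sum>i\<in>I - {i}. a i * tpow (l i y)) = r y"
    using inactive_polynomial[of "I - {i}" ?z a] t(2) by auto
  have "\<forall>\<^sub>F y in nhds ?z. (p y + r y) + a i * tpow (l i y) = 0"
    using t(1) r(2) by eventually_elim (use i tsum_split[of "{i}" a] in auto)
  then obtain e where e: "0 < e" "\<And>y. y \<in> ball ?z e \<Longrightarrow> (p y + r y) + a i * tpow (l i y) = 0"
    unfolding eventually_nhds_metric by (auto simp: dist_commute)
  have ni: "0 < norm (n i)" using normal_nonzero[OF i(1)] by simp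
  define s where "s = e / (2 * norm (n i))"
  have s: "0 < s" "s * norm (n i) < e" using ni e by (simp_all add: s_def)
  have b: "?z + s *\<^sub>R n i \<in> ball ?z e" "?z - s *\<^sub>R n i \<in> ball ?z e"
    using s by (simp_all add: dist_norm)
  have lv: "l i (?z + s *\<^sub>R n i) > 0" "l i (?z - s *\<^sub>R n i) < 0"
    using lz s normal_nonzero[OF i(1)] l_add[of i ?z "s *\<^sub>R n i"] l_add[of i ?z "- (s *\<^sub>R n i)"] by simp_all
  have zero: "p y + r y = 0" for y
  proof (rule cubic_poly_eq_zero[OF cubic_poly_add[OF p r(1)]])
    show "open (ball ?z e \<inter> {y. l i y < 0})"
      by (intro open_Int open_ball open_Collect_less l_continuous continuous_on_const)
    show "ball ?z e \<inter> {y. l i y < 0} \<noteq> {}" using b(2) lv(2) by blast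
    show "p y + r y = 0" if "y \<in> ball ?z e \<inter> {y. l i y < 0}" for y
      using e(2)[of y] that by (simp add: tpow_simps)
  qed
  show ?thesis using e(2)[OF b(1)] lv(1) zero by (simp add: tpow_simps)
qed

lemma local_form_unique:
  assumes "local_form f x p a" "local_form f x q b" "i \<in> I" "l i x = 0" shows "a i = b i"
proof -
  have "\<forall>\<^sub>F y in nhds x. (p y - q y) + tsum (\<lambda>i. a i - b i) y = 0"
    using assms(1,2)[unfolded local_form_def, THEN conjunct2]
    by eventually_elim (simp add: tsum_def left_diff_distrib sum_subtractf)
  from local_form_coefficients_zero[OF _ this assms(3,4)] show ?thesis
    using assms(1,2) by (simp add: local_form_def cubic_poly_diff)
qed

lemma eventually_local_form:
  assumes "local_form f x p a" shows "\<forall>\<^sub>F y in nhds x. local_form f y p a"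
  using assms unfolding local_form_def by (simp add: eventually_eventually)

lemma locally_constant_connected:
  assumes "connected S" "\<And>x. x \<in> S \<Longrightarrow> \<forall>\<^sub>F y in nhds x. y \<in> S \<longrightarrow> h y = h x" "x \<in> S" "y \<in> S"
  shows "h x = h y"
proof (rule connected_equivalence_relation[OF assms(1,3,4), where R = "\<lambda>x y. h x = h y"])
  fix a assume a: "a \<in> S"
  have "\<exists>U. open U \<and> a \<in> U \<and> (\<forall>y\<in>U. y \<in> S \<longrightarrow> h y = h a)"
    using assms(2)[OF a] by (simp only: eventually_nhds)
  then obtain U where U: "open U" "a \<in> U" "\<And>y. y \<in> U \<Longrightarrow> y \<in> S \<Longrightarrow> h y = h a" by blast
  show "\<exists>T. openin (top_of_set S) T \<and> a \<in> T \<and> (\<forall>x\<in>T. h a = h x)"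
  proof (intro exI conjI ballI)
    show "openin (top_of_set S) (S \<inter> U)" using U(1) by (rule openin_open_Int)
    show "a \<in> S \<inter> U" using a U(2) by blast
    show "h a = h x" if "x \<in> S \<inter> U" for x by (rule U(3)[symmetric]) (use that in blast)+
  qed
qed (simp_all only:)

text \<open>A convex set meets each line in a connected set, so a coefficient that is unique and
  locally constant is constant along it. After subtraction of these global terms, locally constant
  choices of a polynomial remain, and \<open>H\<close> is connected.\<close>

lemma patch:
  assumes H: "open H" "convex H" "H \<noteq> {}" and loc: "\<And>x. x \<in> H \<Longrightarrow> \<exists>p a. local_form f x p a"
  obtains p a where "cubic_poly p" "\<And>x. x \<in> H \<Longrightarrow> f x = p x + tsum a x"
proof -
  obtain P A where PA: "\<And>x. x \<in> H \<Longrightarrow> local_form f x (P x) (A x)" using loc by metis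
  have const: "A x i = A y i" if "i \<in> I" "x \<in> H" "y \<in> H" "l i x = 0" "l i y = 0" for i x y
  proof (rule locally_constant_connected[of "H \<inter> {x. l i x = 0}"])
    have "{x. l i x = 0} = {x. n i \<bullet> x = - c i}" by (auto simp: l_def)
    then show "connected (H \<inter> {x. l i x = 0})"
      by (simp add: convex_connected convex_Int H convex_hyperplane)
    fix x assume x: "x \<in> H \<inter> {x. l i x = 0}"
    then have "local_form f x (P x) (A x)" using PA by simp
    from eventually_local_form[OF this]
    show "\<forall>\<^sub>F y in nhds x. y \<in> H \<inter> {x. l i x = 0} \<longrightarrow> A y i = A x i"
      by (rule eventually_mono) (use PA that(1) local_form_unique in blast)
  qed (use that in auto)
  \<comment> \<open>For a line that misses \<open>H\<close> the choice is arbitrary, which is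
    harmless: its truncated cube is polynomial near every point of \<open>H\<close>.\<close>
  define a where "a = (\<lambda>i. A (SOME x. x \<in> H \<and> l i x = 0) i)"
  have a: "A x i = a i" if "i \<in> I" "x \<in> H" "l i x = 0" for i x
  proof -
    have "\<exists>x. x \<in> H \<and> l i x = 0" using that by blast
    from someI_ex[OF this] have "(SOME x. x \<in> H \<and> l i x = 0) \<in> H" "l i (SOME x. x \<in> H \<and> l i x = 0) = 0"
      by simp_all
    from const[OF that(1,2) this(1) that(3) this(2)] show ?thesis unfolding a_def .
  qed
  have "\<exists>q. cubic_poly q \<and> (\<forall>\<^sub>F y in nhds x. f y - tsum a y = q y)" if x: "x \<in> H" for x
  proof -
    let ?J = "{i\<in>I. l i x \<noteq> 0}"
    obtain r where r: "cubic_poly r" "\<forall>\<^sub>F y in nhds x. (\<Sum>i\<in>?J. (A x i - a i) * tpow (l i y)) = r y"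
      by (rule inactive_polynomial[of ?J x "\<lambda>i. A x i - a i"]) (use that in auto)
    have "tsum (\<lambda>i. A x i - a i) y = (\<Sum>i\<in>?J. (A x i - a i) * tpow (l i y))" for y
    proof -
      have "(\<Sum>i\<in>I - ?J. (A x i - a i) * tpow (l i y)) = 0"
        by (intro sum.neutral) (use a x in auto)
      then show ?thesis using tsum_split[of ?J "\<lambda>i. A x i - a i" y] by auto
    qed
    then have deq: "tsum (A x) y - tsum a y = (\<Sum>i\<in>?J. (A x i - a i) * tpow (l i y))" for y
      by (simp add: tsum_def left_diff_distrib sum_subtractf)
    have "\<forall>\<^sub>F y in nhds x. f y - tsum a y = P x y + r y"
      using PA[OF x, unfolded local_form_def, THEN conjunct2] r(2)
    proof eventually_elim
      case (elim y)
      then show ?case using deq[of y] by linarith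
    qed
    then show ?thesis using PA[OF x] r(1) by (intro exI[of _ "\<lambda>y. P x y + r y"]) (simp add: cubic_poly_add local_form_def)
  qed
  then obtain Q where Q: "\<And>x. x \<in> H \<Longrightarrow> cubic_poly (Q x)" "\<And>x. x \<in> H \<Longrightarrow> \<forall>\<^sub>F y in nhds x. f y - tsum a y = Q x y"
    by metis
  obtain x0 where x0: "x0 \<in> H" using H by blast
  have "Q x = Q x0" if "x \<in> H" for x
  proof (rule locally_constant_connected[of H Q])
    fix x assume x: "x \<in> H"
    show "\<forall>\<^sub>F y in nhds x. y \<in> H \<longrightarrow> Q y = Q x"
      using Q(2)[OF x, THEN eventually_eventually[THEN iffD2]]
    proof eventually_elim
      case (elim y)
      show ?case
      proof
        assume y: "y \<in> H"
        have "\<forall>\<^sub>F z in nhds y. Q y z = Q x z" using elim Q(2)[OF y] by eventually_elim simp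
        then obtain U where "open U" "y \<in> U" "\<forall>z\<in>U. Q y z = Q x z" unfolding eventually_nhds by blast
        then show "Q y = Q x" using Q(1)[OF x] Q(1)[OF y] by (intro cubic_poly_eqI[of _ _ U]) auto
      qed
    qed
  qed (use that x0 H convex_connected in auto)
  then have "f x = Q x0 x + tsum a x" if "x \<in> H" for x
    using eventually_nhds_x_imp_x[OF Q(2)[OF that]] that by simp
  then show ?thesis using that Q(1)[OF x0] by blast
qed

section \<open>Existence of local forms on a single line and at a vertex\<close>

lemma tsum_zero: "tsum (\<lambda>i. 0) y = 0"
  by (simp add: tsum_def)

lemma tsum_single: "i \<in> I \<Longrightarrow> tsum (\<lambda>j. if j = i then k else 0) y = k * tpow (l i y)"
  unfolding tsum_def using fin by (subst sum.remove[of _ i]) (auto intro!: sum.neutral)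

lemma open_pos: "open {y. 0 < l i y}" and open_neg: "open {y. l i y < 0}"
  by (intro open_Collect_less l_continuous continuous_on_const)+

lemma convex_pos: "convex {y. 0 < l i y}" and convex_neg: "convex {y. l i y < 0}"
proof -
  have "{y. 0 < l i y} = {y. n i \<bullet> y > - c i}" "{y. l i y < 0} = {y. n i \<bullet> y < - c i}" by (auto simp: l_def)
  then show "convex {y. 0 < l i y}" "convex {y. l i y < 0}"
    by (simp_all add: convex_halfspace_gt convex_halfspace_lt)
qed

text \<open>Off the lines \<open>g\<close> is one polynomial near \<open>y\<close>; on a line the
  two sides carry one polynomial each, and \<open>C2_across_line\<close> compares them.\<close>

lemma local_form_single_line:
  assumes C2: "C2_open U g" and e: "0 < e" "ball y e \<subseteq> U"
    and one: "\<And>i j. i \<in> I \<Longrightarrow> j \<in> I \<Longrightarrow> l i y = 0 \<Longrightarrow> l j y = 0 \<Longrightarrow> i = j"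
    and poly: "\<And>C. convex C \<Longrightarrow> C \<subseteq> ball y e \<Longrightarrow> (\<forall>i\<in>I. \<forall>z\<in>C. l i z \<noteq> 0) \<Longrightarrow> \<exists>q. cubic_poly q \<and> (\<forall>z\<in>C. g z = q z)"
  shows "\<exists>p a. local_form g y p a"
proof -
  have "\<forall>\<^sub>F z in nhds y. \<forall>i\<in>{i\<in>I. l i y \<noteq> 0}. l i z \<noteq> 0"
  proof (intro eventually_ball_finite ballI)
    fix i assume "i \<in> {i\<in>I. l i y \<noteq> 0}"
    then have "l i y \<noteq> 0" by simp
    from eventually_sign[OF this] show "\<forall>\<^sub>F z in nhds y. l i z \<noteq> 0" by (rule eventually_mono) simp
  qed (use fin in simp)
  then obtain e1 where e1: "0 < e1" "\<And>z. dist z y < e1 \<Longrightarrow> \<forall>i\<in>{i\<in>I. l i y \<noteq> 0}. l i z \<noteq> 0"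
    unfolding eventually_nhds_metric by blast
  define d where "d = min e e1"
  have d: "0 < d" "ball y d \<subseteq> ball y e" "ball y d \<subseteq> U" using e e1 by (auto simp: d_def)
  have off: "l i z \<noteq> 0" if "z \<in> ball y d" "i \<in> I" "l i y \<noteq> 0" for i z
    using e1(2)[of z] that by (simp add: d_def dist_commute)
  have ev: "\<forall>\<^sub>F z in nhds y. z \<in> ball y d" using d(1) by (intro eventually_nhds_in_open) auto
  show ?thesis
  proof (cases "\<exists>i\<in>I. l i y = 0")
    case False
    then obtain q where q: "cubic_poly q" "\<forall>z\<in>ball y d. g z = q z"
      using poly[of "ball y d"] d off by auto
    have "local_form g y q (\<lambda>i. 0)"
      unfolding local_form_def tsum_zero using q ev by (auto elim: eventually_mono)
    then show ?thesis by blast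
  next
    case True
    then obtain i where i: "i \<in> I" "l i y = 0" by blast
    have offi: "l j z \<noteq> 0" if "z \<in> ball y d" "j \<in> I" "j \<noteq> i" for j z
      using off[OF that(1,2)] one[OF that(2) i(1) _ i(2)] that(3) by blast
    have "\<exists>q. cubic_poly q \<and> (\<forall>z\<in>ball y d \<inter> {z. 0 < l i z}. g z = q z)"
    proof (rule poly)
      show "convex (ball y d \<inter> {z. 0 < l i z})" by (intro convex_Int convex_ball convex_pos)
      show "\<forall>j\<in>I. \<forall>z\<in>ball y d \<inter> {z. 0 < l i z}. l j z \<noteq> 0"
      proof (intro ballI)
        fix j z assume "j \<in> I" "z \<in> ball y d \<inter> {z. 0 < l i z}"
        then show "l j z \<noteq> 0" using offi[of z j] by (cases "j = i") auto
      qed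
    qed (use d in auto)
    then obtain q where q: "cubic_poly q" "\<forall>z\<in>ball y d \<inter> {z. 0 < l i z}. g z = q z" by blast
    have "\<exists>q. cubic_poly q \<and> (\<forall>z\<in>ball y d \<inter> {z. l i z < 0}. g z = q z)"
    proof (rule poly)
      show "convex (ball y d \<inter> {z. l i z < 0})" by (intro convex_Int convex_ball convex_neg)
      show "\<forall>j\<in>I. \<forall>z\<in>ball y d \<inter> {z. l i z < 0}. l j z \<noteq> 0"
      proof (intro ballI)
        fix j z assume "j \<in> I" "z \<in> ball y d \<inter> {z. l i z < 0}"
        then show "l j z \<noteq> 0" using offi[of z j] by (cases "j = i") auto
      qed
    qed (use d in auto)
    then obtain r where r: "cubic_poly r" "\<forall>z\<in>ball y d \<inter> {z. l i z < 0}. g z = r z" by blast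
    have "\<exists>k. \<forall>\<^sub>F z in nhds y. g z = r z + k * tpow (n i \<bullet> z + c i)"
    proof (rule C2_across_line[OF C2 d(1,3) normal_nonzero[OF i(1)] _ q(1) _ r(1)])
      show "n i \<bullet> y + c i = 0" using i by (simp add: l_def)
      show "g z = q z" if "z \<in> ball y d" "0 < n i \<bullet> z + c i" for z using q(2) that by (simp add: l_def)
      show "g z = r z" if "z \<in> ball y d" "n i \<bullet> z + c i < 0" for z using r(2) that by (simp add: l_def)
    qed blast
    then obtain k where k: "\<forall>\<^sub>F z in nhds y. g z = r z + k * tpow (n i \<bullet> z + c i)" ..
    have "local_form g y r (\<lambda>j. if j = i then k else 0)"
      unfolding local_form_def tsum_single[OF i(1)] l_def using r(1) k by blast
    then show ?thesis by blast
  qed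
qed

text \<open>Among the directions (1, t) each line excludes at most one value of
  \<open>t\<close>.\<close>

lemma exists_transversal_direction:
  obtains u :: pt where "\<And>i. i \<in> I \<Longrightarrow> n i \<bullet> u \<noteq> 0"
proof -
  have "finite (\<Union>i\<in>I. {t. n i$1 + t * n i$2 = 0})"
  proof (intro finite_UN_I fin)
    fix i assume i: "i \<in> I"
    have "{t. n i$1 + t * n i$2 = 0} \<subseteq> {- n i$1 / n i$2}"
    proof
      fix t assume "t \<in> {t. n i$1 + t * n i$2 = 0}"
      then have t: "n i$1 + t * n i$2 = 0" by simp
      have "n i$2 \<noteq> 0"
      proof
        assume "n i$2 = 0"
        with t have "n i = 0" by (simp add: vec_eq_iff forall_2)
        then show False using normal_nonzero[OF i] by simp
      qed
      then show "t \<in> {- n i$1 / n i$2}" using t by (simp add: field_simps)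
    qed
    then show "finite {t. n i$1 + t * n i$2 = 0}" by (rule finite_subset) simp
  qed
  then obtain t where t: "t \<notin> (\<Union>i\<in>I. {t. n i$1 + t * n i$2 = 0})"
    using ex_new_if_finite[OF infinite_UNIV_char_0] by blast
  show ?thesis
    by (rule that[of "vector [1, t]"]) (use t in \<open>auto simp: inner_vec_def sum_2 vector_2 mult.commute\<close>)
qed

text \<open>On the two open half discs cut off by a line through the vertex in general position the lines of the
  family are pairwise disjoint, so the local forms can be patched there. Comparing the two results at
  both ends of the cutting line shows that the coefficients agree.\<close>

lemma local_form_vertex:
  assumes C2: "C2_open U g" and e: "0 < e" "ball x e \<subseteq> U"
    and x: "\<And>i. i \<in> I \<Longrightarrow> l i x = 0" and card: "card I \<le> 4"
    and poly: "\<And>C. convex C \<Longrightarrow> C \<subseteq> ball x e \<Longrightarrow> (\<forall>i\<in>I. \<forall>z\<in>C. l i z \<noteq> 0) \<Longrightarrow> \<exists>q. cubic_poly q \<and> (\<forall>z\<in>C. g z = q z)"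
  shows "\<exists>p a. local_form g x p a"
proof -
  have crs: "cross2 (n i) (n j) \<noteq> 0" if "i \<in> I" "j \<in> I" "i \<noteq> j" for i j
    using transversal[OF that, of x] x[OF that(1)] x[OF that(2)] by (simp add: l_def)
  have lx: "l i (x + v) = n i \<bullet> v" if "i \<in> I" for i v using x[OF that] by (simp add: l_add)
  obtain u where u: "\<And>i. i \<in> I \<Longrightarrow> n i \<bullet> u \<noteq> 0" by (rule exists_transversal_direction) blast
  \<comment> \<open>For an empty family \<open>u\<close> may be zero, but the cutting line still
    needs a direction.\<close>
  define u' where "u' = (if u = 0 then axis 1 1 else u)"
  have u': "u' \<noteq> 0" "\<And>i. i \<in> I \<Longrightarrow> n i \<bullet> u' \<noteq> 0" using u by (auto simp: u'_def axis_eq_0_iff)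
  define m where "m = perp u'"
  have mu: "m \<bullet> u' = 0" by (simp add: m_def inner_perp cross2_def)
  have m0: "m \<noteq> 0" using u'(1) by (auto simp: m_def perp_def vec_eq_iff forall_2 vector_2)
  \<comment> \<open>The signs 1 and -1 of \<open>s\<close> give the two half discs, so one argument
    covers both.\<close>
  define H where "H = (\<lambda>s::real. ball x e \<inter> {y. 0 < s * (m \<bullet> (y - x))})"
  have Hin: "H s \<subseteq> ball x e" for s by (auto simp: H_def)
  have Hopen: "open (H s)" for s
    unfolding H_def by (intro open_Int open_ball open_Collect_less continuous_intros)
  have "{y. 0 < s * (m \<bullet> (y - x))} = {y. (s *\<^sub>R m) \<bullet> y > s * (m \<bullet> x)}" for s
    by (auto simp: inner_diff_right algebra_simps)
  then have "convex {y. 0 < s * (m \<bullet> (y - x))}" for s by (simp only: convex_halfspace_gt)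
  then have Hconvex: "convex (H s)" for s unfolding H_def by (intro convex_Int convex_ball)
  have mm: "0 < m \<bullet> m" using m0 by simp
  have Hne: "x + v + t *\<^sub>R (s *\<^sub>R m) \<in> H s" if "s \<noteq> 0" "m \<bullet> v = 0" "0 < t" "x + v + t *\<^sub>R (s *\<^sub>R m) \<in> ball x e" for s t v
  proof -
    have "s * (m \<bullet> ((x + v + t *\<^sub>R (s *\<^sub>R m)) - x)) = t * (s * s) * (m \<bullet> m)"
      using that(2) by (simp add: inner_add_right algebra_simps)
    also have "0 < t * (s * s) * (m \<bullet> m)"
      using that(1) by (intro mult_pos_pos[OF mult_pos_pos[OF that(3) _] mm]) (simp add: zero_less_mult_iff, linarith)
    finally show ?thesis unfolding H_def using that(4) by blast
  qed
  have half: "\<exists>p a. cubic_poly p \<and> (\<forall>y\<in>H s. g y = p y + tsum a y)" if s: "s \<noteq> 0" for s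
  proof -
    have "H s \<noteq> {}"
    proof -
      have "((\<lambda>t. x + 0 + t *\<^sub>R (s *\<^sub>R m)) \<longlongrightarrow> x + 0 + 0 *\<^sub>R (s *\<^sub>R m)) (at_right 0)" by (intro tendsto_intros)
      then have "\<forall>\<^sub>F t in at_right 0. x + 0 + t *\<^sub>R (s *\<^sub>R m) \<in> ball x e" using e(1) by (intro topological_tendstoD) auto
      from eventually_happens[OF eventually_conj[OF this eventually_at_right_less[of 0]]]
      obtain t where "x + 0 + t *\<^sub>R (s *\<^sub>R m) \<in> ball x e" "0 < t" by auto
      then show ?thesis using Hne[OF s, of 0 t] by auto
    qed
    have loc: "\<exists>p a. local_form g y p a" if y: "y \<in> H s" for y
    proof -
      obtain d where d: "0 < d" "ball y d \<subseteq> H s" using openE[OF Hopen y] by blast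
      have yx: "y \<noteq> x" using y by (auto simp: H_def)
      show ?thesis
      proof (rule local_form_single_line[OF C2 d(1)])
        show "ball y d \<subseteq> U" using d(2) Hin e(2) by blast
        show "i = j" if ij: "i \<in> I" "j \<in> I" "l i y = 0" "l j y = 0" for i j
        proof (rule ccontr)
          assume ne: "i \<noteq> j"
          have "n i \<bullet> (y - x) = 0" "n j \<bullet> (y - x) = 0" using lx[of i "y - x"] lx[of j "y - x"] ij by simp_all
          then have "y - x = 0" by (rule cross2_cancel[OF crs[OF ij(1,2) ne]])
          then show False using yx by simp
        qed
        show "\<exists>q. cubic_poly q \<and> (\<forall>z\<in>C. g z = q z)"
          if "convex C" "C \<subseteq> ball y d" "\<forall>i\<in>I. \<forall>z\<in>C. l i z \<noteq> 0" for C
          using poly[OF that(1) _ that(3)] that(2) d(2) Hin by blast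
      qed
    qed
    obtain p a where "cubic_poly p" "\<And>y. y \<in> H s \<Longrightarrow> g y = p y + tsum a y"
      using patch[OF Hopen Hconvex \<open>H s \<noteq> {}\<close> loc] by metis
    then show ?thesis by blast
  qed
  obtain P A where P: "cubic_poly P" "\<And>y. y \<in> H 1 \<Longrightarrow> g y = P y + tsum A y"
    using half[of 1] by auto
  obtain R B where R: "cubic_poly R" "\<And>y. y \<in> H (-1) \<Longrightarrow> g y = R y + tsum B y"
    using half[of "-1"] by auto
  \<comment> \<open>The polynomial that \<open>tsum a\<close> equals near the end of the cutting
    line in direction \<open>\<sigma>\<close>: exactly the lines with positive sign there
    contribute.\<close>
  define side where "side = (\<lambda>\<sigma> a y. \<Sum>i\<in>I. (if 0 < \<sigma> * (n i \<bullet> u') then a i else 0) * l i y ^ 3)"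
  have side_cubic: "cubic_poly (side \<sigma> a)" for \<sigma> a
    unfolding side_def by (intro cubic_poly_sum cubic_poly_cmult l_cube)
  have eq: "P y + side \<sigma> A y = R y + side \<sigma> B y" if \<sigma>: "\<sigma> = 1 \<or> \<sigma> = -1" for \<sigma> y
  proof -
    have "((\<lambda>t. x + t *\<^sub>R (\<sigma> *\<^sub>R u')) \<longlongrightarrow> x + 0 *\<^sub>R (\<sigma> *\<^sub>R u')) (at_right 0)" by (intro tendsto_intros)
    then have "\<forall>\<^sub>F t in at_right 0. x + t *\<^sub>R (\<sigma> *\<^sub>R u') \<in> ball x e" using e(1) by (intro topological_tendstoD) auto
    from eventually_happens[OF eventually_conj[OF this eventually_at_right_less[of 0]]]
    obtain t where t: "x + t *\<^sub>R (\<sigma> *\<^sub>R u') \<in> ball x e" "0 < t" by auto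
    define z where "z = x + t *\<^sub>R (\<sigma> *\<^sub>R u')"
    have lz: "l i z = t * (\<sigma> * (n i \<bullet> u'))" if "i \<in> I" for i unfolding z_def lx[OF that] by simp
    have lz0: "l i z \<noteq> 0" if "i \<in> I" for i using u'(2)[OF that] t(2) \<sigma> by (auto simp: lz[OF that])
    have sgn: "0 < l i z \<longleftrightarrow> 0 < \<sigma> * (n i \<bullet> u')" if "i \<in> I" for i
      using t(2) by (simp add: lz[OF that] zero_less_mult_iff)
    have "\<forall>\<^sub>F y in nhds z. \<forall>i\<in>I. (0 < l i y \<longleftrightarrow> 0 < l i z) \<and> l i y \<noteq> 0"
      using fin lz0 eventually_sign by (intro eventually_ball_finite) auto
    moreover have "\<forall>\<^sub>F y in nhds z. y \<in> ball x e"
      using t(1) by (intro eventually_nhds_in_open) (auto simp: z_def)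
    ultimately have "\<forall>\<^sub>F y in nhds z. y \<in> ball x e \<and> (\<forall>i\<in>I. (0 < l i y \<longleftrightarrow> 0 < l i z) \<and> l i y \<noteq> 0)"
      by eventually_elim blast
    then obtain d where d: "0 < d" "\<And>y. dist y z < d \<Longrightarrow> y \<in> ball x e \<and> (\<forall>i\<in>I. (0 < l i y \<longleftrightarrow> 0 < l i z) \<and> l i y \<noteq> 0)"
      unfolding eventually_nhds_metric by blast
    have "\<exists>q. cubic_poly q \<and> (\<forall>y\<in>ball z d. g y = q y)"
      by (rule poly) (use d(2) in \<open>auto simp: dist_commute\<close>)
    then obtain q where q: "cubic_poly q" "\<And>y. y \<in> ball z d \<Longrightarrow> g y = q y" by blast
    have ts: "tsum a y = side \<sigma> a y" if "y \<in> ball z d" for a y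
      unfolding tsum_def side_def
    proof (rule sum.cong[OF refl])
      fix i assume i: "i \<in> I"
      have "0 < l i y \<longleftrightarrow> 0 < \<sigma> * (n i \<bullet> u')" using d(2)[of y] that i sgn[OF i] by (simp add: dist_commute)
      then show "a i * tpow (l i y) = (if 0 < \<sigma> * (n i \<bullet> u') then a i else 0) * l i y ^ 3"
        by (auto simp: tpow_simps)
    qed
    \<comment> \<open>A ball around a point of the cutting line meets both half discs, so both
      representations can be compared with the same \<open>q\<close>.\<close>
    have meet: "ball z d \<inter> H s \<noteq> {}" if s: "s \<noteq> 0" for s
    proof -
      have "((\<lambda>r. z + r *\<^sub>R (s *\<^sub>R m)) \<longlongrightarrow> z + 0 *\<^sub>R (s *\<^sub>R m)) (at_right 0)" by (intro tendsto_intros)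
      then have "\<forall>\<^sub>F r in at_right 0. z + r *\<^sub>R (s *\<^sub>R m) \<in> ball z d" using d(1) by (intro topological_tendstoD) auto
      from eventually_happens[OF eventually_conj[OF this eventually_at_right_less[of 0]]]
      obtain r where r: "z + r *\<^sub>R (s *\<^sub>R m) \<in> ball z d" "0 < r" by auto
      have "z + r *\<^sub>R (s *\<^sub>R m) \<in> ball x e"
        using d(2)[of "z + r *\<^sub>R (s *\<^sub>R m)"] r(1) by (simp add: dist_commute)
      then have "z + r *\<^sub>R (s *\<^sub>R m) \<in> H s"
        unfolding z_def by (intro Hne s r(2)) (simp_all add: mu)
      then show ?thesis using r(1) by blast
    qed
    have 1: "(\<lambda>y. P y + side \<sigma> A y) = q"
    proof (rule cubic_poly_eqI)
      show "open (ball z d \<inter> H 1)" using Hopen by blast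
      show "P y + side \<sigma> A y = q y" if "y \<in> ball z d \<inter> H 1" for y
        using P(2)[of y] q(2)[of y] ts[of y A] that by simp
    qed (use meet[of 1] q(1) in \<open>simp_all add: cubic_poly_add P side_cubic\<close>)
    have 2: "(\<lambda>y. R y + side \<sigma> B y) = q"
    proof (rule cubic_poly_eqI)
      show "open (ball z d \<inter> H (-1))" using Hopen by blast
      show "R y + side \<sigma> B y = q y" if "y \<in> ball z d \<inter> H (-1)" for y
        using R(2)[of y] q(2)[of y] ts[of y B] that by simp
    qed (use meet[of "-1"] q(1) in \<open>simp_all add: cubic_poly_add R side_cubic\<close>)
    show ?thesis using fun_cong[OF 1, of y] fun_cong[OF 2, of y] by simp
  qed
  have AB: "A i = B i" if i: "i \<in> I" for i
  proof -
    \<comment> \<open>Every line is positive at exactly one end of the cutting line. Subtracting the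
      identities for the two ends removes \<open>P\<close> and \<open>R\<close> and leaves each cube
      with the sign of its end.\<close>
    let ?b = "\<lambda>i. (if 0 < n i \<bullet> u' then 1 else -1) * (A i - B i)"
    have "(\<Sum>i\<in>I. ?b i * (n i \<bullet> v)^3) = 0" for v
    proof -
      have "side 1 A (x + v) - side (-1) A (x + v) - (side 1 B (x + v) - side (-1) B (x + v)) = 0"
        using eq[of 1 "x + v"] eq[of "-1" "x + v"] by simp
      moreover have "side 1 A (x + v) - side (-1) A (x + v) - (side 1 B (x + v) - side (-1) B (x + v)) = (\<Sum>i\<in>I. ?b i * (n i \<bullet> v)^3)"
        unfolding side_def sum_subtractf[symmetric]
      proof (rule sum.cong[OF refl])
        fix i assume i: "i \<in> I"
        show "(if 0 < 1 * (n i \<bullet> u') then A i else 0) * l i (x + v) ^ 3 - (if 0 < -1 * (n i \<bullet> u') then A i else 0) * l i (x + v) ^ 3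
          - ((if 0 < 1 * (n i \<bullet> u') then B i else 0) * l i (x + v) ^ 3 - (if 0 < -1 * (n i \<bullet> u') then B i else 0) * l i (x + v) ^ 3)
          = ?b i * (n i \<bullet> v)^3"
          using u'(2)[OF i] unfolding lx[OF i] by (auto simp: algebra_simps)
      qed
      ultimately show ?thesis by simp
    qed
    from cubes_independent[where n = n and b = ?b, OF fin card crs normal_nonzero this i]
    have "?b i = 0" .
    then show ?thesis by (simp split: if_splits)
  qed
  have tAB: "tsum A = tsum B" unfolding tsum_def using AB by (intro ext sum.cong) auto
  have PR: "P y = R y" for y
  proof -
    have "side 1 A y = side 1 B y" unfolding side_def using AB by (intro sum.cong) auto
    then show ?thesis using eq[of 1 y] by simp
  qed
  have g_cont: "continuous_on U g"
    using C2 unfolding C2_open_def by (intro continuous_at_imp_continuous_on ballI differentiable_imp_continuous_within) blast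
  have "g y = P y + tsum A y" if y: "y \<in> ball x e" for y
  proof -
    consider "0 < m \<bullet> (y - x)" | "m \<bullet> (y - x) < 0" | "m \<bullet> (y - x) = 0" by linarith
    then show ?thesis
    proof cases
      case 1
      then have "y \<in> H 1" using y by (simp add: H_def)
      then show ?thesis by (rule P(2))
    next
      case 2
      then have "y \<in> H (-1)" using y by (simp add: H_def)
      then show ?thesis using R(2) PR tAB by simp
    next
      \<comment> \<open>Points of the cutting line lie in neither half disc; they are reached from
        \<open>H 1\<close> by continuity.\<close>
      case 3
      have lim: "((\<lambda>t. y + t *\<^sub>R m) \<longlongrightarrow> y) (at_right 0)"
      proof -
        have "((\<lambda>t. y + t *\<^sub>R m) \<longlongrightarrow> y + 0 *\<^sub>R m) (at_right 0)" by (intro tendsto_intros)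
        then show ?thesis by simp
      qed
      have inb: "\<forall>\<^sub>F t in at_right 0. y + t *\<^sub>R m \<in> ball x e" using y lim by (intro topological_tendstoD) auto
      have "isCont g y" using g_cont C2 y e(2) unfolding C2_open_def by (auto simp: continuous_on_eq_continuous_at)
      then have l1: "((\<lambda>t. g (y + t *\<^sub>R m)) \<longlongrightarrow> g y) (at_right 0)" by (rule isCont_tendsto_compose[OF _ lim])
      have "isCont (\<lambda>y. P y + tsum A y) y"
        using cubic_poly_continuous[OF P(1), of UNIV] tsum_continuous[of UNIV A]
        by (auto intro!: continuous_intros simp: continuous_on_eq_continuous_at)
      then have l2: "((\<lambda>t. P (y + t *\<^sub>R m) + tsum A (y + t *\<^sub>R m)) \<longlongrightarrow> P y + tsum A y) (at_right 0)"
        by (rule isCont_tendsto_compose[OF _ lim])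
      have ev: "\<forall>\<^sub>F t in at_right 0. g (y + t *\<^sub>R m) = P (y + t *\<^sub>R m) + tsum A (y + t *\<^sub>R m)"
        using inb eventually_at_right_less[of "0::real"]
      proof eventually_elim
        case (elim t)
        have "y + t *\<^sub>R m \<in> H 1"
          using Hne[of 1 "y - x" t] elim 3 by simp
        then show ?case by (rule P(2))
      qed
      have "((\<lambda>t. g (y + t *\<^sub>R m)) \<longlongrightarrow> P y + tsum A y) (at_right 0)"
        using l2 tendsto_cong[OF ev] by blast
      then show ?thesis using l1 by (intro tendsto_unique[OF trivial_limit_at_right_real])
    qed
  qed
  moreover have "\<forall>\<^sub>F y in nhds x. y \<in> ball x e" using e(1) by (intro eventually_nhds_in_open) auto
  ultimately have "local_form g x P A"
    unfolding local_form_def using P(1) by (auto elim: eventually_mono)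
  then show ?thesis by blast
qed

end

section \<open>Slices of lifted simplices\<close>

text \<open>Twice the signed area of the triangle.\<close>

definition orient :: "pt \<Rightarrow> pt \<Rightarrow> pt \<Rightarrow> real" where
  "orient u v w = (u$1 - w$1) * (v$2 - w$2) - (v$1 - w$1) * (u$2 - w$2)"

text \<open>The coordinate of \<open>x\<close> belonging to \<open>u\<close>; the other two arise by
  rotating the arguments.\<close>

definition bary :: "pt \<Rightarrow> pt \<Rightarrow> pt \<Rightarrow> pt \<Rightarrow> real" where
  "bary u v w x = orient x v w / orient u v w"

lemma orient_rotate: "orient v w u = orient u v w"
  by (simp add: orient_def algebra_simps)

lemma orient_nonzero:
  assumes "\<not> collinear {u, v, w}" shows "orient u v w \<noteq> 0"
proof
  assume 0: "orient u v w = 0"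
  have "u \<noteq> w" using assms by (auto simp: insert_commute)
  then have nz: "u$1 - w$1 \<noteq> 0 \<or> u$2 - w$2 \<noteq> 0" by (auto simp: vec_eq_iff forall_2)
  have "\<exists>c. v - w = c *\<^sub>R (u - w)"
  proof (cases "u$1 - w$1 = 0")
    case True
    with 0 nz have "v$1 - w$1 = 0" by (simp add: orient_def)
    then have "v - w = ((v$2 - w$2) / (u$2 - w$2)) *\<^sub>R (u - w)"
      using nz True by (simp add: vec_eq_iff forall_2)
    then show ?thesis by blast
  next
    case False
    then have "v$2 - w$2 = (v$1 - w$1) / (u$1 - w$1) * (u$2 - w$2)"
      using 0 by (subst times_divide_eq_left, subst eq_divide_eq) (simp add: orient_def mult.commute)
    then have "v - w = ((v$1 - w$1) / (u$1 - w$1)) *\<^sub>R (u - w)"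
      using False by (simp add: vec_eq_iff forall_2)
    then show ?thesis by blast
  qed
  then obtain c where c: "v - w = c *\<^sub>R (u - w)" ..
  have "collinear {w, u, v}"
    unfolding collinear_def
  proof (intro exI[of _ "u - w"] ballI)
    have 1: "v = w + c *\<^sub>R (u - w)" "u = w + 1 *\<^sub>R (u - w)" "w = w + 0 *\<^sub>R (u - w)"
      using c by (simp_all add: algebra_simps)
    fix x y assume "x \<in> {w,u,v}" "y \<in> {w,u,v}"
    then obtain s t where "x = w + s *\<^sub>R (u - w)" "y = w + t *\<^sub>R (u - w)" using 1 by blast
    then have "x - y = (s - t) *\<^sub>R (u - w)" by (simp add: scaleR_left_diff_distrib)
    then show "\<exists>c. x - y = c *\<^sub>R (u - w)" ..
  qed
  then show False using assms by (simp add: insert_commute)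
qed

lemma bary_sum:
  assumes "orient u v w \<noteq> 0"
  shows "bary u v w x + bary v w u x + bary w u v x = 1"
proof -
  have "orient x v w + orient x w u + orient x u v = orient u v w"
    by (simp add: orient_def algebra_simps)
  then show ?thesis using assms
    unfolding bary_def orient_rotate[of v w u] orient_rotate[of u v w, symmetric]
    by (simp add: orient_rotate add_divide_distrib[symmetric])
qed

lemma bary_point:
  assumes "orient u v w \<noteq> 0"
  shows "x = bary u v w x *\<^sub>R u + bary v w u x *\<^sub>R v + bary w u v x *\<^sub>R w"
proof -
  have "orient u v w * x$k = orient x v w * u$k + orient x w u * v$k + orient x u v * w$k" for k
    using exhaust_2[of k] by (auto simp: orient_def algebra_simps)
  then have "x$k = bary u v w x * u$k + bary v w u x * v$k + bary w u v x * w$k" for k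
    using assms unfolding bary_def orient_rotate[of v w u] orient_rotate[of w u v]
    by (simp add: field_simps orient_rotate)
  then show ?thesis by (simp add: vec_eq_iff)
qed

lemma bary_combination:
  assumes "\<alpha> + \<beta> + \<gamma> = 1"
  shows "orient (\<alpha> *\<^sub>R a + \<beta> *\<^sub>R b + \<gamma> *\<^sub>R c) v w = \<alpha> * orient a v w + \<beta> * orient b v w + \<gamma> * orient c v w"
proof -
  have \<gamma>: "\<gamma> = 1 - \<alpha> - \<beta>" using assms by simp
  show ?thesis unfolding \<gamma> by (simp add: orient_def algebra_simps)
qed

lemma bary_unique:
  assumes "orient u v w \<noteq> 0" "\<alpha> + \<beta> + \<gamma> = 1"
  shows "bary u v w (\<alpha> *\<^sub>R u + \<beta> *\<^sub>R v + \<gamma> *\<^sub>R w) = \<alpha>"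
proof -
  have "orient v v w = 0" "orient w v w = 0" by (simp_all add: orient_def)
  then show ?thesis using assms by (simp add: bary_def bary_combination)
qed

lemma continuous_on_bary [continuous_intros]:
  assumes "continuous_on S g"
  shows "continuous_on S (\<lambda>x. bary u v w (g x))"
  unfolding bary_def orient_def divide_inverse by (intro continuous_intros assms)

text \<open>Indexing by position gives coinciding entries separate weights, as repeated knots
  require.\<close>

lemma convex_hull_list:
  fixes vs :: "'a::real_vector list"
  shows "convex hull (set vs) = {\<Sum>i<length vs. u i *\<^sub>R vs ! i | u. (\<forall>i<length vs. 0 \<le> u i) \<and> (\<Sum>i<length vs. u i) = (1::real)}"
    (is "_ = ?R")
proof
  have "convex ?R"
  proof (rule convexI)
    fix x y and s t :: real
    assume "x \<in> ?R" "y \<in> ?R" and st: "0 \<le> s" "0 \<le> t" "s + t = 1"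
    then obtain u u' where u: "x = (\<Sum>i<length vs. u i *\<^sub>R vs ! i)" "\<forall>i<length vs. 0 \<le> u i" "(\<Sum>i<length vs. u i) = 1"
      and u': "y = (\<Sum>i<length vs. u' i *\<^sub>R vs ! i)" "\<forall>i<length vs. 0 \<le> u' i" "(\<Sum>i<length vs. u' i) = 1" by blast
    show "s *\<^sub>R x + t *\<^sub>R y \<in> ?R"
      using u u' st
      by (intro CollectI exI[of _ "\<lambda>i. s * u i + t * u' i"])
         (auto simp: scaleR_sum_right sum.distrib scaleR_add_left sum_distrib_left[symmetric])
  qed
  moreover have "set vs \<subseteq> ?R"
  proof
    fix v assume "v \<in> set vs"
    then obtain k where k: "k < length vs" "vs ! k = v" by (auto simp: in_set_conv_nth)
    show "v \<in> ?R"
      using k by (intro CollectI exI[of _ "\<lambda>i. if i = k then 1 else 0"]) (auto simp: if_distrib[of "\<lambda>c. c *\<^sub>R _"] cong: if_cong)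
  qed
  ultimately show "convex hull (set vs) \<subseteq> ?R" by (rule hull_minimal[rotated])
  show "?R \<subseteq> convex hull (set vs)"
  proof
    fix x assume "x \<in> ?R"
    then obtain u where u: "x = (\<Sum>i<length vs. u i *\<^sub>R vs ! i)" "\<forall>i<length vs. 0 \<le> u i" "(\<Sum>i<length vs. u i) = 1" by blast
    show "x \<in> convex hull (set vs)" unfolding u(1)
      using u by (intro convex_sum) (auto intro: hull_inc)
  qed
qed

text \<open>Here \<open>s\<close> holds the convex weights of \<open>a\<close>, \<open>b\<close>,
  \<open>c\<close>; each of the last three inequalities says that the weight of \<open>d\<close>,
  \<open>e\<close> or \<open>f\<close> that the projection \<open>x\<close> forces is
  nonnegative.\<close>

definition slice :: "pt \<Rightarrow> pt \<Rightarrow> pt \<Rightarrow> pt \<Rightarrow> pt \<Rightarrow> pt \<Rightarrow> pt \<Rightarrow> (real^3) set" where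
  "slice d e f a b c x = {s. 0 \<le> s$1 \<and> 0 \<le> s$2 \<and> 0 \<le> s$3 \<and>
     s$1 * bary d e f a + s$2 * bary d e f b + s$3 * bary d e f c \<le> bary d e f x \<and>
     s$1 * bary e f d a + s$2 * bary e f d b + s$3 * bary e f d c \<le> bary e f d x \<and>
     s$1 * bary f d e a + s$2 * bary f d e b + s$3 * bary f d e c \<le> bary f d e x}"

lemma slice_sum_le:
  assumes "orient d e f \<noteq> 0" "s \<in> slice d e f a b c x"
  shows "s$1 + s$2 + s$3 \<le> 1"
proof -
  have eq: "s$1 + s$2 + s$3 = s$1 * (bary d e f a + bary e f d a + bary f d e a)
     + s$2 * (bary d e f b + bary e f d b + bary f d e b) + s$3 * (bary d e f c + bary e f d c + bary f d e c)"
    using bary_sum[OF assms(1)] by simp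
  show ?thesis
    using assms(2) bary_sum[OF assms(1), of x] unfolding eq slice_def by (simp add: algebra_simps)
qed

lemma compact_slice:
  assumes "orient d e f \<noteq> 0" shows "compact (slice d e f a b c x)"
proof -
  have "bounded (slice d e f a b c x)"
  proof (rule boundedI)
    fix s assume s: "s \<in> slice d e f a b c x"
    have "norm s \<le> (\<Sum>i\<in>UNIV. \<bar>s$i\<bar>)" by (rule norm_le_l1_cart)
    also have "\<dots> \<le> 1" using s slice_sum_le[OF assms s] by (simp add: sum_3 slice_def)
    finally show "norm s \<le> 1" .
  qed
  moreover have "closed (slice d e f a b c x)"
    unfolding slice_def by (intro closed_Collect_conj closed_Collect_le continuous_intros)
  ultimately show ?thesis by (simp add: compact_eq_bounded_closed)
qed

lemma closed_slice_pairs: "closed {(x, s). s \<in> slice d e f a b c x}"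
  unfolding slice_def mem_Collect_eq case_prod_unfold
  by (intro closed_Collect_conj closed_Collect_le continuous_intros)

text \<open>The projection \<open>x\<close> and total weight 1 determine the weights of
  \<open>d\<close>, \<open>e\<close>, \<open>f\<close> from the other three, so the fibre over
  \<open>x\<close> is an affine image of the slice.\<close>

lemma mem_lifted_simplex:
  assumes D: "orient d e f \<noteq> 0"
  shows "(x, z) \<in> lifted_simplex [d,e,f,a,b,c] [z1,z2,z3,z4,z5,z6] \<longleftrightarrow>
    (\<exists>s\<in>slice d e f a b c x. z = bary d e f x *\<^sub>R z1 + bary e f d x *\<^sub>R z2 + bary f d e x *\<^sub>R z3
       + (s$1 *\<^sub>R (z4 - bary d e f a *\<^sub>R z1 - bary e f d a *\<^sub>R z2 - bary f d e a *\<^sub>R z3)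
       + s$2 *\<^sub>R (z5 - bary d e f b *\<^sub>R z1 - bary e f d b *\<^sub>R z2 - bary f d e b *\<^sub>R z3)
       + s$3 *\<^sub>R (z6 - bary d e f c *\<^sub>R z1 - bary e f d c *\<^sub>R z2 - bary f d e c *\<^sub>R z3)))"
    (is "?L \<longleftrightarrow> (\<exists>s\<in>_. z = ?F s)")
proof -
  let ?vs = "[(d,z1),(e,z2),(f,z3),(a,z4),(b,z5),(c,z6)]"
  have efd: "orient e f d \<noteq> 0" "orient f d e \<noteq> 0" using D by (simp_all add: orient_rotate)
  have len: "{..<length ?vs} = {0,1,2,3,4,5}" by auto
  have all: "(\<forall>i<length ?vs. P i) \<longleftrightarrow> P 0 \<and> P 1 \<and> P 2 \<and> P 3 \<and> P 4 \<and> P 5" for P :: "nat \<Rightarrow> bool"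
    by (auto simp: numeral_eq_Suc All_less_Suc)
  have L: "?L \<longleftrightarrow> (\<exists>u::nat\<Rightarrow>real. (x,z) = (\<Sum>i\<in>{0,1,2,3,4,5}. u i *\<^sub>R ?vs ! i)
      \<and> (0 \<le> u 0 \<and> 0 \<le> u 1 \<and> 0 \<le> u 2 \<and> 0 \<le> u 3 \<and> 0 \<le> u 4 \<and> 0 \<le> u 5) \<and> (\<Sum>i\<in>{0,1,2,3,4,5}. u i) = 1)"
    unfolding lifted_simplex_def
    using convex_hull_list[of ?vs, unfolded all len] by simp
  show ?thesis
  proof
    assume ?L
    then obtain u :: "nat \<Rightarrow> real" where u: "(x,z) = (\<Sum>i\<in>{0,1,2,3,4,5}. u i *\<^sub>R ?vs ! i)"
      "0 \<le> u 0" "0 \<le> u 1" "0 \<le> u 2" "0 \<le> u 3" "0 \<le> u 4" "0 \<le> u 5" "(\<Sum>i\<in>{0,1,2,3,4,5}. u i) = 1"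
      unfolding L by blast
    have us: "u 0 + u 1 + u 2 + u 3 + u 4 + u 5 = 1" using u(8) by simp
    have x: "x = u 0 *\<^sub>R d + u 1 *\<^sub>R e + u 2 *\<^sub>R f + u 3 *\<^sub>R a + u 4 *\<^sub>R b + u 5 *\<^sub>R c"
      and z: "z = u 0 *\<^sub>R z1 + u 1 *\<^sub>R z2 + u 2 *\<^sub>R z3 + u 3 *\<^sub>R z4 + u 4 *\<^sub>R z5 + u 5 *\<^sub>R z6"
      using u(1) by (simp_all add: numeral_eq_Suc add.assoc)
    have key: "bary p q r x = u 0 * bary p q r d + u 1 * bary p q r e + u 2 * bary p q r f
        + u 3 * bary p q r a + u 4 * bary p q r b + u 5 * bary p q r c" for p q r
    proof -
      have u0: "u 0 = 1 - u 1 - u 2 - u 3 - u 4 - u 5" using us by simp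
      have "orient x q r = u 0 * orient d q r + u 1 * orient e q r + u 2 * orient f q r
        + u 3 * orient a q r + u 4 * orient b q r + u 5 * orient c q r"
        unfolding x u0 by (simp add: orient_def algebra_simps)
      then show ?thesis by (simp add: bary_def add_divide_distrib)
    qed
    have zz: "bary d e f d = 1" "bary d e f e = 0" "bary d e f f = 0"
      "bary e f d d = 0" "bary e f d e = 1" "bary e f d f = 0"
      "bary f d e d = 0" "bary f d e e = 0" "bary f d e f = 1"
      using D efd by (simp_all add: bary_def) (simp_all add: orient_def)
    define s :: "real^3" where "s = vector [u 3, u 4, u 5]"
    have s: "s$1 = u 3" "s$2 = u 4" "s$3 = u 5" by (simp_all add: s_def vector_3)
    have "s \<in> slice d e f a b c x"
      using u unfolding slice_def key[of d e f] key[of e f d] key[of f d e] by (simp add: s zz)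
    moreover have "z = ?F s"
      unfolding key[of d e f] key[of e f d] key[of f d e] s zz z by (simp add: algebra_simps)
    ultimately show "\<exists>s\<in>slice d e f a b c x. z = ?F s" by blast
  next
    assume "\<exists>s\<in>slice d e f a b c x. z = ?F s"
    then obtain s where s: "s \<in> slice d e f a b c x" "z = ?F s" by blast
    let ?b = "\<lambda>p q r. bary p q r x - (s$1 * bary p q r a + s$2 * bary p q r b + s$3 * bary p q r c)"
    define u where "u = (!) [?b d e f, ?b e f d, ?b f d e, s$1, s$2, s$3]"
    have u: "u 0 = ?b d e f" "u 1 = ?b e f d" "u 2 = ?b f d e" "u 3 = s$1" "u 4 = s$2" "u 5 = s$3"
      by (simp_all add: u_def)
    have sm: "bary d e f y = 1 - bary e f d y - bary f d e y" for y
      using bary_sum[OF D, of y] by simp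
    have "u 0 + u 1 + u 2 + u 3 + u 4 + u 5 = 1"
      unfolding u by (simp add: sm algebra_simps)
    then have 1: "(\<Sum>i\<in>{0,1,2,3,4,5}. u i) = 1" by simp
    show ?L unfolding L
    proof (intro exI[of _ u] conjI)
      have "x = u 0 *\<^sub>R d + u 1 *\<^sub>R e + u 2 *\<^sub>R f + u 3 *\<^sub>R a + u 4 *\<^sub>R b + u 5 *\<^sub>R c"
      proof -
        have "u 0 *\<^sub>R d + u 1 *\<^sub>R e + u 2 *\<^sub>R f + u 3 *\<^sub>R a + u 4 *\<^sub>R b + u 5 *\<^sub>R c =
          (bary d e f x *\<^sub>R d + bary e f d x *\<^sub>R e + bary f d e x *\<^sub>R f)
          + s$1 *\<^sub>R (a - (bary d e f a *\<^sub>R d + bary e f d a *\<^sub>R e + bary f d e a *\<^sub>R f))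
          + s$2 *\<^sub>R (b - (bary d e f b *\<^sub>R d + bary e f d b *\<^sub>R e + bary f d e b *\<^sub>R f))
          + s$3 *\<^sub>R (c - (bary d e f c *\<^sub>R d + bary e f d c *\<^sub>R e + bary f d e c *\<^sub>R f))"
          unfolding u by (simp add: algebra_simps)
        then show ?thesis using bary_point[OF D, of x] bary_point[OF D, of a] bary_point[OF D, of b] bary_point[OF D, of c] by simp
      qed
      moreover have "z = u 0 *\<^sub>R z1 + u 1 *\<^sub>R z2 + u 2 *\<^sub>R z3 + u 3 *\<^sub>R z4 + u 4 *\<^sub>R z5 + u 5 *\<^sub>R z6"
        unfolding s(2) u by (simp add: algebra_simps)
      ultimately show "(x,z) = (\<Sum>i\<in>{0,1,2,3,4,5}. u i *\<^sub>R ?vs ! i)" by (simp add: numeral_eq_Suc add.assoc)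
    qed (use s(1) 1 in \<open>simp_all add: u u[unfolded One_nat_def] slice_def\<close>)
  qed
qed

text \<open>The liftings are permuted along with the knots. This makes the spline independent of the
  order of its knots and lets any nondegenerate triple stand first.\<close>

lemma mset_zip_permute:
  assumes "mset xs = mset ys" "length zs = length xs"
  obtains zs' where "length zs' = length ys" "mset (zip xs zs) = mset (zip ys zs')"
proof -
  obtain p where p: "p permutes {..<length ys}" "permute_list p ys = xs"
    using mset_eq_permutation[OF assms(1)] by blast
  have len: "length zs = length ys" using assms by (metis mset_eq_length)
  define zs' where "zs' = permute_list (inv p) zs"
  have "permute_list p zs' = permute_list (inv p \<circ> p) zs"
    unfolding zs'_def using p len by (subst permute_list_compose) auto
  also have "\<dots> = zs" using p by (simp add: permutes_inv_o)
  finally have "zip xs zs = permute_list p (zip ys zs')"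
    using p len by (subst permute_list_zip[OF p(1)]) (auto simp: zs'_def)
  then have "mset (zip xs zs) = mset (zip ys zs')"
    using p len by (simp add: zs'_def mset_permute_list)
  then show ?thesis using that[of zs'] len by (simp add: zs'_def)
qed

lemma emeasure_affine_image:
  fixes g :: "real^('n::{finite,wellorder}) \<Rightarrow> real^('n::{finite,wellorder})" and S :: "(real^('n::{finite,wellorder})) set"
  assumes S: "compact S" and g: "linear g"
  shows "emeasure lborel ((\<lambda>s. q + g s) ` S) = ennreal \<bar>det (matrix g)\<bar> * emeasure lborel S"
proof -
  have im: "(\<lambda>s. q + g s) ` S = (+) q ` (g ` S)" by (simp add: image_image)
  have cg: "compact (g ` S)"
    using S g by (intro compact_continuous_image linear_continuous_on) (simp_all add: linear_conv_bounded_linear)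
  then have ci: "compact ((+) q ` (g ` S))" by (rule compact_translation)
  have mc: "emeasure lborel A = ennreal (measure lebesgue A)" if "compact A" for A :: "(real^('n::{finite,wellorder})) set"
    using that emeasure_compact_finite[OF that]
    by (subst emeasure_eq_ennreal_measure) (auto simp: measure_completion compact_imp_closed)
  have "measure lebesgue ((+) q ` (g ` S)) = measure lebesgue (g ` S)" by (rule measure_translation)
  also have "\<dots> = \<bar>det (matrix g)\<bar> * measure lebesgue S"
    using S g by (intro measure_lebesgue_linear_transformation) (auto simp: compact_imp_bounded compact_imp_closed intro: borel_closed)
  finally show ?thesis
    unfolding im mc[OF ci] mc[OF S] by (simp add: ennreal_mult)
qed

lemma orient_combination6:
  assumes "u1 + u2 + u3 + u4 + u5 + u6 = 1"
  shows "orient (u1 *\<^sub>R d + u2 *\<^sub>R e + u3 *\<^sub>R f + u4 *\<^sub>R a + u5 *\<^sub>R b + u6 *\<^sub>R c) q r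
    = u1 * orient d q r + u2 * orient e q r + u3 * orient f q r + u4 * orient a q r + u5 * orient b q r + u6 * orient c q r"
proof -
  have u: "u1 = 1 - u2 - u3 - u4 - u5 - u6" using assms by simp
  show ?thesis unfolding u by (simp add: orient_def algebra_simps)
qed

text \<open>For fixed \<open>s\<close> the admissible \<open>x\<close> fill a translate of the
  triangle \<open>d\<close>, \<open>e\<close>, \<open>f\<close> shrunk by 1 minus the sum of
  \<open>s\<close> (empty if that is negative). Its area does not involve \<open>a\<close>,
  \<open>b\<close>, \<open>c\<close>, which makes the volume of the lifted simplex
  computable.\<close>

lemma emeasure_cross_slice:
  fixes s :: "real^3"
  assumes D: "orient d e f \<noteq> 0" and s: "0 \<le> s$1" "0 \<le> s$2" "0 \<le> s$3"
  shows "emeasure lborel {x. s \<in> slice d e f a b c x} = ennreal \<bar>orient d e f\<bar> *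
    emeasure lborel {u::real^2. 0 \<le> u$1 \<and> 0 \<le> u$2 \<and> u$1 + u$2 \<le> 1 - (s$1 + s$2 + s$3)}"
proof -
  let ?U = "{u::real^2. 0 \<le> u$1 \<and> 0 \<le> u$2 \<and> u$1 + u$2 \<le> 1 - (s$1 + s$2 + s$3)}"
  define q where "q = f + s$1 *\<^sub>R (a - f) + s$2 *\<^sub>R (b - f) + s$3 *\<^sub>R (c - f)"
  define g where "g = (\<lambda>u::real^2. u$1 *\<^sub>R (d - f) + u$2 *\<^sub>R (e - f))"
  have lin: "linear g" unfolding g_def by (rule linearI) (simp_all add: algebra_simps)
  have det: "det (matrix g) = orient d e f"
    unfolding det_2 matrix_def g_def by (simp add: orient_def axis_def)
  have "bounded ?U"
  proof (rule boundedI)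
    fix u assume u: "u \<in> ?U"
    have "norm u \<le> (\<Sum>i\<in>UNIV. \<bar>u$i\<bar>)" by (rule norm_le_l1_cart)
    also have "\<dots> \<le> 1" using u s by (simp add: sum_2)
    finally show "norm u \<le> 1" .
  qed
  moreover have "closed ?U"
    by (intro closed_Collect_conj closed_Collect_le continuous_intros)
  ultimately have U: "compact ?U" by (simp add: compact_eq_bounded_closed)
  have efd: "orient e f d \<noteq> 0" "orient f d e \<noteq> 0" using D by (simp_all add: orient_rotate)
  have zz: "orient e e f = 0" "orient f e f = 0" "orient d f d = 0" "orient f f d = 0" 
      "orient d d e = 0" "orient e d e = 0" by (simp_all add: orient_def)
  have "{x. s \<in> slice d e f a b c x} = (\<lambda>u. q + g u) ` ?U"
  proof (intro equalityI subsetI)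
    fix x assume x: "x \<in> {x. s \<in> slice d e f a b c x}"
    let ?b = "\<lambda>p q r. bary p q r x - (s$1 * bary p q r a + s$2 * bary p q r b + s$3 * bary p q r c)"
    define u :: "real^2" where "u = vector [?b d e f, ?b e f d]"
    have u: "u$1 = ?b d e f" "u$2 = ?b e f d" by (simp_all add: u_def vector_2)
    have b3: "bary f d e y = 1 - bary d e f y - bary e f d y" for y using bary_sum[OF D, of y] by simp
    have "u$1 + u$2 \<le> 1 - (s$1 + s$2 + s$3)"
      using x unfolding u by (simp add: slice_def b3 algebra_simps)
    then have "u \<in> ?U" using x by (simp add: u slice_def)
    moreover have "x = q + g u"
    proof -
      have r: "y - f = bary d e f y *\<^sub>R (d - f) + bary e f d y *\<^sub>R (e - f)" for y
        by (subst (1) bary_point[OF D, of y]) (simp add: b3 algebra_simps)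
      have "q + g u = f + (bary d e f x *\<^sub>R (d - f) + bary e f d x *\<^sub>R (e - f))
        + s$1 *\<^sub>R ((a - f) - (bary d e f a *\<^sub>R (d - f) + bary e f d a *\<^sub>R (e - f)))
        + s$2 *\<^sub>R ((b - f) - (bary d e f b *\<^sub>R (d - f) + bary e f d b *\<^sub>R (e - f)))
        + s$3 *\<^sub>R ((c - f) - (bary d e f c *\<^sub>R (d - f) + bary e f d c *\<^sub>R (e - f)))"
        unfolding q_def g_def u by (simp add: algebra_simps)
      then show ?thesis unfolding r[symmetric] by simp
    qed
    ultimately show "x \<in> (\<lambda>u. q + g u) ` ?U" by blast
  next
    fix x assume "x \<in> (\<lambda>u. q + g u) ` ?U"
    then obtain u where u: "u \<in> ?U" "x = q + g u" by blast
    have x: "x = u$1 *\<^sub>R d + u$2 *\<^sub>R e + (1 - u$1 - u$2 - s$1 - s$2 - s$3) *\<^sub>R f + s$1 *\<^sub>R a + s$2 *\<^sub>R b + s$3 *\<^sub>R c"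
      unfolding u(2) q_def g_def by (simp add: algebra_simps)
    have "orient x q r = u$1 * orient d q r + u$2 * orient e q r + (1 - u$1 - u$2 - s$1 - s$2 - s$3) * orient f q r
        + s$1 * orient a q r + s$2 * orient b q r + s$3 * orient c q r" for q r
      unfolding x by (rule orient_combination6) simp
    then have "bary d e f x = u$1 + s$1 * bary d e f a + s$2 * bary d e f b + s$3 * bary d e f c"
      "bary e f d x = u$2 + s$1 * bary e f d a + s$2 * bary e f d b + s$3 * bary e f d c"
      "bary f d e x = (1 - u$1 - u$2 - s$1 - s$2 - s$3) + s$1 * bary f d e a + s$2 * bary f d e b + s$3 * bary f d e c"
      unfolding bary_def using D efd by (simp_all add: zz add_divide_distrib)
    then show "x \<in> {x. s \<in> slice d e f a b c x}" using u(1) s by (simp add: slice_def)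
  qed
  then show ?thesis using emeasure_affine_image[OF U lin, of q] by (simp add: det)
qed

text \<open>Linear part of the parametrisation of a fibre by its slice. The lifting enters the
  volumes only through its determinant, which cancels in the quotient.\<close>

definition lift_map :: "pt list \<Rightarrow> (real^3) list \<Rightarrow> real^3 \<Rightarrow> real^3" where
  "lift_map xs zs s = (\<Sum>k<3. s $ of_nat (Suc k) *\<^sub>R (zs!(k+3)
      - bary (xs!0) (xs!1) (xs!2) (xs!(k+3)) *\<^sub>R zs!0
      - bary (xs!1) (xs!2) (xs!0) (xs!(k+3)) *\<^sub>R zs!1
      - bary (xs!2) (xs!0) (xs!1) (xs!(k+3)) *\<^sub>R zs!2))"

lemma emeasure_lifted_simplex_slice:
  assumes D: "orient d e f \<noteq> 0" and zs: "length zs = 6"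
  shows "emeasure lborel {z. (x, z) \<in> lifted_simplex [d,e,f,a,b,c] zs}
    = ennreal \<bar>det (matrix (lift_map [d,e,f,a,b,c] zs))\<bar> * emeasure lborel (slice d e f a b c x)"
proof -
  obtain z1 z2 z3 z4 z5 z6 where zs: "zs = [z1,z2,z3,z4,z5,z6]"
    using zs by (auto simp: length_Suc_conv numeral_eq_Suc)
  let ?g = "lift_map [d,e,f,a,b,c] zs"
  have g: "?g s = s$1 *\<^sub>R (z4 - bary d e f a *\<^sub>R z1 - bary e f d a *\<^sub>R z2 - bary f d e a *\<^sub>R z3)
       + s$2 *\<^sub>R (z5 - bary d e f b *\<^sub>R z1 - bary e f d b *\<^sub>R z2 - bary f d e b *\<^sub>R z3)
       + s$3 *\<^sub>R (z6 - bary d e f c *\<^sub>R z1 - bary e f d c *\<^sub>R z2 - bary f d e c *\<^sub>R z3)" for s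
    by (simp add: lift_map_def zs numeral_3_eq_3 lessThan_Suc add.assoc)
  have lin: "linear ?g" by (rule linearI) (simp_all add: g algebra_simps)
  define q where "q = bary d e f x *\<^sub>R z1 + bary e f d x *\<^sub>R z2 + bary f d e x *\<^sub>R z3"
  have "{z. (x, z) \<in> lifted_simplex [d,e,f,a,b,c] zs} = (\<lambda>s. q + ?g s) ` slice d e f a b c x"
    unfolding zs mem_lifted_simplex[OF D] unfolding q_def g[unfolded zs] by blast
  then show ?thesis using emeasure_affine_image[OF compact_slice[OF D] lin] by simp
qed

text \<open>The volume of the standard simplex in dimension five as an iterated integral.\<close>

definition simplex_constant :: ennreal where
  "simplex_constant = nn_integral lborel (\<lambda>s::real^3. indicator {s. 0 \<le> s$1 \<and> 0 \<le> s$2 \<and> 0 \<le> s$3} s *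
    emeasure lborel {u::real^2. 0 \<le> u$1 \<and> 0 \<le> u$2 \<and> u$1 + u$2 \<le> 1 - (s$1 + s$2 + s$3)})"

lemma emeasure_lifted_simplex_aux:
  assumes D: "orient d e f \<noteq> 0" and zs: "length zs = 6"
  shows "emeasure lborel (lifted_simplex [d,e,f,a,b,c] zs)
    = ennreal \<bar>det (matrix (lift_map [d,e,f,a,b,c] zs))\<bar> * (ennreal \<bar>orient d e f\<bar> * simplex_constant)"
proof -
  let ?k = "\<bar>det (matrix (lift_map [d,e,f,a,b,c] zs))\<bar>" and ?\<sigma> = "lifted_simplex [d,e,f,a,b,c] zs"
  let ?P = "{(x, s). s \<in> slice d e f a b c x}"
  have "compact ?\<sigma>" unfolding lifted_simplex_def by (rule finite_imp_compact_convex_hull) simp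
  then have \<sigma>: "?\<sigma> \<in> sets (lborel \<Otimes>\<^sub>M lborel)" unfolding lborel_prod by (simp add: borel_compact)
  have P: "?P \<in> sets (lborel \<Otimes>\<^sub>M lborel)" using borel_closed[OF closed_slice_pairs] unfolding lborel_prod by simp
  have "emeasure lborel ?\<sigma> = emeasure (lborel \<Otimes>\<^sub>M lborel) ?\<sigma>" by (simp add: lborel_prod)
  also have "\<dots> = (\<integral>\<^sup>+x. emeasure lborel (Pair x -` ?\<sigma>) \<partial>lborel)" by (rule lborel.emeasure_pair_measure_alt[OF \<sigma>])
  also have "\<dots> = (\<integral>\<^sup>+x. ennreal ?k * emeasure lborel (Pair x -` ?P) \<partial>lborel)"
    using emeasure_lifted_simplex_slice[OF D zs] by (intro nn_integral_cong) (simp add: vimage_def)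
  also have "\<dots> = ennreal ?k * (\<integral>\<^sup>+x. emeasure lborel (Pair x -` ?P) \<partial>lborel)"
    by (intro nn_integral_cmult lborel.measurable_emeasure_Pair[OF P])
  \<comment> \<open>Exchanging the order of integration replaces the slice volumes by explicit
    triangle areas, one for each weight vector \<open>s\<close>.\<close>
  also have "(\<integral>\<^sup>+x. emeasure lborel (Pair x -` ?P) \<partial>lborel) = (\<integral>\<^sup>+s. emeasure lborel ((\<lambda>x. (x, s)) -` ?P) \<partial>lborel)"
    unfolding lborel.emeasure_pair_measure_alt[OF P, symmetric] by (rule lborel_pair.emeasure_pair_measure_alt2[OF P])
  also have "\<dots> = nn_integral lborel (\<lambda>s::real^3. ennreal \<bar>orient d e f\<bar> * (indicator {s. 0 \<le> s$1 \<and> 0 \<le> s$2 \<and> 0 \<le> s$3} s *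
    emeasure lborel {u::real^2. 0 \<le> u$1 \<and> 0 \<le> u$2 \<and> u$1 + u$2 \<le> 1 - (s$1 + s$2 + s$3)}))"
  proof (intro nn_integral_cong)
    fix s :: "real^3"
    show "emeasure lborel ((\<lambda>x. (x, s)) -` ?P) = ennreal \<bar>orient d e f\<bar> * (indicator {s. 0 \<le> s$1 \<and> 0 \<le> s$2 \<and> 0 \<le> s$3} s *
      emeasure lborel {u::real^2. 0 \<le> u$1 \<and> 0 \<le> u$2 \<and> u$1 + u$2 \<le> 1 - (s$1 + s$2 + s$3)})"
    proof (cases "0 \<le> s$1 \<and> 0 \<le> s$2 \<and> 0 \<le> s$3")
      case True
      then show ?thesis using emeasure_cross_slice[OF D, of s] by (simp add: vimage_def)
    next
      case False
      then have "(\<lambda>x. (x, s)) -` ?P = {}" by (auto simp: slice_def)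
      then show ?thesis using False by (simp add: indicator_def del: vimage_eq)
    qed
  qed
  also have "\<dots> = ennreal \<bar>orient d e f\<bar> * simplex_constant"
    unfolding simplex_constant_def
  proof (rule nn_integral_cmult)
    have c: "closed {(s::real^3, u::real^2). 0 \<le> u$1 \<and> 0 \<le> u$2 \<and> u$1 + u$2 \<le> 1 - (s$1 + s$2 + s$3)}"
      unfolding case_prod_unfold by (intro closed_Collect_conj closed_Collect_le continuous_intros)
    have "{(s::real^3, u::real^2). 0 \<le> u$1 \<and> 0 \<le> u$2 \<and> u$1 + u$2 \<le> 1 - (s$1 + s$2 + s$3)} \<in> sets (lborel \<Otimes>\<^sub>M lborel)"
      using borel_closed[OF c] unfolding lborel_prod by simp
    from lborel.measurable_emeasure_Pair[OF this]
    have m: "(\<lambda>s::real^3. emeasure lborel {u::real^2. 0 \<le> u$1 \<and> 0 \<le> u$2 \<and> u$1 + u$2 \<le> 1 - (s$1 + s$2 + s$3)}) \<in> borel_measurable lborel"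
      by (simp add: vimage_def)
    have "closed {s::real^3. 0 \<le> s$1 \<and> 0 \<le> s$2 \<and> 0 \<le> s$3}"
      by (intro closed_Collect_conj closed_Collect_le continuous_intros)
    then have "{s::real^3. 0 \<le> s$1 \<and> 0 \<le> s$2 \<and> 0 \<le> s$3} \<in> sets lborel" by (simp add: borel_closed)
    then show "(\<lambda>s::real^3. indicator {s. 0 \<le> s$1 \<and> 0 \<le> s$2 \<and> 0 \<le> s$3} s *
      emeasure lborel {u::real^2. 0 \<le> u$1 \<and> 0 \<le> u$2 \<and> u$1 + u$2 \<le> 1 - (s$1 + s$2 + s$3)}) \<in> borel_measurable lborel"
      using m by (intro borel_measurable_times_ennreal borel_measurable_indicator)
  qed
  finally show ?thesis .
qed

text \<open>With this lifting \<open>lift_map\<close> is the identity; it certifies that some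
  lifting has positive volume, so that the Hilbert choice in \<open>simplex_spline\<close> is
  meaningful.\<close>

abbreviation std_lift :: "(real^3) list" where
  "std_lift \<equiv> [0, 0, 0, axis 1 1, axis 2 1, axis 3 1]"

lemma det_std_lift: "det (matrix (lift_map [d,e,f,a,b,c] std_lift)) = 1"
proof -
  have "lift_map [d,e,f,a,b,c] std_lift s = s" for s
    by (simp add: lift_map_def numeral_3_eq_3 lessThan_Suc vec_eq_iff forall_3 axis_def)
  then have "lift_map [d,e,f,a,b,c] std_lift = id" by auto
  then show ?thesis by (simp add: matrix_id_mat_1)
qed

text \<open>The constant is read off from the standard simplex.\<close>

lemma simplex_constant: "simplex_constant = ennreal (1 / 120)"
proof -
  let ?d = "axis 1 1 :: pt" and ?e = "axis 2 1 :: pt"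
  have o: "orient ?d ?e 0 = 1" by (simp add: orient_def axis_def)
  have B2: "(Basis :: pt set) = {?d, ?e}" by (auto simp: Basis_vec_def UNIV_2)
  have B3: "(Basis :: (real^3) set) = {axis 1 1, axis 2 1, axis 3 1}" by (auto simp: Basis_vec_def UNIV_3)
  have "set (zip [?d, ?e, 0, 0, 0, 0] std_lift) = insert 0 Basis"
    unfolding Basis_prod_def B2 B3 by (auto simp: zero_prod_def)
  then have "emeasure lborel (lifted_simplex [?d, ?e, 0, 0, 0, 0] std_lift) = ennreal (1 / 120)"
    unfolding lifted_simplex_def using emeasure_std_simplex[where 'a = "pt \<times> (real^3)"] by (simp add: fact_numeral)
  then show ?thesis
    by (subst (asm) emeasure_lifted_simplex_aux) (simp_all add: o det_std_lift)
qed

text \<open>Fibre and simplex volumes carry the same determinant, so the quotient does not depend on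
  the lifting; 120 is the reciprocal of the standard volume. Any three non-collinear knots may take
  the place of \<open>d\<close>, \<open>e\<close>, \<open>f\<close>.\<close>

lemma simplex_spline_eq:
  assumes D: "orient d e f \<noteq> 0" and xs: "mset xs = mset [d,e,f,a,b,c]"
  shows "simplex_spline xs x = 120 / \<bar>orient d e f\<bar> * measure lborel (slice d e f a b c x)"
proof -
  let ?ys = "[d,e,f,a,b,c]" and ?k = "\<lambda>zs. \<bar>det (matrix (lift_map [d,e,f,a,b,c] zs))\<bar>"
  have m: "measure lborel (lifted_simplex ?ys zs) = ?k zs * \<bar>orient d e f\<bar> / 120"
       "measure lborel {z. (x, z) \<in> lifted_simplex ?ys zs} = ?k zs * measure lborel (slice d e f a b c x)"
    if "length zs = 6" for zs
    using emeasure_lifted_simplex_aux[OF D that, of a b c] emeasure_lifted_simplex_slice[OF D that, of x a b c]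
    by (simp_all add: measure_def simplex_constant enn2real_mult flip: ennreal_mult)
  have same: "lifted_simplex as zs = lifted_simplex bs zs'" if "mset (zip as zs) = mset (zip bs zs')" for as bs zs zs'
    using mset_eq_setD[OF that] by (simp add: lifted_simplex_def)
  have len: "length xs = 6" using mset_eq_length[OF xs] by simp
  have "\<exists>zs. length zs = length xs \<and> measure lborel (lifted_simplex xs zs) > 0"
  proof -
    obtain zs where zs: "length zs = length xs" "mset (zip ?ys std_lift) = mset (zip xs zs)"
      by (rule mset_zip_permute[OF xs[symmetric], of std_lift]) auto
    have "measure lborel (lifted_simplex xs zs) > 0"
      unfolding same[OF zs(2), symmetric] using D by (subst m) (simp_all add: det_std_lift)
    then show ?thesis using zs by blast
  qed
  then have "\<exists>zs. (length zs = length xs \<and> measure lborel (lifted_simplex xs zs) > 0)" .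
  from someI_ex[OF this] obtain zs where zs: "zs = (SOME zs. length zs = length xs \<and> measure lborel (lifted_simplex xs zs) > 0)"
    "length zs = length xs" "measure lborel (lifted_simplex xs zs) > 0" by blast
  obtain zs' where zs': "length zs' = length ?ys" "mset (zip xs zs) = mset (zip ?ys zs')"
    using mset_zip_permute[OF xs zs(2)] by blast
  have l6: "length zs' = 6" using zs' by simp
  have "?k zs' \<noteq> 0" using zs(3) unfolding same[OF zs'(2)] m(1)[OF l6] by auto
  then show ?thesis
    unfolding simplex_spline_def Let_def zs(1)[symmetric] same[OF zs'(2)] m[OF l6] by simp
qed

section \<open>Knot insertion\<close>

text \<open>The plane where the weights left for \<open>d\<close> and \<open>e\<close> have the
  ratio \<open>\<mu>\<close> to \<open>1 - \<mu>\<close> cuts the slice in two. The parts are the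
  slices with \<open>g\<close> in place of \<open>d\<close> and of \<open>e\<close>, and the factors
  \<open>\<mu>\<close> and \<open>1 - \<mu>\<close> compensate for the smaller normalising
  triangles.\<close>

lemma simplex_spline_insert:
  assumes D: "orient d e f \<noteq> 0" and \<mu>: "0 < \<mu>" "\<mu> < 1" and g: "g = \<mu> *\<^sub>R d + (1 - \<mu>) *\<^sub>R e"
    and nondeg: "orient g f a \<noteq> 0 \<or> orient g f b \<noteq> 0 \<or> orient g f c \<noteq> 0 \<or> orient g f x \<noteq> 0"
    and m: "mset xs = mset [d,e,f,a,b,c]" "mset ys = mset [g,e,f,a,b,c]" "mset zs = mset [d,g,f,a,b,c]"
  shows "simplex_spline xs x = \<mu> * simplex_spline ys x + (1 - \<mu>) * simplex_spline zs x"
proof -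
  let ?D = "orient d e f"
  define A B where "A = (\<lambda>y. bary d e f y)" and "B = (\<lambda>y. bary e f d y)"
  define C where "C = (\<lambda>y. bary f d e y)"
  have D1: "orient g e f = \<mu> * ?D" and D2: "orient d g f = (1 - \<mu>) * ?D"
    unfolding g by (simp_all add: orient_def algebra_simps)
  then have D12: "orient g e f \<noteq> 0" "orient d g f \<noteq> 0" using D \<mu> by simp_all
  have r: "orient e f d = ?D" "orient f d e = ?D" by (simp_all add: orient_def algebra_simps)
  have r': "orient e f g = \<mu> * ?D" "orient f g e = \<mu> * ?D" "orient g f d = (1 - \<mu>) * ?D" "orient f d g = (1 - \<mu>) * ?D"
    unfolding D1[symmetric] D2[symmetric] by (simp_all add: orient_def algebra_simps)
  have ABC0: "A y = orient y e f / ?D" "B y = orient y f d / ?D" "C y = orient y d e / ?D" for y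
    by (simp_all add: A_def B_def C_def bary_def r)
  have gf0: "orient g f y = (1 - \<mu>) * orient y e f - \<mu> * orient y f d" for y
    unfolding g by (simp add: orient_def algebra_simps)
  have gf: "orient g f y = ?D * ((1 - \<mu>) * A y - \<mu> * B y)" for y
  proof -
    have "K * ((1 - \<mu>) * (p / K) - \<mu> * (q / K)) = (1 - \<mu>) * p - \<mu> * q" if "K \<noteq> 0" for K p q :: real
      using that by (simp add: right_diff_distrib)
    from this[OF D, symmetric] show ?thesis unfolding gf0 ABC0 .
  qed
  have ABC: "bary g e f y = A y / \<mu>" "bary e f g y = (\<mu> * B y - (1 - \<mu>) * A y) / \<mu>" "bary f g e y = C y"
     "bary d g f y = ((1 - \<mu>) * A y - \<mu> * B y) / (1 - \<mu>)" "bary g f d y = B y / (1 - \<mu>)" "bary f d g y = C y" for y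
  proof -
    have "orient y f g = \<mu> * orient y f d - (1 - \<mu>) * orient y e f" "orient y g f = (1 - \<mu>) * orient y e f - \<mu> * orient y f d"
      "orient y g e = \<mu> * orient y d e" "orient y d g = (1 - \<mu>) * orient y d e"
      unfolding g by (simp_all add: orient_def algebra_simps)
    then show "bary g e f y = A y / \<mu>" "bary e f g y = (\<mu> * B y - (1 - \<mu>) * A y) / \<mu>" "bary f g e y = C y"
     "bary d g f y = ((1 - \<mu>) * A y - \<mu> * B y) / (1 - \<mu>)" "bary g f d y = B y / (1 - \<mu>)" "bary f d g y = C y"
      using D \<mu> unfolding bary_def D1 D2 r' ABC0 by (simp_all add: divide_simps)
  qed
  let ?a = "\<lambda>s::real^3. A x - (s$1 * A a + s$2 * A b + s$3 * A c)"
  let ?b = "\<lambda>s::real^3. B x - (s$1 * B a + s$2 * B b + s$3 * B c)"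
  let ?c = "\<lambda>s::real^3. C x - (s$1 * C a + s$2 * C b + s$3 * C c)"
  let ?P = "\<lambda>s::real^3. 0 \<le> s$1 \<and> 0 \<le> s$2 \<and> 0 \<le> s$3"
  have S: "slice d e f a b c x = {s. ?P s \<and> 0 \<le> ?a s \<and> 0 \<le> ?b s \<and> 0 \<le> ?c s}"
    by (simp add: slice_def A_def B_def C_def)
  have lin: "s1 * (u / m) + s2 * (v / m) + s3 * (w / m) \<le> z / m \<longleftrightarrow> s1 * u + s2 * v + s3 * w \<le> z" if "0 < m"
    for s1 s2 s3 u v w z m :: real
  proof -
    have "s1 * (u / m) + s2 * (v / m) + s3 * (w / m) = (s1 * u + s2 * v + s3 * w) / m"
      by (simp add: add_divide_distrib)
    then show ?thesis using that by (simp add: divide_le_cancel)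
  qed
  have \<mu>': "0 < 1 - \<mu>" using \<mu> by simp
  have S1: "slice g e f a b c x = {s. ?P s \<and> 0 \<le> ?a s \<and> (1 - \<mu>) * ?a s \<le> \<mu> * ?b s \<and> 0 \<le> ?c s}"
    unfolding slice_def ABC lin[OF \<mu>(1)] by (auto simp: algebra_simps)
  have S2: "slice d g f a b c x = {s. ?P s \<and> 0 \<le> ?b s \<and> \<mu> * ?b s \<le> (1 - \<mu>) * ?a s \<and> 0 \<le> ?c s}"
    unfolding slice_def ABC lin[OF \<mu>'] by (auto simp: algebra_simps)
  have un: "slice d e f a b c x = slice g e f a b c x \<union> slice d g f a b c x"
  proof -
    have "0 \<le> u \<and> 0 \<le> v \<longleftrightarrow> (0 \<le> u \<and> (1 - \<mu>) * u \<le> \<mu> * v) \<or> (0 \<le> v \<and> \<mu> * v \<le> (1 - \<mu>) * u)" for u v :: real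
      using \<mu> by (smt (verit) mult_nonneg_nonneg zero_le_mult_iff)
    then show ?thesis unfolding S S1 S2 by blast
  qed
  have ng: "negligible (slice g e f a b c x \<inter> slice d g f a b c x)"
  proof -
    \<comment> \<open>The plane degenerates if \<open>a\<close>, \<open>b\<close>, \<open>c\<close>
      all lie on the line through \<open>f\<close> and \<open>g\<close>; then \<open>nondeg\<close>
      puts \<open>x\<close> off that line and the set is empty.\<close>
    let ?l = "\<lambda>y. (1 - \<mu>) * A y - \<mu> * B y"
    define n :: "real^3" where "n = vector [?l a, ?l b, ?l c]"
    have sub: "slice g e f a b c x \<inter> slice d g f a b c x \<subseteq> {s. n \<bullet> s = ?l x}"
      unfolding S1 S2 by (auto simp: n_def inner_vec_def sum_3 vector_3 algebra_simps)
    have "negligible {s. n \<bullet> s = ?l x}"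
    proof (cases "n = 0")
      case True
      then have "?l a = 0" "?l b = 0" "?l c = 0" by (simp_all add: n_def vec_eq_iff forall_3 vector_3)
      then have "?l x \<noteq> 0" using nondeg unfolding gf by auto
      then show ?thesis using True by simp
    qed (simp add: negligible_hyperplane)
    then show ?thesis using negligible_subset sub by blast
  qed
  have ms: "measure lebesgue (slice p q r a b c x) = measure lborel (slice p q r a b c x)" "slice p q r a b c x \<in> lmeasurable"
    if "orient p q r \<noteq> 0" for p q r
    using compact_slice[OF that, of a b c x] by (simp_all add: measure_completion compact_imp_closed lmeasurable_compact)
  have "measure lebesgue (slice d e f a b c x) = measure lebesgue (slice g e f a b c x) + measure lebesgue (slice d g f a b c x)"
    unfolding un using ms(2) D12 negligible_imp_measure0[OF ng] by (subst measure_Un3) simp_all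
  then have V: "measure lborel (slice d e f a b c x) = measure lborel (slice g e f a b c x) + measure lborel (slice d g f a b c x)"
    using ms D D12 by simp
  have ab: "\<bar>orient g e f\<bar> = \<mu> * \<bar>?D\<bar>" "\<bar>orient d g f\<bar> = (1 - \<mu>) * \<bar>?D\<bar>" using \<mu> by (simp_all add: D1 D2 abs_mult)
  show ?thesis
    unfolding simplex_spline_eq[OF D m(1)] simplex_spline_eq[OF D12(1) m(2)] simplex_spline_eq[OF D12(2) m(3)] V ab
    using D \<mu> by (simp add: field_simps)
qed

section \<open>Splines with explicitly computable slices\<close>

lemma measure_corner:
  assumes "0 \<le> t"
  shows "measure lborel {s::real^3. 0 \<le> s$1 \<and> 0 \<le> s$2 \<and> 0 \<le> s$3 \<and> s$1 + s$2 + s$3 \<le> t} = t^3 / 6"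
proof (cases "t = 0")
  case True
  then have "{s::real^3. 0 \<le> s$1 \<and> 0 \<le> s$2 \<and> 0 \<le> s$3 \<and> s$1 + s$2 + s$3 \<le> t} = {0}"
    by (auto simp: vec_eq_iff forall_3)
  then show ?thesis using True by simp
next
  case False
  have B: "(Basis :: (real^3) set) = {axis 1 1, axis 2 1, axis 3 1}" by (auto simp: Basis_vec_def UNIV_3)
  have sum: "sum ((\<bullet>) x) Basis = x$1 + x$2 + x$3" for x :: "real^3"
    unfolding B by (simp add: axis_eq_axis inner_axis)
  have std: "convex hull (insert 0 Basis) = {x::real^3. 0 \<le> x$1 \<and> 0 \<le> x$2 \<and> 0 \<le> x$3 \<and> x$1 + x$2 + x$3 \<le> 1}"
    unfolding std_simplex sum unfolding B by (auto simp: inner_axis)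
  have cp: "compact (convex hull (insert 0 Basis) :: (real^3) set)"
    by (intro finite_imp_compact_convex_hull) auto
  have "{s::real^3. 0 \<le> s$1 \<and> 0 \<le> s$2 \<and> 0 \<le> s$3 \<and> s$1 + s$2 + s$3 \<le> t} = (\<lambda>s. 0 + t *\<^sub>R s) ` (convex hull (insert 0 Basis))"
  proof (intro equalityI subsetI)
    fix s :: "real^3" assume s: "s \<in> {s. 0 \<le> s$1 \<and> 0 \<le> s$2 \<and> 0 \<le> s$3 \<and> s$1 + s$2 + s$3 \<le> t}"
    then have "(1/t) *\<^sub>R s \<in> convex hull (insert 0 Basis)" "s = 0 + t *\<^sub>R ((1/t) *\<^sub>R s)"
      using assms False unfolding std by (simp_all add: field_simps)
    then show "s \<in> (\<lambda>s. 0 + t *\<^sub>R s) ` (convex hull (insert 0 Basis))" by blast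
  next
    fix s :: "real^3" assume "s \<in> (\<lambda>s. 0 + t *\<^sub>R s) ` (convex hull (insert 0 Basis))"
    then obtain r where r: "s = t *\<^sub>R r" "0 \<le> r$1" "0 \<le> r$2" "0 \<le> r$3" "r$1 + r$2 + r$3 \<le> 1" unfolding std by auto
    have "t * (r$1 + r$2 + r$3) \<le> t" using r(5) assms by (simp add: mult_left_le)
    then show "s \<in> {s. 0 \<le> s$1 \<and> 0 \<le> s$2 \<and> 0 \<le> s$3 \<and> s$1 + s$2 + s$3 \<le> t}"
      using r assms by (simp add: algebra_simps)
  qed
  then have "emeasure lborel {s::real^3. 0 \<le> s$1 \<and> 0 \<le> s$2 \<and> 0 \<le> s$3 \<and> s$1 + s$2 + s$3 \<le> t}
      = ennreal \<bar>det (matrix ((*\<^sub>R) t :: real^3 \<Rightarrow> real^3))\<bar> * ennreal (1 / 6)"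
    using emeasure_affine_image[OF cp, of "(*\<^sub>R) t" 0] emeasure_std_simplex[where 'a = "real^3"]
    by (simp add: fact_numeral linear_scale_self)
  then show ?thesis
    using assms by (simp add: measure_def det_matrix_scaleR flip: ennreal_mult)
qed

text \<open>With \<open>v\<close> fourfold the slice is a corner tetrahedron of size
  \<open>bary v a b x\<close>; its volume \<open>t^3 / 6\<close> turns 120 into 20. The sign
  conditions place \<open>x\<close> in the cone at \<open>v\<close> spanned by \<open>a\<close> and
  \<open>b\<close>, or in the opposite halves that the maximum sends to zero only through the
  remaining coordinate.\<close>

lemma simplex_spline_corner:
  assumes D: "orient v a b \<noteq> 0" and m: "mset xs = mset [v,a,b,v,v,v]"
    and nn: "0 \<le> bary a b v x" "0 \<le> bary b v a x"
  shows "simplex_spline xs x = 20 / \<bar>orient v a b\<bar> * (max 0 (bary v a b x))^3"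
proof -
  have z: "bary v a b v = 1" "bary a b v v = 0" "bary b v a v = 0"
    using D by (simp_all add: bary_def) (simp_all add: orient_def)
  have S: "slice v a b v v v x = {s. 0 \<le> s$1 \<and> 0 \<le> s$2 \<and> 0 \<le> s$3 \<and> s$1 + s$2 + s$3 \<le> bary v a b x}"
    using nn by (simp add: slice_def z)
  show ?thesis
  proof (cases "0 \<le> bary v a b x")
    case True
    then show ?thesis unfolding simplex_spline_eq[OF D m] S by (simp add: measure_corner)
  next
    case False
    then have "{s::real^3. 0 \<le> s$1 \<and> 0 \<le> s$2 \<and> 0 \<le> s$3 \<and> s$1 + s$2 + s$3 \<le> bary v a b x} = {}" by auto
    then show ?thesis using False unfolding simplex_spline_eq[OF D m] S by (simp only:) simp
  qed
qed

text \<open>Doubling each of \<open>d\<close>, \<open>e\<close>, \<open>f\<close> decouples the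
  inequalities, so the slice is a box.\<close>

lemma simplex_spline_box:
  assumes D: "orient d e f \<noteq> 0" and m: "mset xs = mset [d,e,f,d,e,f]"
    and nn: "0 \<le> bary d e f x" "0 \<le> bary e f d x" "0 \<le> bary f d e x"
  shows "simplex_spline xs x = 120 / \<bar>orient d e f\<bar> * (bary d e f x * bary e f d x * bary f d e x)"
proof -
  have efd: "orient e f d \<noteq> 0" "orient f d e \<noteq> 0" using D by (simp_all add: orient_rotate)
  have z: "bary d e f d = 1" "bary d e f e = 0" "bary d e f f = 0"
      "bary e f d d = 0" "bary e f d e = 1" "bary e f d f = 0"
      "bary f d e d = 0" "bary f d e e = 0" "bary f d e f = 1"
    using D efd by (simp_all add: bary_def) (simp_all add: orient_def)
  have S: "slice d e f d e f x = cbox 0 (vector [bary d e f x, bary e f d x, bary f d e x])"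
    by (auto simp: slice_def z mem_box_cart forall_3 vector_3)
  have ne: "cbox 0 (vector [bary d e f x, bary e f d x, bary f d e x] :: real^3) \<noteq> {}"
    using nn by (simp add: interval_ne_empty_cart forall_3 vector_3)
  show ?thesis unfolding simplex_spline_eq[OF D m] S
    unfolding content_cbox_cart[OF ne] UNIV_3 by (simp add: vector_3)
qed

section \<open>Barycentric triples and normalised splines\<close>

definition pt_of :: "pt \<Rightarrow> pt \<Rightarrow> pt \<Rightarrow> real \<times> real \<times> real \<Rightarrow> pt" where
  "pt_of p1 p2 p3 = (\<lambda>(a, b, c). a *\<^sub>R p1 + b *\<^sub>R p2 + c *\<^sub>R p3)"

definition mass :: "real \<times> real \<times> real \<Rightarrow> real" where
  "mass = (\<lambda>(a, b, c). a + b + c)"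

definition det3 :: "real \<times> real \<times> real \<Rightarrow> real \<times> real \<times> real \<Rightarrow> real \<times> real \<times> real \<Rightarrow> real" where
  "det3 = (\<lambda>(a1, a2, a3) (b1, b2, b3) (c1, c2, c3).
     a1 * (b2 * c3 - b3 * c2) - a2 * (b1 * c3 - b3 * c1) + a3 * (b1 * c2 - b2 * c1))"

text \<open>The factor is one fifteenth of the area, since \<open>orient\<close> is twice the signed
  area; multiplied by \<open>ws_c\<close> these are the basis functions.\<close>

definition nspline :: "pt \<Rightarrow> pt \<Rightarrow> pt \<Rightarrow> (real \<times> real \<times> real) list \<Rightarrow> real \<times> real \<times> real \<Rightarrow> real" where
  "nspline p1 p2 p3 ks y = \<bar>orient p1 p2 p3\<bar> / 30 * simplex_spline (map (pt_of p1 p2 p3) ks) (pt_of p1 p2 p3 y)"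

lemma orient_pt_of:
  assumes "mass u = 1" "mass v = 1" "mass w = 1"
  shows "orient (pt_of p1 p2 p3 u) (pt_of p1 p2 p3 v) (pt_of p1 p2 p3 w) = det3 u v w * orient p1 p2 p3"
proof -
  obtain a b c a' b' c' a'' b'' c'' where t: "u = (a,b,c)" "v = (a',b',c')" "w = (a'',b'',c'')"
    by (metis prod_cases3)
  have a: "c = 1 - a - b" "c' = 1 - a' - b'" "c'' = 1 - a'' - b''" using assms by (auto simp: t mass_def)
  show ?thesis unfolding t a by (simp add: det3_def orient_def pt_of_def algebra_simps)
qed

lemma nspline_insert:
  assumes D: "orient p1 p2 p3 \<noteq> 0"
    and ms: "mset xs = mset [d,e,f,a,b,c]" "mset ys = mset [g,e,f,a,b,c]" "mset zs = mset [d,g,f,a,b,c]"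
    and mass: "\<forall>k\<in>set [d,e,f,a,b,c,y]. mass k = 1"
    and det: "det3 d e f \<noteq> 0" and \<mu>: "0 < \<mu>" "\<mu> < 1" 
    and g: "g = (\<mu> * fst d + (1 - \<mu>) * fst e, \<mu> * fst (snd d) + (1 - \<mu>) * fst (snd e), \<mu> * snd (snd d) + (1 - \<mu>) * snd (snd e))"
    and nondeg: "det3 g f a \<noteq> 0 \<or> det3 g f b \<noteq> 0 \<or> det3 g f c \<noteq> 0 \<or> det3 g f y \<noteq> 0"
  shows "nspline p1 p2 p3 xs y = \<mu> * nspline p1 p2 p3 ys y + (1 - \<mu>) * nspline p1 p2 p3 zs y"
proof -
  let ?p = "pt_of p1 p2 p3"
  have mg: "mass g = 1"
  proof -
    have "mass g = \<mu> * mass d + (1 - \<mu>) * mass e" unfolding g mass_def by (simp add: case_prod_unfold algebra_simps)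
    then show ?thesis using mass by simp
  qed
  have pg: "?p g = \<mu> *\<^sub>R ?p d + (1 - \<mu>) *\<^sub>R ?p e"
    unfolding g pt_of_def by (simp add: case_prod_unfold algebra_simps)
  have "simplex_spline (map ?p xs) (?p y) = \<mu> * simplex_spline (map ?p ys) (?p y) + (1 - \<mu>) * simplex_spline (map ?p zs) (?p y)"
  proof (rule simplex_spline_insert[of "?p d" "?p e" "?p f" \<mu> "?p g" "?p a" "?p b" "?p c"])
    show "orient (?p g) (?p f) (?p a) \<noteq> 0 \<or> orient (?p g) (?p f) (?p b) \<noteq> 0 \<or> orient (?p g) (?p f) (?p c) \<noteq> 0 \<or> orient (?p g) (?p f) (?p y) \<noteq> 0"
      using mg mass nondeg D by (simp add: orient_pt_of)
  qed (use D ms mass det \<mu> pg in \<open>simp_all add: orient_pt_of\<close>)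
  then show ?thesis by (simp add: nspline_def distrib_left mult_ac)
qed

lemma bary_pt_of:
  assumes "orient p1 p2 p3 \<noteq> 0" "mass u = 1" "mass v = 1" "mass w = 1" "mass y = 1"
  shows "bary (pt_of p1 p2 p3 u) (pt_of p1 p2 p3 v) (pt_of p1 p2 p3 w) (pt_of p1 p2 p3 y) = det3 y v w / det3 u v w"
  using assms by (simp add: bary_def orient_pt_of)

lemma nspline_corner:
  assumes D: "orient p1 p2 p3 \<noteq> 0" and det: "det3 v a b \<noteq> 0" and m: "mset xs = mset [v,a,b,v,v,v]"
    and mass: "\<forall>k\<in>set [v,a,b,y]. mass k = 1"
    and nn: "0 \<le> det3 y b v / det3 v a b" "0 \<le> det3 y v a / det3 v a b"
  shows "nspline p1 p2 p3 xs y = 2 / 3 / \<bar>det3 v a b\<bar> * (max 0 (det3 y a b / det3 v a b))^3"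
proof -
  let ?p = "pt_of p1 p2 p3"
  have rot: "det3 a b v = det3 v a b" "det3 b v a = det3 v a b"
    by (simp_all add: det3_def case_prod_unfold algebra_simps)
  have "simplex_spline (map ?p xs) (?p y) = 20 / \<bar>orient (?p v) (?p a) (?p b)\<bar> * (max 0 (bary (?p v) (?p a) (?p b) (?p y)))^3"
    using D det m mass nn by (intro simplex_spline_corner) (simp_all add: orient_pt_of bary_pt_of rot)
  then show ?thesis using D det mass by (simp add: nspline_def orient_pt_of bary_pt_of abs_mult)
qed

lemma nspline_box:
  assumes D: "orient p1 p2 p3 \<noteq> 0" and m: "mset xs = mset [(1,0,0),(1,0,0),(0,1,0),(0,1,0),(0,0,1),(0,0,1)]"
    and y: "0 \<le> y1" "0 \<le> y2" "0 \<le> y3" "y1 + y2 + y3 = 1"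
  shows "nspline p1 p2 p3 xs (y1, y2, y3) = 4 * (y1 * y2 * y3)"
proof -
  let ?p = "pt_of p1 p2 p3" and ?u = "(1::real,0::real,0::real)" and ?v = "(0::real,1::real,0::real)" and ?w = "(0::real,0::real,1::real)"
  let ?y = "(y1, y2, y3)"
  have b: "bary (?p ?u) (?p ?v) (?p ?w) (?p ?y) = y1" "bary (?p ?v) (?p ?w) (?p ?u) (?p ?y) = y2" "bary (?p ?w) (?p ?u) (?p ?v) (?p ?y) = y3"
    using y by (simp_all add: bary_pt_of[OF D] mass_def det3_def)
  have o: "orient (?p ?u) (?p ?v) (?p ?w) = orient p1 p2 p3" by (simp add: orient_pt_of mass_def det3_def)
  have "simplex_spline (map ?p xs) (?p ?y) = 120 / \<bar>orient (?p ?u) (?p ?v) (?p ?w)\<bar> * (y1 * y2 * y3)"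
    using simplex_spline_box[of "?p ?u" "?p ?v" "?p ?w" "map ?p xs" "?p ?y"] D m y unfolding b o
    by (simp add: add_mset_commute)
  then show ?thesis using D by (simp add: nspline_def o)
qed

section \<open>The knot multisets of the basis\<close>

abbreviation "v1 \<equiv> (1::real, 0::real, 0::real)"
abbreviation "v2 \<equiv> (0::real, 1::real, 0::real)"
abbreviation "v3 \<equiv> (0::real, 0::real, 1::real)"
abbreviation "e12 \<equiv> (0::real, 2/3::real, 1/3::real)"
abbreviation "e13 \<equiv> (0::real, 1/3::real, 2/3::real)"
abbreviation "e21 \<equiv> (2/3::real, 0::real, 1/3::real)"
abbreviation "e23 \<equiv> (1/3::real, 0::real, 2/3::real)"
abbreviation "e31 \<equiv> (2/3::real, 1/3::real, 0::real)"
abbreviation "e32 \<equiv> (1/3::real, 2/3::real, 0::real)"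

text \<open>Here \<open>u\<close> belongs to the vertex, and the line
  \<open>u = r * v + s * w\<close> meets the two adjacent sides where the ratio of \<open>u\<close>
  to \<open>v\<close> is \<open>r\<close> and that of \<open>u\<close> to \<open>w\<close> is
  \<open>s\<close>. The knots on a side, apart from the vertex itself, have the ratios 2, 1/2 and
  0.\<close>

definition corner :: "real \<Rightarrow> real \<Rightarrow> real \<Rightarrow> real \<Rightarrow> real \<Rightarrow> real" where
  "corner r s u v w = (max 0 (u - r * v - s * w)) ^ 3"

locale interior_point =
  fixes p1 p2 p3 :: pt and y1 y2 y3 :: real
  assumes nondegenerate: "orient p1 p2 p3 \<noteq> 0"
    and y: "0 < y1" "0 < y2" "0 < y3" "y1 + y2 + y3 = 1"
begin

abbreviation N :: "(real \<times> real \<times> real) list \<Rightarrow> real" where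
  "N ks \<equiv> nspline p1 p2 p3 ks (y1, y2, y3)"

lemmas eval = det3_def mass_def add_mset_commute

lemma y_nonzero [simp]: "y1 \<noteq> 0" "y2 \<noteq> 0" "y3 \<noteq> 0"
  using y by simp_all

declare y(1-3) [simp] y(1-3) [THEN less_imp_le, simp]

text \<open>One conjunction of side conditions lets a single simplification on numerals settle an
  instance; \<open>\<nu>\<close> stands for \<open>1 - \<mu>\<close> so that both weights appear as
  literal fractions.\<close>

lemma insertion:
  assumes "mset xs = mset [d,e,f,a,b,c] \<and> mset ys = mset [g,e,f,a,b,c] \<and> mset zs = mset [d,g,f,a,b,c]
    \<and> (\<forall>k\<in>set [d,e,f,a,b,c]. mass k = 1) \<and> det3 d e f \<noteq> 0 \<and> 0 < \<mu> \<and> 0 < \<nu> \<and> \<mu> + \<nu> = 1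
    \<and> g = (\<mu> * fst d + \<nu> * fst e, \<mu> * fst (snd d) + \<nu> * fst (snd e), \<mu> * snd (snd d) + \<nu> * snd (snd e))
    \<and> (det3 g f a \<noteq> 0 \<or> det3 g f b \<noteq> 0 \<or> det3 g f c \<noteq> 0 \<or> det3 g f (y1, y2, y3) \<noteq> 0)"
  shows "N xs = \<mu> * N ys + \<nu> * N zs"
proof -
  have "\<nu> = 1 - \<mu>" using assms by simp
  moreover have "mass (y1, y2, y3) = 1" using y by (simp add: mass_def)
  ultimately show ?thesis using assms nondegenerate
    by (simp only:, intro nspline_insert[of p1 p2 p3 xs d e f a b c ys g zs]) auto
qed

lemma corner_spline:
  assumes "mset xs = mset [v,a,b,v,v,v] \<and> (\<forall>k\<in>set [v,a,b]. mass k = 1) \<and> 0 < det3 v a b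
    \<and> 0 \<le> det3 (y1, y2, y3) b v \<and> 0 \<le> det3 (y1, y2, y3) v a
    \<and> m = 2 / (3 * det3 v a b) \<and> det3 (y1, y2, y3) a b / det3 v a b = t - r * t' - s * t''"
  shows "N xs = m * corner r s t t' t''"
  using assms nondegenerate y by (subst nspline_corner[of p1 p2 p3 v a b]) (simp_all add: mass_def corner_def)

text \<open>The factor is \<open>2/3 * (1 + r) * (1 + s)\<close>, because the triangle cut off at
  the vertex has relative area \<open>1 / ((1 + r) * (1 + s))\<close>. Knots are listed in one fixed
  order, so that equal multisets are equal terms in the linear elimination.\<close>

lemma corner_splines:
  shows "N [v1, v1, v1, v1, v2, v3] = 2/3 * corner 0 0 y1 y2 y3"
    and "N [v1, v1, v1, v1, v2, e21] = 2 * corner 0 2 y1 y2 y3"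
    and "N [v1, v1, v1, v1, v2, e23] = 1 * corner 0 (1/2) y1 y2 y3"
    and "N [v1, v1, v1, v1, v3, e31] = 2 * corner 2 0 y1 y2 y3"
    and "N [v1, v1, v1, v1, v3, e32] = 1 * corner (1/2) 0 y1 y2 y3"
    and "N [v1, v1, v1, v1, e21, e31] = 6 * corner 2 2 y1 y2 y3"
    and "N [v1, v1, v1, v1, e21, e32] = 3 * corner (1/2) 2 y1 y2 y3"
    and "N [v1, v1, v1, v1, e23, e31] = 3 * corner 2 (1/2) y1 y2 y3"
    and "N [v1, v1, v1, v1, e23, e32] = 3/2 * corner (1/2) (1/2) y1 y2 y3"
    and "N [v1, v2, v2, v2, v2, v3] = 2/3 * corner 0 0 y2 y3 y1"
    and "N [v1, v2, v2, v2, v2, e12] = 2 * corner 2 0 y2 y3 y1"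
    and "N [v1, v2, v2, v2, v2, e13] = 1 * corner (1/2) 0 y2 y3 y1"
    and "N [v1, v2, v3, v3, v3, v3] = 2/3 * corner 0 0 y3 y1 y2"
    and "N [v1, v3, v3, v3, v3, e12] = 1 * corner 0 (1/2) y3 y1 y2"
    and "N [v1, v3, v3, v3, v3, e13] = 2 * corner 0 2 y3 y1 y2"
    and "N [v2, v2, v2, v2, v3, e31] = 1 * corner 0 (1/2) y2 y3 y1"
    and "N [v2, v2, v2, v2, v3, e32] = 2 * corner 0 2 y2 y3 y1"
    and "N [v2, v2, v2, v2, e12, e31] = 3 * corner 2 (1/2) y2 y3 y1"
    and "N [v2, v2, v2, v2, e12, e32] = 6 * corner 2 2 y2 y3 y1"
    and "N [v2, v2, v2, v2, e13, e31] = 3/2 * corner (1/2) (1/2) y2 y3 y1"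
    and "N [v2, v2, v2, v2, e13, e32] = 3 * corner (1/2) 2 y2 y3 y1"
    and "N [v2, v3, v3, v3, v3, e21] = 1 * corner (1/2) 0 y3 y1 y2"
    and "N [v2, v3, v3, v3, v3, e23] = 2 * corner 2 0 y3 y1 y2"
    and "N [v3, v3, v3, v3, e12, e21] = 3/2 * corner (1/2) (1/2) y3 y1 y2"
    and "N [v3, v3, v3, v3, e12, e23] = 3 * corner 2 (1/2) y3 y1 y2"
    and "N [v3, v3, v3, v3, e13, e21] = 3 * corner (1/2) 2 y3 y1 y2"
    and "N [v3, v3, v3, v3, e13, e23] = 6 * corner 2 2 y3 y1 y2"
  by (rule corner_spline[of _ v1 v2 v3], simp add: eval diff_divide_distrib add_divide_distrib algebra_simps,
      rule corner_spline[of _ v1 v2 e21], simp add: eval diff_divide_distrib add_divide_distrib algebra_simps,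
      rule corner_spline[of _ v1 v2 e23], simp add: eval diff_divide_distrib add_divide_distrib algebra_simps,
      rule corner_spline[of _ v1 e31 v3], simp add: eval diff_divide_distrib add_divide_distrib algebra_simps,
      rule corner_spline[of _ v1 e32 v3], simp add: eval diff_divide_distrib add_divide_distrib algebra_simps,
      rule corner_spline[of _ v1 e31 e21], simp add: eval diff_divide_distrib add_divide_distrib algebra_simps,
      rule corner_spline[of _ v1 e32 e21], simp add: eval diff_divide_distrib add_divide_distrib algebra_simps,
      rule corner_spline[of _ v1 e31 e23], simp add: eval diff_divide_distrib add_divide_distrib algebra_simps,
      rule corner_spline[of _ v1 e32 e23], simp add: eval diff_divide_distrib add_divide_distrib algebra_simps,
      rule corner_spline[of _ v2 v3 v1], simp add: eval diff_divide_distrib add_divide_distrib algebra_simps,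
      rule corner_spline[of _ v2 e12 v1], simp add: eval diff_divide_distrib add_divide_distrib algebra_simps,
      rule corner_spline[of _ v2 e13 v1], simp add: eval diff_divide_distrib add_divide_distrib algebra_simps,
      rule corner_spline[of _ v3 v1 v2], simp add: eval diff_divide_distrib add_divide_distrib algebra_simps,
      rule corner_spline[of _ v3 v1 e12], simp add: eval diff_divide_distrib add_divide_distrib algebra_simps,
      rule corner_spline[of _ v3 v1 e13], simp add: eval diff_divide_distrib add_divide_distrib algebra_simps,
      rule corner_spline[of _ v2 v3 e31], simp add: eval diff_divide_distrib add_divide_distrib algebra_simps,
      rule corner_spline[of _ v2 v3 e32], simp add: eval diff_divide_distrib add_divide_distrib algebra_simps,
      rule corner_spline[of _ v2 e12 e31], simp add: eval diff_divide_distrib add_divide_distrib algebra_simps,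
      rule corner_spline[of _ v2 e12 e32], simp add: eval diff_divide_distrib add_divide_distrib algebra_simps,
      rule corner_spline[of _ v2 e13 e31], simp add: eval diff_divide_distrib add_divide_distrib algebra_simps,
      rule corner_spline[of _ v2 e13 e32], simp add: eval diff_divide_distrib add_divide_distrib algebra_simps,
      rule corner_spline[of _ v3 e21 v2], simp add: eval diff_divide_distrib add_divide_distrib algebra_simps,
      rule corner_spline[of _ v3 e23 v2], simp add: eval diff_divide_distrib add_divide_distrib algebra_simps,
      rule corner_spline[of _ v3 e21 e12], simp add: eval diff_divide_distrib add_divide_distrib algebra_simps,
      rule corner_spline[of _ v3 e23 e12], simp add: eval diff_divide_distrib add_divide_distrib algebra_simps,
      rule corner_spline[of _ v3 e21 e13], simp add: eval diff_divide_distrib add_divide_distrib algebra_simps,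
      rule corner_spline[of _ v3 e23 e13], simp add: eval diff_divide_distrib add_divide_distrib algebra_simps)

text \<open>Inserting a knot on a whole side gives the weights 1/3 and 2/3; halving two thirds of a
  side gives 1/2 and 1/2.\<close>

lemma insertions_1:
  shows "N [v1, v1, v1, v1, e21, e32] = 1/2 * N [v1, v1, v1, e21, e31, e32] + 1/2 * N [v1, v1, v1, v1, e21, e31]"
    and "N [v1, v1, v1, v1, v2, e21] = 2/3 * N [v1, v1, v1, v2, e21, e31] + 1/3 * N [v1, v1, v1, v1, e21, e31]"
    and "N [v1, v1, v1, v2, e21, e31] = 1/3 * N [v1, v1, v2, e21, e31, e32] + 2/3 * N [v1, v1, v1, e21, e31, e32]"
    and "N [v1, v1, v1, v1, e23, e32] = 1/2 * N [v1, v1, v1, e23, e31, e32] + 1/2 * N [v1, v1, v1, v1, e23, e31]"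
    and "N [v1, v1, v1, e23, e31, e32] = 1/2 * N [v1, v1, v1, e21, e31, e32] + 1/2 * N [v1, v1, e21, e23, e31, e32]"
    and "N [v1, v1, v1, v1, v2, v3] = 2/3 * N [v1, v1, v1, v2, v3, e31] + 1/3 * N [v1, v1, v1, v1, v3, e31]"
    and "N [v1, v1, v1, v1, v3, e32] = 1/2 * N [v1, v1, v1, v3, e31, e32] + 1/2 * N [v1, v1, v1, v1, v3, e31]"
    and "N [v1, v1, v1, v2, v3, e31] = 1/3 * N [v1, v1, v2, v3, e31, e32] + 2/3 * N [v1, v1, v1, v3, e31, e32]"
    and "N [v1, v1, v2, v3, e31, e32] = 1/3 * N [v1, v1, v2, e21, e31, e32] + 2/3 * N [v1, v2, v3, e21, e31, e32]"
    and "N [v1, v2, v2, v2, v2, v3] = 2/3 * N [v2, v2, v2, v2, v3, e31] + 1/3 * N [v1, v2, v2, v2, v3, e31]"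
    and "N [v1, v2, v2, v2, v2, e12] = 2/3 * N [v2, v2, v2, v2, e12, e31] + 1/3 * N [v1, v2, v2, v2, e12, e31]"
    and "N [v1, v2, v2, v2, v3, e31] = 2/3 * N [v1, v2, v2, v3, e12, e31] + 1/3 * N [v1, v2, v2, v2, e12, e31]"
    and "N [v1, v1, v1, v2, v3, e31] = 1/3 * N [v1, v1, v1, v2, e21, e31] + 2/3 * N [v1, v1, v2, v3, e21, e31]"
    and "N [v1, v2, v3, v3, v3, v3] = 2/3 * N [v1, v3, v3, v3, v3, e12] + 1/3 * N [v1, v2, v3, v3, v3, e12]"
    and "N [v2, v3, v3, v3, v3, e21] = 2/3 * N [v3, v3, v3, v3, e12, e21] + 1/3 * N [v2, v3, v3, v3, e12, e21]"
    and "N [v1, v2, v3, v3, v3, e12] = 1/3 * N [v1, v2, v3, v3, e12, e21] + 2/3 * N [v2, v3, v3, v3, e12, e21]"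
    and "N [v1, v2, v2, v2, v2, v3] = 1/3 * N [v2, v2, v2, v2, v3, e32] + 2/3 * N [v1, v2, v2, v2, v3, e32]"
    and "N [v1, v2, v2, v2, v3, e31] = 1/2 * N [v1, v2, v2, v2, v3, e32] + 1/2 * N [v1, v2, v2, v3, e31, e32]"
    and "N [v1, v2, v2, v2, v2, e12] = 1/3 * N [v2, v2, v2, v2, e12, e32] + 2/3 * N [v1, v2, v2, v2, e12, e32]"
    and "N [v1, v2, v2, v2, e12, e31] = 1/2 * N [v1, v2, v2, v2, e12, e32] + 1/2 * N [v1, v2, v2, e12, e31, e32]"
    and "N [v1, v2, v2, v3, e31, e32] = 2/3 * N [v1, v2, v3, e12, e31, e32] + 1/3 * N [v1, v2, v2, e12, e31, e32]"
  by (rule insertion[of _ v1 e32 e21 v1 v1 v1 _ e31], simp add: eval,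
      rule insertion[of _ v1 v2 e21 v1 v1 v1 _ e31], simp add: eval,
      rule insertion[of _ v1 v2 e21 v1 v1 e31 _ e32], simp add: eval,
      rule insertion[of _ v1 e32 e23 v1 v1 v1 _ e31], simp add: eval,
      rule insertion[of _ e23 v1 e32 v1 v1 e31 _ e21], simp add: eval,
      rule insertion[of _ v1 v2 v3 v1 v1 v1 _ e31], simp add: eval,
      rule insertion[of _ v1 e32 v3 v1 v1 v1 _ e31], simp add: eval,
      rule insertion[of _ v1 v2 v3 v1 v1 e31 _ e32], simp add: eval,
      rule insertion[of _ v3 v1 e32 v1 v2 e31 _ e21], simp add: eval,
      rule insertion[of _ v1 v2 v3 v2 v2 v2 _ e31], simp add: eval,
      rule insertion[of _ v1 v2 e12 v2 v2 v2 _ e31], simp add: eval,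
      rule insertion[of _ v2 v3 v1 v2 v2 e31 _ e12], simp add: eval,
      rule insertion[of _ v3 v1 v2 v1 v1 e31 _ e21], simp add: eval,
      rule insertion[of _ v2 v3 v1 v3 v3 v3 _ e12], simp add: eval,
      rule insertion[of _ v2 v3 e21 v3 v3 v3 _ e12], simp add: eval,
      rule insertion[of _ v3 v1 v2 v3 v3 e12 _ e21], simp add: eval,
      rule insertion[of _ v1 v2 v3 v2 v2 v2 _ e32], simp add: eval,
      rule insertion[of _ e31 v2 v3 v1 v2 v2 _ e32], simp add: eval,
      rule insertion[of _ v1 v2 e12 v2 v2 v2 _ e32], simp add: eval,
      rule insertion[of _ e31 v2 e12 v1 v2 v2 _ e32], simp add: eval,
      rule insertion[of _ v2 v3 e32 v1 v2 e31 _ e12], simp add: eval)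

text \<open>Unlike the other relations, these cannot be solved one spline at a time: further unknown splines
  are eliminated by linear arithmetic.\<close>

lemma insertions_2:
  shows "N [v1, v2, v3, e21, e31, e32] = 2/3 * N [v1, v3, e12, e21, e31, e32] + 1/3 * N [v1, v2, e12, e21, e31, e32]"
    and "N [v1, v2, v3, v3, e12, e31] = 1/3 * N [v1, v2, v3, e12, e21, e31] + 2/3 * N [v2, v3, v3, e12, e21, e31]"
    and "N [v1, v1, v2, v2, v3, v3] = 2/3 * N [v1, v2, v2, v3, v3, e31] + 1/3 * N [v1, v1, v2, v3, v3, e31]"
    and "N [v1, v2, v3, v3, e21, e31] = 2/3 * N [v1, v3, v3, e12, e21, e31] + 1/3 * N [v1, v2, v3, e12, e21, e31]"
    and "N [v1, v2, v2, v3, v3, e31] = 2/3 * N [v1, v2, v3, v3, e12, e31] + 1/3 * N [v1, v2, v2, v3, e12, e31]"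
    and "N [v1, v1, v2, v3, v3, e31] = 1/3 * N [v1, v1, v2, v3, e21, e31] + 2/3 * N [v1, v2, v3, v3, e21, e31]"
    and "N [v1, v2, v3, v3, e12, e21] = 2/3 * N [v2, v3, v3, e12, e21, e31] + 1/3 * N [v1, v3, v3, e12, e21, e31]"
    and "N [v1, v2, v3, e12, e21, e31] = 1/3 * N [v2, v3, e12, e21, e31, e32] + 2/3 * N [v1, v3, e12, e21, e31, e32]"
    and "N [v1, v2, v3, e12, e31, e32] = 1/3 * N [v1, v2, e12, e21, e31, e32] + 2/3 * N [v2, v3, e12, e21, e31, e32]"
  by (rule insertion[of _ v2 v3 e21 v1 e31 e32 _ e12], simp add: eval,
      rule insertion[of _ v3 v1 v2 v3 e12 e31 _ e21], simp add: eval,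
      rule insertion[of _ v1 v2 v3 v1 v2 v3 _ e31], simp add: eval,
      rule insertion[of _ v2 v3 e21 v1 v3 e31 _ e12], simp add: eval,
      rule insertion[of _ v2 v3 v1 v2 v3 e31 _ e12], simp add: eval,
      rule insertion[of _ v3 v1 v2 v1 v3 e31 _ e21], simp add: eval,
      rule insertion[of _ v1 v2 e21 v3 v3 e12 _ e31], simp add: eval,
      rule insertion[of _ v1 v2 e21 v3 e12 e31 _ e32], simp add: eval,
      rule insertion[of _ v3 v1 e32 v2 e12 e31 _ e21], simp add: eval)

lemma insertions_3:
  shows "N [v1, v2, v3, e12, e21, e32] = 1/2 * N [v2, v3, e12, e21, e31, e32] + 1/2 * N [v1, v2, v3, e12, e21, e31]"
    and "N [v1, v2, v3, v3, v3, v3] = 1/3 * N [v1, v3, v3, v3, v3, e13] + 2/3 * N [v1, v2, v3, v3, v3, e13]"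
    and "N [v1, v2, v3, v3, v3, e12] = 1/2 * N [v1, v2, v3, v3, v3, e13] + 1/2 * N [v1, v2, v3, v3, e12, e13]"
    and "N [v1, v2, v3, v3, e12, e13] = 2/3 * N [v1, v2, v3, e12, e13, e23] + 1/3 * N [v2, v3, v3, e12, e13, e23]"
    and "N [v1, v2, v3, e12, e13, e23] = 1/3 * N [v2, v3, e12, e13, e23, e32] + 2/3 * N [v1, v3, e12, e13, e23, e32]"
    and "N [v1, v2, v2, v3, e12, e31] = 1/2 * N [v1, v2, v2, v3, e12, e32] + 1/2 * N [v1, v2, v3, e12, e31, e32]"
    and "N [v1, v2, v2, v2, v2, e13] = 1/3 * N [v2, v2, v2, v2, e13, e32] + 2/3 * N [v1, v2, v2, v2, e13, e32]"
    and "N [v1, v2, v2, v2, e13, e32] = 1/2 * N [v1, v2, v2, e12, e13, e32] + 1/2 * N [v1, v2, v2, v2, e12, e32]"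
    and "N [v1, v2, v2, v3, e12, e32] = 1/3 * N [v1, v2, v3, e12, e13, e32] + 2/3 * N [v1, v2, v2, e12, e13, e32]"
    and "N [v1, v2, v3, e12, e13, e32] = 2/3 * N [v1, v2, e12, e13, e23, e32] + 1/3 * N [v2, v3, e12, e13, e23, e32]"
    and "N [v1, v2, v3, e12, e23, e32] = 1/3 * N [v1, v3, e12, e13, e23, e32] + 2/3 * N [v1, v2, e12, e13, e23, e32]"
    and "N [v1, v2, v3, e12, e21, e32] = 1/2 * N [v1, v2, e12, e21, e23, e32] + 1/2 * N [v1, v2, v3, e12, e23, e32]"
    and "N [v1, v1, v1, v1, v2, e23] = 2/3 * N [v1, v1, v1, v2, e23, e31] + 1/3 * N [v1, v1, v1, v1, e23, e31]"
    and "N [v1, v1, v1, v2, e23, e31] = 1/3 * N [v1, v1, v2, e23, e31, e32] + 2/3 * N [v1, v1, v1, e23, e31, e32]"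
    and "N [v1, v1, v2, v3, e31, e32] = 2/3 * N [v1, v1, v2, e23, e31, e32] + 1/3 * N [v1, v2, v3, e23, e31, e32]"
    and "N [v1, v2, v3, e23, e31, e32] = 1/2 * N [v1, v2, v3, e21, e31, e32] + 1/2 * N [v2, v3, e21, e23, e31, e32]"
  by (rule insertion[of _ v1 e32 e21 v2 v3 e12 _ e31], simp add: eval,
      rule insertion[of _ v2 v3 v1 v3 v3 v3 _ e13], simp add: eval,
      rule insertion[of _ e12 v3 v1 v2 v3 v3 _ e13], simp add: eval,
      rule insertion[of _ v3 v1 v2 v3 e12 e13 _ e23], simp add: eval,
      rule insertion[of _ v1 v2 e23 v3 e12 e13 _ e32], simp add: eval,
      rule insertion[of _ e31 v2 v3 v1 v2 e12 _ e32], simp add: eval,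
      rule insertion[of _ v1 v2 e13 v2 v2 v2 _ e32], simp add: eval,
      rule insertion[of _ v2 e13 e32 v1 v2 v2 _ e12], simp add: eval,
      rule insertion[of _ v2 v3 e32 v1 v2 e12 _ e13], simp add: eval,
      rule insertion[of _ v3 v1 e32 v2 e12 e13 _ e23], simp add: eval,
      rule insertion[of _ v2 v3 e32 v1 e12 e23 _ e13], simp add: eval,
      rule insertion[of _ v3 e21 e32 v1 v2 e12 _ e23], simp add: eval,
      rule insertion[of _ v1 v2 e23 v1 v1 v1 _ e31], simp add: eval,
      rule insertion[of _ v1 v2 e23 v1 v1 e31 _ e32], simp add: eval,
      rule insertion[of _ v3 v1 e32 v1 v2 e31 _ e23], simp add: eval,
      rule insertion[of _ e23 v1 e32 v2 v3 e31 _ e21], simp add: eval)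

text \<open>The unknowns on the right share five side knots and differ in the vertex; the relations
  form a cyclic system of three equations in them with nonzero determinant.\<close>

lemma insertions_4:
  shows "N [v1, v3, e12, e21, e31, e32] = 2/3 * N [v1, e12, e21, e23, e31, e32] + 1/3 * N [v3, e12, e21, e23, e31, e32]"
    and "N [v1, v2, e12, e21, e23, e32] = 2/3 * N [v2, e12, e21, e23, e31, e32] + 1/3 * N [v1, e12, e21, e23, e31, e32]"
    and "N [v2, v3, e21, e23, e31, e32] = 2/3 * N [v3, e12, e21, e23, e31, e32] + 1/3 * N [v2, e12, e21, e23, e31, e32]"
  by (rule insertion[of _ v3 v1 e12 e21 e31 e32 _ e23], simp add: eval,
      rule insertion[of _ v1 v2 e21 e12 e23 e32 _ e31], simp add: eval,
      rule insertion[of _ v2 v3 e21 e23 e31 e32 _ e12], simp add: eval)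

text \<open>The last relation contains the spline on the six side points. The first and third supply
  the two splines at \<open>v3\<close> that occur with it, and the second draws on the cyclic system
  of \<open>insertions_4\<close>.\<close>

lemma insertions_5:
  shows "N [v2, v3, e12, e21, e31, e32] = 1/3 * N [v3, e12, e13, e21, e31, e32] + 2/3 * N [v2, e12, e13, e21, e31, e32]"
    and "N [v2, v3, e12, e21, e31, e32] = 1/2 * N [v2, e12, e21, e23, e31, e32] + 1/2 * N [v2, v3, e12, e23, e31, e32]"
    and "N [v2, v3, e12, e23, e31, e32] = 1/3 * N [v3, e12, e13, e23, e31, e32] + 2/3 * N [v2, e12, e13, e23, e31, e32]"
    and "N [v3, e12, e13, e21, e31, e32] = 1/2 * N [e12, e13, e21, e23, e31, e32] + 1/2 * N [v3, e12, e13, e23, e31, e32]"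
  by (rule insertion[of _ v2 v3 e21 e12 e31 e32 _ e13], simp add: eval,
      rule insertion[of _ v3 e21 e32 v2 e12 e31 _ e23], simp add: eval,
      rule insertion[of _ v2 v3 e32 e12 e23 e31 _ e13], simp add: eval,
      rule insertion[of _ v3 e21 e32 e12 e13 e31 _ e23], simp add: eval)

lemma box_spline: "N [v1,v1,v2,v2,v3,v3] = 4 * (y1 * y2 * y3)"
  using nondegenerate y by (intro nspline_box) simp_all

text \<open>One representative for each of four orbits of knot multisets under renaming the
  vertices; the other members follow by symmetry.\<close>

lemma orbit_splines_1:
  shows "N [v1, v1, v1, e21, e31, e32] = - 6 * corner 2 2 y1 y2 y3 + 6 * corner (1/2) 2 y1 y2 y3"
    and "N [v1, v1, v2, e21, e31, e32] = 9 * corner 0 2 y1 y2 y3 + 3 * corner 2 2 y1 y2 y3 - 12 * corner (1/2) 2 y1 y2 y3"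
    and "N [v1, v1, e21, e23, e31, e32] = 6 * corner 2 2 y1 y2 y3 - 6 * corner (1/2) 2 y1 y2 y3 - 6 * corner 2 (1/2) y1 y2 y3 + 6 * corner (1/2) (1/2) y1 y2 y3"
    and "N [v1, v2, e12, e21, e31, e32] = 21/2 * corner 0 0 y1 y2 y3 - 21/2 * corner 0 2 y1 y2 y3 + 3/2 * corner 2 0 y1 y2 y3 - 12 * corner (1/2) 0 y1 y2 y3 - 3/2 * corner 2 2 y1 y2 y3 + 12 * corner (1/2) 2 y1 y2 y3 - 36 * (y1 * y2 * y3) + 21/2 * corner 0 0 y2 y3 y1 - 21/2 * corner 2 0 y2 y3 y1 + 24 * corner 0 0 y3 y1 y2 - 24 * corner 0 (1/2) y3 y1 y2 - 12 * corner 0 (1/2) y2 y3 y1 + 3/2 * corner 0 2 y2 y3 y1 + 12 * corner 2 (1/2) y2 y3 y1 - 3/2 * corner 2 2 y2 y3 y1 - 24 * corner (1/2) 0 y3 y1 y2 + 24 * corner (1/2) (1/2) y3 y1 y2"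
  using insertions_1 insertions_2 corner_splines box_spline by linarith+

section \<open>Symmetry of the triangle and the remaining orbits\<close>

lemma relabel:
  shows "nspline p2 p3 p1 ks (y2, y3, y1) = N (map (\<lambda>(a, b, c). (c, a, b)) ks)"
    and "nspline p3 p1 p2 ks (y3, y1, y2) = N (map (\<lambda>(a, b, c). (b, c, a)) ks)"
    and "nspline p2 p1 p3 ks (y2, y1, y3) = N (map (\<lambda>(a, b, c). (b, a, c)) ks)"
    and "nspline p1 p3 p2 ks (y1, y3, y2) = N (map (\<lambda>(a, b, c). (a, c, b)) ks)"
    and "nspline p3 p2 p1 ks (y3, y2, y1) = N (map (\<lambda>(a, b, c). (c, b, a)) ks)"
proof -
  have "\<bar>orient p2 p3 p1\<bar> = \<bar>orient p1 p2 p3\<bar>" "\<bar>orient p3 p1 p2\<bar> = \<bar>orient p1 p2 p3\<bar>"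
    "\<bar>orient p2 p1 p3\<bar> = \<bar>orient p1 p2 p3\<bar>" "\<bar>orient p1 p3 p2\<bar> = \<bar>orient p1 p2 p3\<bar>"
    "\<bar>orient p3 p2 p1\<bar> = \<bar>orient p1 p2 p3\<bar>"
    by (simp_all add: orient_def algebra_simps abs_if)
  moreover have "pt_of p2 p3 p1 = (\<lambda>k. pt_of p1 p2 p3 (case k of (a, b, c) \<Rightarrow> (c, a, b)))"
    "pt_of p3 p1 p2 = (\<lambda>k. pt_of p1 p2 p3 (case k of (a, b, c) \<Rightarrow> (b, c, a)))"
    "pt_of p2 p1 p3 = (\<lambda>k. pt_of p1 p2 p3 (case k of (a, b, c) \<Rightarrow> (b, a, c)))"
    "pt_of p1 p3 p2 = (\<lambda>k. pt_of p1 p2 p3 (case k of (a, b, c) \<Rightarrow> (a, c, b)))"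
    "pt_of p3 p2 p1 = (\<lambda>k. pt_of p1 p2 p3 (case k of (a, b, c) \<Rightarrow> (c, b, a)))"
    by (auto simp: pt_of_def)
  ultimately show "nspline p2 p3 p1 ks (y2, y3, y1) = N (map (\<lambda>(a, b, c). (c, a, b)) ks)"
    "nspline p3 p1 p2 ks (y3, y1, y2) = N (map (\<lambda>(a, b, c). (b, c, a)) ks)"
    "nspline p2 p1 p3 ks (y2, y1, y3) = N (map (\<lambda>(a, b, c). (b, a, c)) ks)"
    "nspline p1 p3 p2 ks (y1, y3, y2) = N (map (\<lambda>(a, b, c). (a, c, b)) ks)"
    "nspline p3 p2 p1 ks (y3, y2, y1) = N (map (\<lambda>(a, b, c). (c, b, a)) ks)"
    by (simp_all add: nspline_def comp_def)
qed

lemma nspline_mset: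
  assumes "mset xs = mset [d,e,f,a,b,c]" "mset ys = mset [d,e,f,a,b,c]"
    and "\<forall>k\<in>set [d,e,f]. mass k = 1" "det3 d e f \<noteq> 0"
  shows "N xs = N ys"
proof -
  let ?p = "pt_of p1 p2 p3"
  have D: "orient (?p d) (?p e) (?p f) \<noteq> 0" using assms nondegenerate by (simp add: orient_pt_of)
  have "mset (map ?p xs) = mset [?p d, ?p e, ?p f, ?p a, ?p b, ?p c]" "mset (map ?p ys) = mset [?p d, ?p e, ?p f, ?p a, ?p b, ?p c]"
    using assms by simp_all
  then show ?thesis unfolding nspline_def using simplex_spline_eq[OF D] by simp
qed

lemma permuted:
  "interior_point p2 p3 p1 y2 y3 y1" "interior_point p3 p1 p2 y3 y1 y2" "interior_point p2 p1 p3 y2 y1 y3"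
  "interior_point p1 p3 p2 y1 y3 y2" "interior_point p3 p2 p1 y3 y2 y1"
  using nondegenerate y by (unfold_locales; simp add: orient_def algebra_simps)+

lemma corner_swap:
  "corner r s y1 y3 y2 = corner s r y1 y2 y3" "corner r s y2 y1 y3 = corner s r y2 y3 y1" "corner r s y3 y2 y1 = corner s r y3 y1 y2"
  by (simp_all add: corner_def algebra_simps)

text \<open>The elimination for \<open>orbit_splines_2\<close> meets this image and
  \<open>spline_20\<close> of known representatives; symmetry supplies them instead of further
  insertions.\<close>

lemma spline_15: "N [v2, v3, v3, e12, e13, e23] = 9 * corner 2 0 y3 y1 y2 - 12 * corner 2 (1/2) y3 y1 y2 + 3 * corner 2 2 y3 y1 y2"
proof -
  have "N [v2, v3, v3, e12, e13, e23] = N [v3, v3, v2, e23, e13, e12]"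
    by (rule nspline_mset[of _ v2 v3 e23 v3 e12 e13]) (simp_all add: eval)
  then show ?thesis
    using interior_point.orbit_splines_1(2)[OF permuted(5)] by (simp add: relabel corner_swap algebra_simps)
qed

lemma spline_20: "N [v2, v3, e12, e13, e23, e32] = 24 * corner 0 0 y1 y2 y3 - 24 * corner 0 (1/2) y1 y2 y3 - 24 * corner (1/2) 0 y1 y2 y3 + 24 * corner (1/2) (1/2) y1 y2 y3 - 36 * (y1 * y2 * y3) + 21/2 * corner 0 0 y2 y3 y1 + 3/2 * corner 2 0 y2 y3 y1 - 12 * corner (1/2) 0 y2 y3 y1 + 21/2 * corner 0 0 y3 y1 y2 - 12 * corner 0 (1/2) y3 y1 y2 + 3/2 * corner 0 2 y3 y1 y2 - 21/2 * corner 0 2 y2 y3 y1 - 3/2 * corner 2 2 y2 y3 y1 + 12 * corner (1/2) 2 y2 y3 y1 - 21/2 * corner 2 0 y3 y1 y2 + 12 * corner 2 (1/2) y3 y1 y2 - 3/2 * corner 2 2 y3 y1 y2"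
proof -
  have "N [v2, v3, e12, e13, e23, e32] = N [v2, v3, e23, e32, e12, e13]"
    by (rule nspline_mset[of _ v2 v3 e23 e12 e13 e32]) (simp_all add: eval)
  then show ?thesis
    using interior_point.orbit_splines_1(4)[OF permuted(1)] by (simp add: relabel corner_swap algebra_simps)
qed

lemma orbit_splines_2:
  shows "N [v1, e12, e21, e23, e31, e32] = - 5 * corner 0 0 y1 y2 y3 - 3 * corner 0 2 y1 y2 y3 + 8 * corner 0 (1/2) y1 y2 y3 - corner 2 0 y1 y2 y3 + 6 * corner (1/2) 0 y1 y2 y3 - 3 * corner 2 2 y1 y2 y3 + 6 * corner (1/2) 2 y1 y2 y3 + 4 * corner 2 (1/2) y1 y2 y3 - 12 * corner (1/2) (1/2) y1 y2 y3 + 30 * (y1 * y2 * y3) - 29/4 * corner 0 0 y2 y3 y1 + 29/4 * corner 2 0 y2 y3 y1 - 23 * corner 0 0 y3 y1 y2 + 23 * corner 0 (1/2) y3 y1 y2 + 8 * corner 0 (1/2) y2 y3 y1 - 3/4 * corner 0 2 y2 y3 y1 - 8 * corner 2 (1/2) y2 y3 y1 + 3/4 * corner 2 2 y2 y3 y1 + 24 * corner (1/2) 0 y3 y1 y2 - corner 2 0 y3 y1 y2 - 24 * corner (1/2) (1/2) y3 y1 y2 + corner 2 (1/2) y3 y1 y2"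
  using insertions_1 insertions_2 insertions_3 insertions_4 corner_splines box_spline spline_15 spline_20 by linarith

text \<open>With \<open>spline_25\<close>, one of the two images of \<open>orbit_splines_2\<close>
  that occur in \<open>insertions_5\<close>.\<close>

lemma spline_24: "N [v2, e12, e13, e23, e31, e32] = - 23 * corner 0 0 y1 y2 y3 + 23 * corner 0 (1/2) y1 y2 y3 - corner 2 0 y1 y2 y3 + 24 * corner (1/2) 0 y1 y2 y3 + corner 2 (1/2) y1 y2 y3 - 24 * corner (1/2) (1/2) y1 y2 y3 + 30 * (y1 * y2 * y3) - 5 * corner 0 0 y2 y3 y1 - corner 2 0 y2 y3 y1 + 6 * corner (1/2) 0 y2 y3 y1 - 29/4 * corner 0 0 y3 y1 y2 + 8 * corner 0 (1/2) y3 y1 y2 - 3/4 * corner 0 2 y3 y1 y2 + 8 * corner 0 (1/2) y2 y3 y1 - 3 * corner 0 2 y2 y3 y1 + 4 * corner 2 (1/2) y2 y3 y1 - 3 * corner 2 2 y2 y3 y1 - 12 * corner (1/2) (1/2) y2 y3 y1 + 6 * corner (1/2) 2 y2 y3 y1 + 29/4 * corner 2 0 y3 y1 y2 - 8 * corner 2 (1/2) y3 y1 y2 + 3/4 * corner 2 2 y3 y1 y2"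
proof -
  have "N [v2, e12, e13, e23, e31, e32] = N [v2, e23, e32, e31, e12, e13]"
    by (rule nspline_mset[of _ v2 e12 e23 e13 e31 e32]) (simp_all add: eval)
  then show ?thesis
    using interior_point.orbit_splines_2[OF permuted(1)] by (simp add: relabel corner_swap algebra_simps)
qed

lemma spline_25: "N [v2, e12, e13, e21, e31, e32] = - 29/4 * corner 0 0 y1 y2 y3 + 29/4 * corner 0 2 y1 y2 y3 - 3/4 * corner 2 0 y1 y2 y3 + 8 * corner (1/2) 0 y1 y2 y3 + 3/4 * corner 2 2 y1 y2 y3 - 8 * corner (1/2) 2 y1 y2 y3 + 30 * (y1 * y2 * y3) - 5 * corner 0 0 y2 y3 y1 - 3 * corner 2 0 y2 y3 y1 + 8 * corner (1/2) 0 y2 y3 y1 - 23 * corner 0 0 y3 y1 y2 + 24 * corner 0 (1/2) y3 y1 y2 - corner 0 2 y3 y1 y2 + 6 * corner 0 (1/2) y2 y3 y1 - corner 0 2 y2 y3 y1 + 6 * corner 2 (1/2) y2 y3 y1 - 3 * corner 2 2 y2 y3 y1 - 12 * corner (1/2) (1/2) y2 y3 y1 + 4 * corner (1/2) 2 y2 y3 y1 + 23 * corner (1/2) 0 y3 y1 y2 - 24 * corner (1/2) (1/2) y3 y1 y2 + corner (1/2) 2 y3 y1 y2"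
proof -
  have "N [v2, e12, e13, e21, e31, e32] = N [v2, e21, e12, e13, e32, e31]"
    by (rule nspline_mset[of _ v2 e12 e21 e13 e31 e32]) (simp_all add: eval)
  then show ?thesis
    using interior_point.orbit_splines_2[OF permuted(3)] by (simp add: relabel corner_swap algebra_simps)
qed

lemma orbit_splines_3:
  shows "N [e12, e13, e21, e23, e31, e32] = 35/2 * corner 0 0 y1 y2 y3 + 5/2 * corner 0 2 y1 y2 y3 - 20 * corner 0 (1/2) y1 y2 y3 + 5/2 * corner 2 0 y1 y2 y3 - 20 * corner (1/2) 0 y1 y2 y3 + 3/2 * corner 2 2 y1 y2 y3 - 4 * corner (1/2) 2 y1 y2 y3 - 4 * corner 2 (1/2) y1 y2 y3 + 24 * corner (1/2) (1/2) y1 y2 y3 - 24 * (y1 * y2 * y3) + 35/2 * corner 0 0 y2 y3 y1 + 5/2 * corner 2 0 y2 y3 y1 - 20 * corner (1/2) 0 y2 y3 y1 + 35/2 * corner 0 0 y3 y1 y2 - 20 * corner 0 (1/2) y3 y1 y2 + 5/2 * corner 0 2 y3 y1 y2 - 20 * corner 0 (1/2) y2 y3 y1 + 5/2 * corner 0 2 y2 y3 y1 - 4 * corner 2 (1/2) y2 y3 y1 + 3/2 * corner 2 2 y2 y3 y1 + 24 * corner (1/2) (1/2) y2 y3 y1 - 4 * corner (1/2) 2 y2 y3 y1 - 20 * corner (1/2) 0 y3 y1 y2 + 5/2 * corner 2 0 y3 y1 y2 + 24 * corner (1/2) (1/2) y3 y1 y2 - 4 * corner 2 (1/2) y3 y1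 y2 - 4 * corner (1/2) 2 y3 y1 y2 + 3/2 * corner 2 2 y3 y1 y2"
  using insertions_1 insertions_2 insertions_3 insertions_4 insertions_5 corner_splines box_spline orbit_splines_1 orbit_splines_2 spline_15 spline_20 spline_24 spline_25 by linarith

end

definition ws_triples :: "(real \<times> real \<times> real) list list" where
  "ws_triples = [
  [v1, v1, v1, v1, e31, e21],
  [v2, v2, v2, v2, e32, e12],
  [v3, v3, v3, v3, e13, e23],
  [v1, v1, v1, e31, e32, e21],
  [v1, v1, v1, e21, e23, e31],
  [v2, v2, v2, e12, e13, e32],
  [v2, v2, v2, e32, e31, e12],
  [v3, v3, v3, e23, e21, e13],
  [v3, v3, v3, e13, e12, e23],
  [v1, v1, e31, e32, v2, e21],
  [v1, v1, e21, e23, v3, e31],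
  [v2, v2, e12, e13, v3, e32],
  [v2, v2, e32, e31, v1, e12],
  [v3, v3, e23, e21, v1, e13],
  [v3, v3, e13, e12, v2, e23],
  [v1, v1, e31, e32, e21, e23],
  [v2, v2, e32, e31, e12, e13],
  [v3, v3, e13, e12, e23, e21],
  [v1, v2, e31, e32, e21, e12],
  [v2, v3, e12, e13, e32, e23],
  [v3, v1, e23, e21, e13, e31],
  [v1, e31, e32, e12, e23, e21],
  [v1, e21, e23, e13, e32, e31],
  [v2, e12, e13, e23, e31, e32],
  [v2, e31, e32, e12, e13, e21],
  [v3, e23, e21, e31, e12, e13],
  [v3, e12, e13, e23, e21, e32],
  [e31, e32, e12, e13, e23, e21]]"

text \<open>Twelve times the coefficients of the basis functions with respect to the elementary functions.\<close>

definition ws_matrix :: "int list list" where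
  "ws_matrix = [
  [12,0,0,0,0,0,0,0,0,0,0,0,0,0,0,0,0,0,0,0,0,0,0,0,0,0,0,0],
  [0,0,0,0,0,0,0,0,0,12,0,0,0,0,0,0,0,0,0,0,0,0,0,0,0,0,0,0],
  [0,0,0,0,0,0,0,0,0,0,0,0,0,0,0,0,0,0,12,0,0,0,0,0,0,0,0,0],
  [-24,0,0,24,0,0,0,0,0,0,0,0,0,0,0,0,0,0,0,0,0,0,0,0,0,0,0,0],
  [-24,24,0,0,0,0,0,0,0,0,0,0,0,0,0,0,0,0,0,0,0,0,0,0,0,0,0,0],
  [0,0,0,0,0,0,0,0,0,-24,0,0,24,0,0,0,0,0,0,0,0,0,0,0,0,0,0,0],
  [0,0,0,0,0,0,0,0,0,-24,24,0,0,0,0,0,0,0,0,0,0,0,0,0,0,0,0,0],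
  [0,0,0,0,0,0,0,0,0,0,0,0,0,0,0,0,0,0,-24,0,0,24,0,0,0,0,0,0],
  [0,0,0,0,0,0,0,0,0,0,0,0,0,0,0,0,0,0,-24,24,0,0,0,0,0,0,0,0],
  [18,0,0,-72,0,0,54,0,0,0,0,0,0,0,0,0,0,0,0,0,0,0,0,0,0,0,0,0],
  [18,-72,54,0,0,0,0,0,0,0,0,0,0,0,0,0,0,0,0,0,0,0,0,0,0,0,0,0],
  [0,0,0,0,0,0,0,0,0,18,0,0,-72,0,0,54,0,0,0,0,0,0,0,0,0,0,0,0],
  [0,0,0,0,0,0,0,0,0,18,-72,54,0,0,0,0,0,0,0,0,0,0,0,0,0,0,0,0],
  [0,0,0,0,0,0,0,0,0,0,0,0,0,0,0,0,0,0,18,0,0,-72,0,0,54,0,0,0],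
  [0,0,0,0,0,0,0,0,0,0,0,0,0,0,0,0,0,0,18,-72,54,0,0,0,0,0,0,0],
  [48,-48,0,-48,48,0,0,0,0,0,0,0,0,0,0,0,0,0,0,0,0,0,0,0,0,0,0,0],
  [0,0,0,0,0,0,0,0,0,48,-48,0,-48,48,0,0,0,0,0,0,0,0,0,0,0,0,0,0],
  [0,0,0,0,0,0,0,0,0,0,0,0,0,0,0,0,0,0,48,-48,0,-48,48,0,0,0,0,0],
  [-15,0,15,120,0,-120,-105,0,105,-15,120,-105,0,0,0,15,-120,105,0,0,0,0,240,-240,0,-240,240,-360],
  [0,0,0,0,240,-240,0,-240,240,-15,0,15,120,0,-120,-105,0,105,-15,120,-105,0,0,0,15,-120,105,-360],
  [-15,120,-105,0,0,0,15,-120,105,0,0,0,0,240,-240,0,-240,240,-15,0,15,120,0,-120,-105,0,105,-360],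
  [-24,32,-8,48,-96,48,-24,64,-40,6,-64,58,0,0,0,-6,64,-58,0,8,-8,0,-192,192,0,184,-184,240],
  [-24,48,-24,32,-96,64,-8,48,-40,0,0,0,8,-192,184,-8,192,-184,6,0,-6,-64,0,64,58,0,-58,240],
  [0,8,-8,0,-192,192,0,184,-184,-24,32,-8,48,-96,48,-24,64,-40,6,-64,58,0,0,0,-6,64,-58,240],
  [6,0,-6,-64,0,64,58,0,-58,-24,48,-24,32,-96,64,-8,48,-40,0,0,0,8,-192,184,-8,192,-184,240],
  [6,-64,58,0,0,0,-6,64,-58,0,8,-8,0,-192,192,0,184,-184,-24,32,-8,48,-96,48,-24,64,-40,240],
  [0,0,0,8,-192,184,-8,192,-184,6,0,-6,-64,0,64,58,0,-58,-24,48,-24,32,-96,64,-8,48,-40,240],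
  [18,-48,30,-48,288,-240,30,-240,210,18,-48,30,-48,288,-240,30,-240,210,18,-48,30,-48,288,-240,30,-240,210,-288]]"

definition corners :: "real \<Rightarrow> real \<Rightarrow> real \<Rightarrow> real list" where
  "corners u v w = [corner 2 2 u v w, corner 2 (1/2) u v w, corner 2 0 u v w, corner (1/2) 2 u v w, corner (1/2) (1/2) u v w, corner (1/2) 0 u v w, corner 0 2 u v w, corner 0 (1/2) u v w, corner 0 0 u v w]"

text \<open>This order fixes the columns of \<open>ws_matrix\<close>: nine corners for each vertex,
  then the product in column 27.\<close>

definition elementary :: "real \<Rightarrow> real \<Rightarrow> real \<Rightarrow> real list" where
  "elementary y1 y2 y3 = corners y1 y2 y3 @ corners y2 y3 y1 @ corners y3 y1 y2 @ [y1 * y2 * y3]"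

definition combination :: "int list \<Rightarrow> real list \<Rightarrow> real" where
  "combination r es = sum_list (map2 (\<lambda>m e. real_of_int m * e) r es)"

context interior_point begin

abbreviation comb :: "int list \<Rightarrow> real" where
  "comb r \<equiv> combination r (elementary y1 y2 y3) / 12"

lemmas ws_value_simps = combination_def elementary_def corners_def eval relabel corner_swap ws_matrix_def algebra_simps

text \<open>In the 28 evaluations the knots are rearranged into the order in which an already
  evaluated spline, or its image under renaming the vertices, is listed.\<close>

lemma ws_value_1: "1/6 * N [v1, v1, v1, v1, e31, e21] = comb (ws_matrix!0)"
  using nspline_mset[of "[v1, v1, v1, v1, e31, e21]" v1 e31 e21 v1 v1 v1 "[v1, v1, v1, v1, e21, e31]"] corner_splines
  by (simp add: ws_value_simps)

lemma ws_value_2: "1/6 * N [v2, v2, v2, v2, e32, e12] = comb (ws_matrix!1)"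
  using nspline_mset[of "[v2, v2, v2, v2, e32, e12]" v2 e32 e12 v2 v2 v2 "[v2, v2, v2, v2, e12, e32]"] corner_splines
  by (simp add: ws_value_simps)

lemma ws_value_3: "1/6 * N [v3, v3, v3, v3, e13, e23] = comb (ws_matrix!2)"
  using nspline_mset[of "[v3, v3, v3, v3, e13, e23]" v3 e13 e23 v3 v3 v3 "[v3, v3, v3, v3, e13, e23]"] corner_splines
  by (simp add: ws_value_simps)

lemma ws_value_4: "1/3 * N [v1, v1, v1, e31, e32, e21] = comb (ws_matrix!3)"
  using nspline_mset[of "[v1, v1, v1, e31, e32, e21]" v1 e31 e21 v1 v1 e32 "[v1, v1, v1, e21, e31, e32]"] orbit_splines_1(1)
  by (simp add: ws_value_simps)

lemma ws_value_5: "1/3 * N [v1, v1, v1, e21, e23, e31] = comb (ws_matrix!4)"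
  using nspline_mset[of "[v1, v1, v1, e21, e23, e31]" v1 e21 e31 v1 v1 e23 "[v1, v1, v1, e31, e21, e23]"] interior_point.orbit_splines_1(1)[OF permuted(4)]
  by (simp add: ws_value_simps)

lemma ws_value_6: "1/3 * N [v2, v2, v2, e12, e13, e32] = comb (ws_matrix!5)"
  using nspline_mset[of "[v2, v2, v2, e12, e13, e32]" v2 e12 e32 v2 v2 e13 "[v2, v2, v2, e32, e12, e13]"] interior_point.orbit_splines_1(1)[OF permuted(1)]
  by (simp add: ws_value_simps)

lemma ws_value_7: "1/3 * N [v2, v2, v2, e32, e31, e12] = comb (ws_matrix!6)"
  using nspline_mset[of "[v2, v2, v2, e32, e31, e12]" v2 e32 e12 v2 v2 e31 "[v2, v2, v2, e12, e32, e31]"] interior_point.orbit_splines_1(1)[OF permuted(3)]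
  by (simp add: ws_value_simps)

lemma ws_value_8: "1/3 * N [v3, v3, v3, e23, e21, e13] = comb (ws_matrix!7)"
  using nspline_mset[of "[v3, v3, v3, e23, e21, e13]" v3 e23 e13 v3 v3 e21 "[v3, v3, v3, e13, e23, e21]"] interior_point.orbit_splines_1(1)[OF permuted(2)]
  by (simp add: ws_value_simps)

lemma ws_value_9: "1/3 * N [v3, v3, v3, e13, e12, e23] = comb (ws_matrix!8)"
  using nspline_mset[of "[v3, v3, v3, e13, e12, e23]" v3 e13 e23 v3 v3 e12 "[v3, v3, v3, e23, e13, e12]"] interior_point.orbit_splines_1(1)[OF permuted(5)]
  by (simp add: ws_value_simps)

lemma ws_value_10: "1/2 * N [v1, v1, e31, e32, v2, e21] = comb (ws_matrix!9)"
  using nspline_mset[of "[v1, v1, e31, e32, v2, e21]" v1 e31 e21 v1 e32 v2 "[v1, v1, v2, e21, e31, e32]"] orbit_splines_1(2)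
  by (simp add: ws_value_simps)

lemma ws_value_11: "1/2 * N [v1, v1, e21, e23, v3, e31] = comb (ws_matrix!10)"
  using nspline_mset[of "[v1, v1, e21, e23, v3, e31]" v1 e21 e31 v1 e23 v3 "[v1, v1, v3, e31, e21, e23]"] interior_point.orbit_splines_1(2)[OF permuted(4)]
  by (simp add: ws_value_simps)

lemma ws_value_12: "1/2 * N [v2, v2, e12, e13, v3, e32] = comb (ws_matrix!11)"
  using nspline_mset[of "[v2, v2, e12, e13, v3, e32]" v2 e12 e32 v2 e13 v3 "[v2, v2, v3, e32, e12, e13]"] interior_point.orbit_splines_1(2)[OF permuted(1)]
  by (simp add: ws_value_simps)

lemma ws_value_13: "1/2 * N [v2, v2, e32, e31, v1, e12] = comb (ws_matrix!12)"
  using nspline_mset[of "[v2, v2, e32, e31, v1, e12]" v2 e32 e12 v2 e31 v1 "[v2, v2, v1, e12, e32, e31]"] interior_point.orbit_splines_1(2)[OF permuted(3)]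
  by (simp add: ws_value_simps)

lemma ws_value_14: "1/2 * N [v3, v3, e23, e21, v1, e13] = comb (ws_matrix!13)"
  using nspline_mset[of "[v3, v3, e23, e21, v1, e13]" v3 e23 e13 v3 e21 v1 "[v3, v3, v1, e13, e23, e21]"] interior_point.orbit_splines_1(2)[OF permuted(2)]
  by (simp add: ws_value_simps)

lemma ws_value_15: "1/2 * N [v3, v3, e13, e12, v2, e23] = comb (ws_matrix!14)"
  using nspline_mset[of "[v3, v3, e13, e12, v2, e23]" v3 e13 e23 v3 e12 v2 "[v3, v3, v2, e23, e13, e12]"] interior_point.orbit_splines_1(2)[OF permuted(5)]
  by (simp add: ws_value_simps)

lemma ws_value_16: "2/3 * N [v1, v1, e31, e32, e21, e23] = comb (ws_matrix!15)"
  using nspline_mset[of "[v1, v1, e31, e32, e21, e23]" v1 e31 e21 v1 e32 e23 "[v1, v1, e21, e23, e31, e32]"] orbit_splines_1(3)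
  by (simp add: ws_value_simps)

lemma ws_value_17: "2/3 * N [v2, v2, e32, e31, e12, e13] = comb (ws_matrix!16)"
  using nspline_mset[of "[v2, v2, e32, e31, e12, e13]" v2 e32 e12 v2 e31 e13 "[v2, v2, e32, e31, e12, e13]"] interior_point.orbit_splines_1(3)[OF permuted(1)]
  by (simp add: ws_value_simps)

lemma ws_value_18: "2/3 * N [v3, v3, e13, e12, e23, e21] = comb (ws_matrix!17)"
  using nspline_mset[of "[v3, v3, e13, e12, e23, e21]" v3 e13 e23 v3 e12 e21 "[v3, v3, e13, e12, e23, e21]"] interior_point.orbit_splines_1(3)[OF permuted(2)]
  by (simp add: ws_value_simps)

lemma ws_value_19: "5/6 * N [v1, v2, e31, e32, e21, e12] = comb (ws_matrix!18)"
  using nspline_mset[of "[v1, v2, e31, e32, e21, e12]" v1 v2 e21 e31 e32 e12 "[v1, v2, e12, e21, e31, e32]"] orbit_splines_1(4)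
  by (simp add: ws_value_simps)

lemma ws_value_20: "5/6 * N [v2, v3, e12, e13, e32, e23] = comb (ws_matrix!19)"
  using nspline_mset[of "[v2, v3, e12, e13, e32, e23]" v2 v3 e32 e12 e13 e23 "[v2, v3, e23, e32, e12, e13]"] interior_point.orbit_splines_1(4)[OF permuted(1)]
  by (simp add: ws_value_simps)

lemma ws_value_21: "5/6 * N [v3, v1, e23, e21, e13, e31] = comb (ws_matrix!20)"
  using nspline_mset[of "[v3, v1, e23, e21, e13, e31]" v3 v1 e13 e23 e21 e31 "[v3, v1, e31, e13, e23, e21]"] interior_point.orbit_splines_1(4)[OF permuted(2)]
  by (simp add: ws_value_simps)

lemma ws_value_22: "2/3 * N [v1, e31, e32, e12, e23, e21] = comb (ws_matrix!21)"
  using nspline_mset[of "[v1, e31, e32, e12, e23, e21]" v1 e31 e12 e32 e23 e21 "[v1, e12, e21, e23, e31, e32]"] orbit_splines_2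
  by (simp add: ws_value_simps)

lemma ws_value_23: "2/3 * N [v1, e21, e23, e13, e32, e31] = comb (ws_matrix!22)"
  using nspline_mset[of "[v1, e21, e23, e13, e32, e31]" v1 e21 e13 e23 e32 e31 "[v1, e13, e31, e32, e21, e23]"] interior_point.orbit_splines_2[OF permuted(4)]
  by (simp add: ws_value_simps)

lemma ws_value_24: "2/3 * N [v2, e12, e13, e23, e31, e32] = comb (ws_matrix!23)"
  using nspline_mset[of "[v2, e12, e13, e23, e31, e32]" v2 e12 e23 e13 e31 e32 "[v2, e23, e32, e31, e12, e13]"] interior_point.orbit_splines_2[OF permuted(1)]
  by (simp add: ws_value_simps)

lemma ws_value_25: "2/3 * N [v2, e31, e32, e12, e13, e21] = comb (ws_matrix!24)"
  using nspline_mset[of "[v2, e31, e32, e12, e13, e21]" v2 e31 e12 e32 e13 e21 "[v2, e21, e12, e13, e32, e31]"] interior_point.orbit_splines_2[OF permuted(3)]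
  by (simp add: ws_value_simps)

lemma ws_value_26: "2/3 * N [v3, e23, e21, e31, e12, e13] = comb (ws_matrix!25)"
  using nspline_mset[of "[v3, e23, e21, e31, e12, e13]" v3 e23 e31 e21 e12 e13 "[v3, e31, e13, e12, e23, e21]"] interior_point.orbit_splines_2[OF permuted(2)]
  by (simp add: ws_value_simps)

lemma ws_value_27: "2/3 * N [v3, e12, e13, e23, e21, e32] = comb (ws_matrix!26)"
  using nspline_mset[of "[v3, e12, e13, e23, e21, e32]" v3 e12 e23 e13 e21 e32 "[v3, e32, e23, e21, e13, e12]"] interior_point.orbit_splines_2[OF permuted(5)]
  by (simp add: ws_value_simps)

lemma ws_value_28: "1 * N [e31, e32, e12, e13, e23, e21] = comb (ws_matrix!27)"
  using nspline_mset[of "[e31, e32, e12, e13, e23, e21]" e31 e32 e12 e13 e23 e21 "[e12, e13, e21, e23, e31, e32]"] orbit_splines_3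
  by (simp add: ws_value_simps)

end

section \<open>Coefficient matrices and the partition lines\<close>

text \<open>1620 times the inverse of the coefficient matrix.\<close>

definition ws_inverse :: "int list list" where
  "ws_inverse = [
  [1620,0,0,0,0,0,0,0,0,0,0,0,0,0,0,0,0,0,0,0,0,0,0,0,0,0,0,0],
  [1620,0,0,0,810,0,0,0,0,0,0,0,0,0,0,0,0,0,0,0,0,0,0,0,0,0,0,0],
  [1620,0,0,0,1080,0,0,0,0,0,360,0,0,0,0,0,0,0,0,0,0,0,0,0,0,0,0,0],
  [1620,0,0,810,0,0,0,0,0,0,0,0,0,0,0,0,0,0,0,0,0,0,0,0,0,0,0,0],
  [1620,0,0,810,810,0,0,0,0,0,0,0,0,0,0,405,0,0,0,0,0,0,0,0,0,0,0,0],
  [1620,0,0,810,1080,0,0,0,0,0,360,0,0,0,0,540,0,0,0,0,108,0,180,0,0,-60,30,-10],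
  [1620,0,0,1080,0,0,0,0,0,360,0,0,0,0,0,0,0,0,0,0,0,0,0,0,0,0,0,0],
  [1620,0,0,1080,810,0,0,0,0,360,0,0,0,0,0,540,0,0,108,0,0,180,0,30,-60,0,0,-10],
  [1620,0,0,1080,1080,0,0,0,0,360,360,0,0,0,0,720,0,0,144,0,144,240,240,0,0,0,0,40],
  [0,1620,0,0,0,0,0,0,0,0,0,0,0,0,0,0,0,0,0,0,0,0,0,0,0,0,0,0],
  [0,1620,0,0,0,0,810,0,0,0,0,0,0,0,0,0,0,0,0,0,0,0,0,0,0,0,0,0],
  [0,1620,0,0,0,0,1080,0,0,0,0,0,360,0,0,0,0,0,0,0,0,0,0,0,0,0,0,0],
  [0,1620,0,0,0,810,0,0,0,0,0,0,0,0,0,0,0,0,0,0,0,0,0,0,0,0,0,0],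
  [0,1620,0,0,0,810,810,0,0,0,0,0,0,0,0,0,405,0,0,0,0,0,0,0,0,0,0,0],
  [0,1620,0,0,0,810,1080,0,0,0,0,0,360,0,0,0,540,0,108,0,0,-60,30,0,180,0,0,-10],
  [0,1620,0,0,0,1080,0,0,0,0,0,360,0,0,0,0,0,0,0,0,0,0,0,0,0,0,0,0],
  [0,1620,0,0,0,1080,810,0,0,0,0,360,0,0,0,0,540,0,0,108,0,0,0,180,0,30,-60,-10],
  [0,1620,0,0,0,1080,1080,0,0,0,0,360,360,0,0,0,720,0,144,144,0,0,0,240,240,0,0,40],
  [0,0,1620,0,0,0,0,0,0,0,0,0,0,0,0,0,0,0,0,0,0,0,0,0,0,0,0,0],
  [0,0,1620,0,0,0,0,0,810,0,0,0,0,0,0,0,0,0,0,0,0,0,0,0,0,0,0,0],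
  [0,0,1620,0,0,0,0,0,1080,0,0,0,0,0,360,0,0,0,0,0,0,0,0,0,0,0,0,0],
  [0,0,1620,0,0,0,0,810,0,0,0,0,0,0,0,0,0,0,0,0,0,0,0,0,0,0,0,0],
  [0,0,1620,0,0,0,0,810,810,0,0,0,0,0,0,0,0,405,0,0,0,0,0,0,0,0,0,0],
  [0,0,1620,0,0,0,0,810,1080,0,0,0,0,0,360,0,0,540,0,108,0,0,0,-60,30,0,180,-10],
  [0,0,1620,0,0,0,0,1080,0,0,0,0,0,360,0,0,0,0,0,0,0,0,0,0,0,0,0,0],
  [0,0,1620,0,0,0,0,1080,810,0,0,0,0,360,0,0,0,540,0,0,108,30,-60,0,0,180,0,-10],
  [0,0,1620,0,0,0,0,1080,1080,0,0,0,0,360,360,0,0,720,0,144,144,0,0,0,0,240,240,40],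
  [0,0,0,0,0,0,0,0,0,0,0,0,0,0,0,30,30,30,30,30,30,50,50,50,50,50,50,70]]"

text \<open>A triple $(a, b, c)$ stands for the chord $a y_1 + b y_2 + c y_3 = 0$ in barycentric coordinates.\<close>

definition ws_lines :: "(int \<times> int \<times> int) list" where
  "ws_lines = [
    (2, -4, -4), (2, -4, -1), (2, -4, 0), (2, -1, -4), (2, -1, -1), (2, 0, -4),
    (-4, 2, -4), (-1, 2, -4), (0, 2, -4), (-4, 2, -1), (-1, 2, -1), (-4, 2, 0),
    (-4, -4, 2), (-4, -1, 2), (-4, 0, 2), (-1, -4, 2), (-1, -1, 2), (0, -4, 2)]"

text \<open>Applied to two chords it yields homogeneous barycentric coordinates of their
  intersection.\<close>

definition icross :: "int \<times> int \<times> int \<Rightarrow> int \<times> int \<times> int \<Rightarrow> int \<times> int \<times> int" where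
  "icross = (\<lambda>(a, b, c) (a', b', c'). (b * c' - c * b', c * a' - a * c', a * b' - b * a'))"

definition idot :: "int \<times> int \<times> int \<Rightarrow> int \<times> int \<times> int \<Rightarrow> int" where
  "idot = (\<lambda>(a, b, c) (a', b', c'). a * a' + b * b' + c * c')"

text \<open>Homogeneous coordinates of equal strict sign describe the points of the open
  triangle.\<close>

definition one_signed :: "int \<times> int \<times> int \<Rightarrow> bool" where
  "one_signed = (\<lambda>(a, b, c). (0 < a \<and> 0 < b \<and> 0 < c) \<or> (a < 0 \<and> b < 0 \<and> c < 0))"

lemma ws_lines_cross: "\<forall>s\<in>set ws_lines. \<forall>t\<in>set ws_lines. s \<noteq> t \<longrightarrow> icross s t \<noteq> (0, 0, 0)"
  unfolding ws_lines_def by code_simp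

lemma ws_lines_concurrent: "\<forall>s\<in>set ws_lines. \<forall>t\<in>set ws_lines. s \<noteq> t \<longrightarrow> one_signed (icross s t) \<longrightarrow>
    length (filter (\<lambda>u. idot u (icross s t) = 0) ws_lines) \<le> 4"
  unfolding ws_lines_def by code_simp

text \<open>Three times the barycentric coordinates of the nine points.\<close>

definition ws_grid :: "(int \<times> int \<times> int) list" where
  "ws_grid = [(3,0,0), (0,3,0), (0,0,3), (0,2,1), (0,1,2), (2,0,1), (1,0,2), (2,1,0), (1,2,0)]"

lemma ws_grid_lines: "\<forall>p\<in>set ws_grid. \<forall>q\<in>set ws_grid. \<exists>t\<in>set ((1,0,0) # (0,1,0) # (0,0,1) # ws_lines). idot t p = 0 \<and> idot t q = 0"
  unfolding ws_lines_def ws_grid_def by code_simp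

text \<open>The matrix product as an accumulation of scaled rows; the starting row fixes the width
  28.\<close>

definition imul :: "int list list \<Rightarrow> int list list \<Rightarrow> int list list" where
  "imul A B = map (\<lambda>r. foldr (\<lambda>(x, b) acc. map2 (\<lambda>u v. x * u + v) b acc) (zip r B) (replicate 28 0)) A"

text \<open>The diagonal entry is 19440 = 12 * 1620, the product of the two common
  denominators.\<close>

lemma inverse1: "imul ws_inverse ws_matrix = map (\<lambda>i. map (\<lambda>j. if i = j then 19440 else 0) [0..<28]) [0..<28]"
  unfolding ws_matrix_def ws_inverse_def by code_simp

lemma inverse2: "imul ws_matrix ws_inverse = map (\<lambda>i. map (\<lambda>j. if i = j then 19440 else 0) [0..<28]) [0..<28]"
  unfolding ws_matrix_def ws_inverse_def by code_simp

lemma length_foldr_rows: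
  fixes B :: "int list list"
  assumes "length r = length B" "\<forall>b\<in>set B. length b = m"
  shows "length (foldr (\<lambda>(x, b) acc. map2 (\<lambda>u v. x * u + v) b acc) (zip r B) (replicate m 0)) = m \<and>
    (\<forall>j<m. foldr (\<lambda>(x, b) acc. map2 (\<lambda>u v. x * u + v) b acc) (zip r B) (replicate m 0) ! j = (\<Sum>k<length r. r!k * B!k!j))"
  using assms by (induction r B rule: list_induct2) (simp_all add: sum.lessThan_Suc_shift del: sum.lessThan_Suc)

lemma imul_nth:
  assumes "length A = 28" "\<forall>r\<in>set A. length r = 28" "length B = 28" "\<forall>r\<in>set B. length r = 28" "i < 28" "j < 28"
  shows "imul A B ! i ! j = (\<Sum>k<28. A!i!k * B!k!j)"
  using assms length_foldr_rows[of "A!i" B 28] by (simp add: imul_def)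

lemma lengths: "length ws_matrix = 28" "\<forall>r\<in>set ws_matrix. length r = 28" "length ws_inverse = 28" "\<forall>r\<in>set ws_inverse. length r = 28"
  "length ws_triples = 28"
  by (simp_all add: ws_matrix_def ws_inverse_def ws_triples_def)

lemma inverse_product:
  assumes "i < 28" "j < 28"
  shows "(\<Sum>k<28. real_of_int (ws_inverse!i!k) * real_of_int (ws_matrix!k!j)) = (if i = j then 19440 else 0)"
    and "(\<Sum>k<28. real_of_int (ws_matrix!i!k) * real_of_int (ws_inverse!k!j)) = (if i = j then 19440 else 0)"
proof -
  have "(\<Sum>k<28. ws_inverse!i!k * ws_matrix!k!j) = (if i = j then 19440 else 0)"
    using imul_nth[OF lengths(3,4,1,2) assms] unfolding inverse1 using assms by simp
  from arg_cong[OF this, of real_of_int]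
  show "(\<Sum>k<28. real_of_int (ws_inverse!i!k) * real_of_int (ws_matrix!k!j)) = (if i = j then 19440 else 0)" by simp
  have "(\<Sum>k<28. ws_matrix!i!k * ws_inverse!k!j) = (if i = j then 19440 else 0)"
    using imul_nth[OF lengths(1,2,3,4) assms] unfolding inverse2 using assms by simp
  from arg_cong[OF this, of real_of_int]
  show "(\<Sum>k<28. real_of_int (ws_matrix!i!k) * real_of_int (ws_inverse!k!j)) = (if i = j then 19440 else 0)" by simp
qed

lemma combination_sum:
  assumes "length r = n" "length es = n"
  shows "combination r es = (\<Sum>k<n. real_of_int (r!k) * es!k)"
  using assms by (simp add: combination_def sum_list_sum_nth atLeast0LessThan)

lemma length_elementary: "length (elementary a b c) = 28"
  by (simp add: elementary_def corners_def)

context interior_point begin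

lemma ws_values:
  "map (\<lambda>(a, ks). a * N ks) (zip (map (\<lambda>i. ws_c (Suc i)) [0..<28]) ws_triples) = map comb ws_matrix"
  using ws_value_1 ws_value_2 ws_value_3 ws_value_4 ws_value_5 ws_value_6 ws_value_7 ws_value_8 ws_value_9 ws_value_10 ws_value_11 ws_value_12 ws_value_13 ws_value_14 ws_value_15 ws_value_16 ws_value_17 ws_value_18 ws_value_19 ws_value_20 ws_value_21 ws_value_22 ws_value_23 ws_value_24 ws_value_25 ws_value_26 ws_value_27 ws_value_28
  by (simp add: ws_triples_def ws_matrix_def ws_c_def upt_rec)

lemma ws_value:
  assumes "i < 28"
  shows "ws_c (Suc i) * N (ws_triples!i) = (\<Sum>k<28. real_of_int (ws_matrix!i!k) * elementary y1 y2 y3 ! k) / 12"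
proof -
  have "ws_c (Suc i) * N (ws_triples!i) = comb (ws_matrix!i)"
    using arg_cong[OF ws_values, of "\<lambda>xs. xs!i"] assms by (simp add: lengths)
  also have "\<dots> = (\<Sum>k<28. real_of_int (ws_matrix!i!k) * elementary y1 y2 y3 ! k) / 12"
    using assms lengths by (subst combination_sum[of _ 28]) (simp_all add: length_elementary)
  finally show ?thesis .
qed

end

lemma ws_knots_eq:
  assumes "i < 28" shows "ws_knots p1 p2 p3 (Suc i) = map (pt_of p1 p2 p3) (ws_triples!i)"
proof -
  have "ws_knots p1 p2 p3 (Suc i) = map (map (pt_of p1 p2 p3)) ws_triples ! i"
    by (simp add: ws_knots_def Let_def ws_triples_def pt_of_def p12_def p13_def p21_def p23_def p31_def p32_def)
  then show ?thesis using assms by (simp add: lengths)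
qed

lemma simplex_spline_nonneg: "0 \<le> simplex_spline xs x"
  by (simp add: simplex_spline_def Let_def)

lemma all_less_28: "(\<forall>k<28. P k) \<longleftrightarrow> list_all P [0,1,2,3,4,5,6,7,8,9,10,11,12,13,14,15,16,17,18,19,20,21,22,23,24,25,26,27::nat]"
  by (simp add: numeral_eq_Suc All_less_Suc) blast

text \<open>The triples are positive homogeneous coordinates. Every chord needs a point of the open
  triangle at which its coefficient can be read off.\<close>

lemma ws_lines_interior: "\<forall>t\<in>set ws_lines. \<exists>y\<in>set [(8,2,2), (5,2,2), (4,2,2), (2,2,2), (2,8,2), (2,5,2), (2,4,2), (2,2,8), (2,2,5), (2,2,4)]. idot t y = 0"
  unfolding ws_lines_def by code_simp

lemma distinct_ws_lines: "distinct ws_lines"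
  unfolding ws_lines_def by code_simp

text \<open>The weights \<open>(1 + r) * v\<close> and \<open>(1 + s) * w\<close> of the two end
  points sum to \<open>u + v + w = 1\<close>.\<close>

lemma closed_segment_between_sides:
  fixes a0 a1 a2 :: "'a::real_vector"
  assumes "0 \<le> r" "0 \<le> s" "0 \<le> v" "0 \<le> w" "u + v + w = 1" "u = r * v + s * w"
  shows "u *\<^sub>R a0 + v *\<^sub>R a1 + w *\<^sub>R a2 \<in>
    closed_segment ((r / (1 + r)) *\<^sub>R a0 + (1 / (1 + r)) *\<^sub>R a1) ((s / (1 + s)) *\<^sub>R a0 + (1 / (1 + s)) *\<^sub>R a2)"
proof -
  have m: "1 - (1 + s) * w = (1 + r) * v" using assms by (simp add: algebra_simps)
  have "0 \<le> (1 + r) * v" "0 \<le> (1 + s) * w" using assms by simp_all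
  then have t: "0 \<le> (1 + s) * w" "(1 + s) * w \<le> 1" using m by simp_all
  have k: "(1 + r) * v * (r / (1 + r)) = r * v" "(1 + r) * v * (1 / (1 + r)) = v"
    "(1 + s) * w * (s / (1 + s)) = s * w" "(1 + s) * w * (1 / (1 + s)) = w" using assms by simp_all
  have "u *\<^sub>R a0 + v *\<^sub>R a1 + w *\<^sub>R a2 = (1 - (1 + s) * w) *\<^sub>R ((r / (1 + r)) *\<^sub>R a0 + (1 / (1 + r)) *\<^sub>R a1)
      + ((1 + s) * w) *\<^sub>R ((s / (1 + s)) *\<^sub>R a0 + (1 / (1 + s)) *\<^sub>R a2)"
    unfolding m scaleR_add_right scaleR_scaleR k assms(6) by (simp add: scaleR_add_left)
  then show ?thesis using t unfolding closed_segment_def by blast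
qed

text \<open>The vector of the \<open>y\<close> is orthogonal to both coefficient vectors, so their
  cross product is a multiple of it; since the \<open>y\<close> sum to 1, the factor is the sum of
  the components.\<close>

lemma cross_proportional:
  fixes s1 s2 s3 t1 t2 t3 y1 y2 y3 :: real
  assumes "s1 * y1 + s2 * y2 + s3 * y3 = 0" "t1 * y1 + t2 * y2 + t3 * y3 = 0" "y1 + y2 + y3 = 1"
  defines "w \<equiv> (s2 * t3 - s3 * t2) + (s3 * t1 - s1 * t3) + (s1 * t2 - s2 * t1)"
  shows "s2 * t3 - s3 * t2 = y1 * w" "s3 * t1 - s1 * t3 = y2 * w" "s1 * t2 - s2 * t1 = y3 * w"
  using assms(1-3) unfolding w_def by algebra+

lemma sum_28: "(\<Sum>k<28. f k) = f 0 + f 1 + f 2 + f 3 + f 4 + f 5 + f 6 + f 7 + f 8 + f 9 + f 10 + f 11 + f 12 + f 13 + f 14 + f 15 + f 16 + f 17 + f 18 + f 19 + f 20 + f 21 + f 22 + f 23 + f 24 + f 25 + f 26 + f 27" for f :: "nat \<Rightarrow> real"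
  by (simp add: numeral_eq_Suc)

lemma sum_list_mult_map: "sum_list (map (\<lambda>t. a t * g t) xs) = sum_list (map2 (*) (map a xs) (map g xs))" for a g :: "'b \<Rightarrow> real"
  by (induction xs) simp_all

text \<open>Truncated cubes of opposite orientation differ by a cube, which reduces the corners to the 18 chords
  and the cubic polynomial \<open>cubic_part\<close> below.\<close>

definition tpow_coefficients :: "(nat \<Rightarrow> real) \<Rightarrow> real list" where
  "tpow_coefficients e = [e 0, e 1, e 2 + e 16 / 8, e 3, e 4, e 6 + e 23 / 8, e 9, e 10, e 11 + e 25 / 8, e 12, e 13, e 15 + e 5 / 8, e 18, e 19, e 20 + e 7 / 8, e 21, e 22, e 24 + e 14 / 8]"

definition tpow_coefficient :: "(nat \<Rightarrow> real) \<Rightarrow> int \<times> int \<times> int \<Rightarrow> real" where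
  "tpow_coefficient e t = the (map_of (zip ws_lines (tpow_coefficients e)) t)"

lemma map_tpow_coefficient: "map (tpow_coefficient e) ws_lines = tpow_coefficients e"
  by (simp add: tpow_coefficient_def tpow_coefficients_def ws_lines_def)

definition cubic_part :: "(nat \<Rightarrow> real) \<Rightarrow> real \<Rightarrow> real \<Rightarrow> real \<Rightarrow> real" where
  "cubic_part e y1 y2 y3 = e 8 * y1 ^ 3 + e 17 * y2 ^ 3 + e 26 * y3 ^ 3 + e 27 * (y1 * y2 * y3)
     - (e 5 * (y2 - 2 * y1) ^ 3 + e 7 * (y3 - 2 * y1) ^ 3 + e 14 * (y3 - 2 * y2) ^ 3
      + e 16 * (y1 - 2 * y2) ^ 3 + e 23 * (y1 - 2 * y3) ^ 3 + e 25 * (y2 - 2 * y3) ^ 3) / 8"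

lemma column_sums:
  assumes "k < 28"
  shows "(\<Sum>i<28. real_of_int (ws_matrix!i!k)) =
    [0, 0, 6, 0, 0, -48, 6, -48, 96, 0, 0, 6, 0, 0, -48, 6, -48, 96, 0, 0, 6, 0, 0, -48, 6, -48, 96, 72] ! k"
proof -
  let ?s = "[0, 0, 6, 0, 0, -48, 6, -48, 96, 0, 0, 6, 0, 0, -48, 6, -48, 96, 0, 0, 6, 0, 0, -48, 6, -48, 96, 72] :: int list"
  \<comment> \<open>Multiplication by the all-ones matrix turns the column sums into one
    evaluation.\<close>
  have p: "imul (replicate 28 (replicate 28 1)) ws_matrix = replicate 28 ?s"
    unfolding ws_matrix_def by code_simp
  have "(\<Sum>i<28. ws_matrix!i!k) = (\<Sum>i<28. replicate 28 (replicate 28 1)!0!i * ws_matrix!i!k)"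
    by (rule sum.cong) simp_all
  also have "\<dots> = imul (replicate 28 (replicate 28 1)) ws_matrix ! 0 ! k"
    using assms lengths by (subst imul_nth) simp_all
  also have "\<dots> = ?s ! k" unfolding p by simp
  finally have "real_of_int (\<Sum>i<28. ws_matrix!i!k) = real_of_int (?s ! k)" by (rule arg_cong)
  also have "\<dots> = map real_of_int ?s ! k" using assms by (subst nth_map) simp_all
  finally show ?thesis by simp
qed

section \<open>The spline space on the triangle\<close>

text \<open>Derivatives are explicit witnesses on the whole plane, which makes closure under sums
  immediate; \<open>C2_open\<close> refers to chosen derivatives instead.\<close>

definition C2_fun :: "(pt \<Rightarrow> real) \<Rightarrow> bool" where
  "C2_fun g \<longleftrightarrow> (\<exists>d dd. (\<forall>x. (g has_derivative (\<lambda>h. \<Sum>k\<in>UNIV. h$k * d k x)) (at x)) \<and>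
     (\<forall>k x. (d k has_derivative (\<lambda>h. \<Sum>l\<in>UNIV. h$l * dd k l x)) (at x)) \<and>
     (\<forall>k l. continuous_on UNIV (dd k l)))"

lemma C2_funI:
  assumes "\<And>x. (g has_derivative (\<lambda>h. \<Sum>k\<in>UNIV. h$k * d k x)) (at x)"
    "\<And>k x. (d k has_derivative (\<lambda>h. \<Sum>l\<in>UNIV. h$l * dd k l x)) (at x)"
    "\<And>k l. continuous_on UNIV (dd k l)"
  shows "C2_fun g"
  using assms unfolding C2_fun_def by blast

lemma partial_eq:
  assumes "\<And>x. (g has_derivative (\<lambda>h. \<Sum>k\<in>UNIV. h$k * d k x)) (at x)"
  shows "partial k g = d k"
proof
  fix x
  have "frechet_derivative g (at x) = (\<lambda>h. \<Sum>k\<in>UNIV. h$k * d k x)"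
    by (rule frechet_derivative_at[symmetric, OF assms])
  then show "partial k g x = d k x"
    unfolding partial_def by (simp add: axis_def if_distrib[of "\<lambda>u. u * _"] cong: if_cong)
qed

lemma C2_fun_imp_C2_open:
  assumes "C2_fun g" shows "C2_open UNIV g"
proof -
  obtain d dd where d: "\<And>x. (g has_derivative (\<lambda>h. \<Sum>k\<in>UNIV. h$k * d k x)) (at x)"
    "\<And>k x. (d k has_derivative (\<lambda>h. \<Sum>l\<in>UNIV. h$l * dd k l x)) (at x)"
    "\<And>k l. continuous_on UNIV (dd k l)" using assms unfolding C2_fun_def by blast
  have p: "partial k g = d k" "partial l (d k) = dd k l" for k l
    by (rule partial_eq[OF d(1)], rule partial_eq[OF d(2)])
  show ?thesis unfolding C2_open_def p using d by (auto intro: differentiableI)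
qed

lemma C2_fun_add:
  assumes "C2_fun f" "C2_fun g" shows "C2_fun (\<lambda>x. f x + g x)"
proof -
  obtain d dd where d: "\<And>x. (f has_derivative (\<lambda>h. \<Sum>k\<in>UNIV. h$k * d k x)) (at x)"
    "\<And>k x. (d k has_derivative (\<lambda>h. \<Sum>l\<in>UNIV. h$l * dd k l x)) (at x)"
    "\<And>k l. continuous_on UNIV (dd k l)" using assms(1) unfolding C2_fun_def by blast
  obtain e ee where e: "\<And>x. (g has_derivative (\<lambda>h. \<Sum>k\<in>UNIV. h$k * e k x)) (at x)"
    "\<And>k x. (e k has_derivative (\<lambda>h. \<Sum>l\<in>UNIV. h$l * ee k l x)) (at x)"
    "\<And>k l. continuous_on UNIV (ee k l)" using assms(2) unfolding C2_fun_def by blast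
  have s: "(\<Sum>k\<in>UNIV. h$k * (a k + b k)) = (\<Sum>k\<in>UNIV. h$k * a k) + (\<Sum>k\<in>UNIV. h$k * b k)" for h :: pt and a b :: "2 \<Rightarrow> real"
    by (simp add: distrib_left sum.distrib)
  show ?thesis
    by (rule C2_funI[where d = "\<lambda>k x. d k x + e k x" and dd = "\<lambda>k l x. dd k l x + ee k l x"])
       (simp_all only: s has_derivative_add d e continuous_on_add)
qed

lemma C2_fun_cmult:
  assumes "C2_fun f" shows "C2_fun (\<lambda>x. a * f x)"
proof -
  obtain d dd where d: "\<And>x. (f has_derivative (\<lambda>h. \<Sum>k\<in>UNIV. h$k * d k x)) (at x)"
    "\<And>k x. (d k has_derivative (\<lambda>h. \<Sum>l\<in>UNIV. h$l * dd k l x)) (at x)"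
    "\<And>k l. continuous_on UNIV (dd k l)" using assms(1) unfolding C2_fun_def by blast
  have s: "(\<Sum>k\<in>UNIV. h$k * (a * b k)) = a * (\<Sum>k\<in>UNIV. h$k * b k)" for h :: pt and b :: "2 \<Rightarrow> real"
    by (simp add: sum_distrib_left mult_ac)
  show ?thesis
    by (rule C2_funI[where d = "\<lambda>k x. a * d k x" and dd = "\<lambda>k l x. a * dd k l x"])
       (simp_all only: s has_derivative_mult_right d continuous_on_mult_left)
qed

lemma C2_fun_sum:
  assumes "\<And>i. i \<in> I \<Longrightarrow> C2_fun (f i)" shows "C2_fun (\<lambda>x. \<Sum>i\<in>I. f i x)"
proof -
  have 0: "C2_fun (\<lambda>x. 0)" by (rule C2_funI[where d = "\<lambda>k x. 0" and dd = "\<lambda>k l x. 0"]) simp_all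
  show ?thesis using assms by (induction I rule: infinite_finite_induct) (simp_all add: 0 C2_fun_add)
qed

lemma C2_fun_affine:
  assumes h: "\<And>t. (h has_real_derivative h1 t) (at t)" "\<And>t. (h1 has_real_derivative h2 t) (at t)" "continuous_on UNIV h2"
  shows "C2_fun (\<lambda>x. h (n \<bullet> x + c))"
proof (rule C2_funI[where d = "\<lambda>k x. n$k * h1 (n \<bullet> x + c)" and dd = "\<lambda>k l x. n$k * (n$l * h2 (n \<bullet> x + c))"])
  have aff: "((\<lambda>x. n \<bullet> x + c) has_derivative (\<lambda>v. n \<bullet> v)) (at x)" for x
    by (auto intro!: derivative_eq_intros)
  have s: "(\<Sum>k\<in>UNIV. v$k * (n$k * b)) = (n \<bullet> v) * b" for v b
    by (simp add: inner_vec_def sum_distrib_left sum_distrib_right mult_ac)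
  show "((\<lambda>x. h (n \<bullet> x + c)) has_derivative (\<lambda>v. \<Sum>k\<in>UNIV. v$k * (n$k * h1 (n \<bullet> x + c)))) (at x)" for x
    unfolding s by (rule DERIV_compose_FDERIV[OF h(1) aff])
  have s2: "(\<Sum>l\<in>UNIV. v$l * (m * (n$l * b))) = m * ((n \<bullet> v) * b)" for v m b
    by (simp add: inner_vec_def sum_distrib_left sum_distrib_right mult_ac)
  show "((\<lambda>x. n$k * h1 (n \<bullet> x + c)) has_derivative (\<lambda>v. \<Sum>l\<in>UNIV. v$l * (n$k * (n$l * h2 (n \<bullet> x + c))))) (at x)" for k x
    unfolding s2 by (rule has_derivative_mult_right, rule DERIV_compose_FDERIV[OF h(2) aff])
  show "continuous_on UNIV (\<lambda>x. n$k * (n$l * h2 (n \<bullet> x + c)))" for k l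
    by (intro continuous_intros continuous_on_compose2[OF h(3)]) auto
qed

text \<open>Writing the truncated cube as \<open>(t^3 + t * (t * abs t)) / 2\<close> reduces its
  smoothness to this function, whose only delicate point is 0.\<close>

lemma DERIV_mult_abs: "((\<lambda>t. t * \<bar>t\<bar>) has_real_derivative 2 * \<bar>t\<bar>) (at t)"
proof -
  consider "0 < t" | "t < 0" | "t = 0" by linarith
  then show ?thesis
  proof cases
    case 1
    have "((\<lambda>t. t * t) has_real_derivative 2 * \<bar>t\<bar>) (at t)" using 1 by (auto intro!: derivative_eq_intros)
    then show ?thesis by (rule has_field_derivative_transform_within_open[of _ _ _ "{0<..}"]) (use 1 in auto)
  next
    case 2
    have "((\<lambda>t. - (t * t)) has_real_derivative 2 * \<bar>t\<bar>) (at t)" using 2 by (auto intro!: derivative_eq_intros)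
    then show ?thesis by (rule has_field_derivative_transform_within_open[of _ _ _ "{..<0}"]) (use 2 in auto)
  next
    case 3
    have "((\<lambda>h::real. \<bar>h\<bar>) \<longlongrightarrow> \<bar>0\<bar>) (at 0)" by (intro tendsto_intros)
    moreover have "\<forall>\<^sub>F h in at 0. \<bar>h\<bar> = ((0 + h) * \<bar>0 + h\<bar> - 0 * \<bar>0\<bar>) / (h::real)"
      by (simp add: eventually_at_filter)
    ultimately have "((\<lambda>h::real. ((0 + h) * \<bar>0 + h\<bar> - 0 * \<bar>0\<bar>) / h) \<longlongrightarrow> \<bar>0\<bar>) (at 0)"
      using tendsto_cong by fast
    then show ?thesis unfolding 3 DERIV_def by simp
  qed
qed

lemma C2_fun_tpow_affine: "C2_fun (\<lambda>x. tpow (n \<bullet> x + c))"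
proof (rule C2_fun_affine)
  have e: "tpow = (\<lambda>t. (t^3 + t * (t * \<bar>t\<bar>)) / 2)" by (auto simp: tpow_def fun_eq_iff max_def power3_eq_cube)
  show "(tpow has_real_derivative (3 * t^2 + 3 * (t * \<bar>t\<bar>)) / 2) (at t)" for t
    unfolding e using DERIV_cdivide[OF DERIV_add[OF DERIV_pow[of 3 t] DERIV_mult[OF DERIV_ident DERIV_mult_abs[of t]]], of 2]
    by (simp add: algebra_simps power2_eq_square)
  show "((\<lambda>t. (3 * t^2 + 3 * (t * \<bar>t\<bar>)) / 2) has_real_derivative (6 * t + 6 * \<bar>t\<bar>) / 2) (at t)" for t
    using DERIV_cdivide[OF DERIV_add[OF DERIV_cmult[OF DERIV_pow[of 2 t], of 3] DERIV_cmult[OF DERIV_mult_abs[of t], of 3]], of 2]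
    by (simp add: algebra_simps)
  show "continuous_on UNIV (\<lambda>t::real. (6 * t + 6 * \<bar>t\<bar>) / 2)" by (intro continuous_intros) auto
qed

lemma C2_fun_affine_cube: "C2_fun (\<lambda>x. (n \<bullet> x + c) ^ 3)"
proof (rule C2_fun_affine)
  show "((\<lambda>t. t^3) has_real_derivative 3 * t^2) (at t)" for t :: real by (auto intro!: derivative_eq_intros)
  show "((\<lambda>t. 3 * t^2) has_real_derivative 6 * t) (at t)" for t :: real by (auto intro!: derivative_eq_intros)
qed (intro continuous_intros)

lemma corner_tpow: "corner r s u v w = tpow (u - r * v - s * w)"
  by (simp add: corner_def tpow_def)

section \<open>Barycentric geometry of the triangle\<close>

locale triangle =
  fixes p1 p2 p3 :: pt
  assumes nondegenerate: "orient p1 p2 p3 \<noteq> 0"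
begin

abbreviation "T \<equiv> tri p1 p2 p3"
abbreviation "b1 \<equiv> bary p1 p2 p3"
abbreviation "b2 \<equiv> bary p2 p3 p1"
abbreviation "b3 \<equiv> bary p3 p1 p2"

lemma bary_total: "b1 x + b2 x + b3 x = 1"
  using bary_sum[OF nondegenerate] .

lemma bary_reconstruct: "x = b1 x *\<^sub>R p1 + b2 x *\<^sub>R p2 + b3 x *\<^sub>R p3"
  using bary_point[OF nondegenerate] .

lemma rotated_nondegenerate: "orient p2 p3 p1 \<noteq> 0" "orient p3 p1 p2 \<noteq> 0"
  using nondegenerate by (simp_all add: orient_def algebra_simps)

lemma bary_combination_eq:
  assumes "a + b + c = 1"
  shows "b1 (a *\<^sub>R p1 + b *\<^sub>R p2 + c *\<^sub>R p3) = a" "b2 (a *\<^sub>R p1 + b *\<^sub>R p2 + c *\<^sub>R p3) = b" "b3 (a *\<^sub>R p1 + b *\<^sub>R p2 + c *\<^sub>R p3) = c"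
proof -
  show "b1 (a *\<^sub>R p1 + b *\<^sub>R p2 + c *\<^sub>R p3) = a" using bary_unique[OF nondegenerate assms] .
  show "b2 (a *\<^sub>R p1 + b *\<^sub>R p2 + c *\<^sub>R p3) = b"
    using bary_unique[OF rotated_nondegenerate(1), of b c a] assms by (simp add: add_ac)
  show "b3 (a *\<^sub>R p1 + b *\<^sub>R p2 + c *\<^sub>R p3) = c"
    using bary_unique[OF rotated_nondegenerate(2), of c a b] assms by (simp add: add_ac)
qed

lemma mem_tri: "x \<in> T \<longleftrightarrow> 0 \<le> b1 x \<and> 0 \<le> b2 x \<and> 0 \<le> b3 x"
proof
  assume "x \<in> T"
  then obtain a b c where "0 \<le> a" "0 \<le> b" "0 \<le> c" "a + b + c = 1" "x = a *\<^sub>R p1 + b *\<^sub>R p2 + c *\<^sub>R p3"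
    unfolding tri_def convex_hull_3 by blast
  then show "0 \<le> b1 x \<and> 0 \<le> b2 x \<and> 0 \<le> b3 x" using bary_combination_eq by simp
next
  assume "0 \<le> b1 x \<and> 0 \<le> b2 x \<and> 0 \<le> b3 x"
  then show "x \<in> T" unfolding tri_def convex_hull_3 using bary_total[of x] bary_reconstruct[of x] by blast
qed

definition grad :: "pt \<Rightarrow> pt \<Rightarrow> pt \<Rightarrow> pt" where
  "grad u v w = vector [(v$2 - w$2) / orient u v w, (w$1 - v$1) / orient u v w]"

lemma bary_affine:
  shows "bary u v w x = grad u v w \<bullet> x + bary u v w 0"
  unfolding bary_def grad_def orient_def inner_vec_def sum_2 vector_2
  by (simp add: add_divide_distrib[symmetric] diff_divide_distrib[symmetric]) (simp add: algebra_simps)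

lemma bary_shift: "bary u v w (x + t *\<^sub>R (a - b)) = bary u v w x + t * (bary u v w a - bary u v w b)"
  by (simp add: bary_affine[of u v w "x + t *\<^sub>R (a - b)"] bary_affine[of u v w x] bary_affine[of u v w a] bary_affine[of u v w b]
      inner_add_right inner_diff_right)

lemma bary_vertices:
  "b1 p1 = 1" "b2 p1 = 0" "b3 p1 = 0" "b1 p2 = 0" "b2 p2 = 1" "b3 p2 = 0" "b1 p3 = 0" "b2 p3 = 0" "b3 p3 = 1"
  using bary_combination_eq[of 1 0 0] bary_combination_eq[of 0 1 0] bary_combination_eq[of 0 0 1] by simp_all

lemma interior_tri: "interior T = {x. 0 < b1 x \<and> 0 < b2 x \<and> 0 < b3 x}" (is "_ = ?I")
proof
  have "open ?I" by (intro open_Collect_conj open_Collect_less continuous_intros)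
  moreover have "?I \<subseteq> T" by (auto simp: mem_tri)
  ultimately show "?I \<subseteq> interior T" by (rule interior_maximal[rotated])
next
  show "interior T \<subseteq> ?I"
  proof
    fix x assume x: "x \<in> interior T"
    have ex: "\<exists>t>0. x + t *\<^sub>R v \<in> T" for v
    proof -
      have "((\<lambda>t. x + t *\<^sub>R v) \<longlongrightarrow> x + 0 *\<^sub>R v) (at_right 0)" by (intro tendsto_intros)
      then have "\<forall>\<^sub>F t in at_right 0. x + t *\<^sub>R v \<in> interior T" using x by (intro topological_tendstoD) auto
      from eventually_happens[OF eventually_conj[OF this eventually_at_right_less[of 0]]]
      show ?thesis using interior_subset by auto
    qed
    \<comment> \<open>Moving parallel to a side decreases one coordinate at unit rate, so staying in
      \<open>T\<close> forces that coordinate to be positive at \<open>x\<close>.\<close>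
    obtain t where t: "t > 0" "x + t *\<^sub>R (p2 - p1) \<in> T" using ex by blast
    obtain s where s: "s > 0" "x + s *\<^sub>R (p3 - p2) \<in> T" using ex by blast
    obtain r where r: "r > 0" "x + r *\<^sub>R (p1 - p3) \<in> T" using ex by blast
    show "x \<in> ?I" using t s r by (simp add: mem_tri bary_shift bary_vertices)
  qed
qed

text \<open>The segment from a point of \<open>T\<close> towards the centroid enters the interior at
  once.\<close>

lemma tri_closure: "T \<subseteq> closure (interior T)"
proof
  fix x assume x: "x \<in> T"
  define g where "g = (1/3) *\<^sub>R p1 + (1/3) *\<^sub>R p2 + (1/3) *\<^sub>R p3"
  have g: "b1 g = 1/3" "b2 g = 1/3" "b3 g = 1/3" unfolding g_def by (rule bary_combination_eq; simp)+
  have lim: "((\<lambda>t. x + t *\<^sub>R (g - x)) \<longlongrightarrow> x + 0 *\<^sub>R (g - x)) (at_right 0)" by (intro tendsto_intros)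
  have "\<forall>\<^sub>F t in at_right 0. t < (1::real)" by (auto simp: eventually_at_right_field intro: exI[of _ 1])
  then have ev: "\<forall>\<^sub>F t in at_right 0. x + t *\<^sub>R (g - x) \<in> interior T"
    using eventually_at_right_less[of "0::real"]
  proof eventually_elim
    case (elim t)
    have "0 < b + t * (1/3 - b)" if "0 \<le> b" for b :: real
    proof -
      have "0 \<le> (1 - t) * b" using that elim by simp
      then show ?thesis using elim(2) by (simp add: algebra_simps)
    qed
    then show ?case using x unfolding interior_tri by (simp add: mem_tri bary_shift g)
  qed
  show "x \<in> closure (interior T)"
    by (rule Lim_in_closed_set[OF closed_closure _ _ lim[simplified]])
       (use ev closure_subset in \<open>auto elim!: eventually_mono\<close>)
qed

lemma area_eq: "area p1 p2 p3 = \<bar>orient p1 p2 p3\<bar> / 2"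
  unfolding area_def tri_def content_triangle by (simp add: orient_def abs_if algebra_simps)

section \<open>The basis functions as splines on the whole plane\<close>

definition E :: "nat \<Rightarrow> pt \<Rightarrow> real" where "E k x = elementary (b1 x) (b2 x) (b3 x) ! k"

text \<open>A C^2 function on the plane that will agree with \<open>ws_B\<close> on
  \<open>T\<close>; it serves as the smooth extension and supplies the boundary limits.\<close>

definition Fn :: "nat \<Rightarrow> pt \<Rightarrow> real" where "Fn i x = (\<Sum>k<28. real_of_int (ws_matrix!i!k) / 12 * E k x)"

lemma C2_fun_corner:
  assumes "\<And>x. f x = n \<bullet> x + c" "\<And>x. g x = n' \<bullet> x + c'" "\<And>x. h x = n'' \<bullet> x + c''"
  shows "C2_fun (\<lambda>x. corner r s (f x) (g x) (h x))"
proof -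
  have "f x - r * g x - s * h x = (n - r *\<^sub>R n' - s *\<^sub>R n'') \<bullet> x + (c - r * c' - s * c'')" for x
    unfolding assms by (simp add: inner_diff_left algebra_simps)
  then show ?thesis unfolding corner_tpow by (simp only: C2_fun_tpow_affine)
qed

lemma C2_fun_bary_corner: "C2_fun (\<lambda>x. corner r s (bary u v w x) (bary u' v' w' x) (bary u'' v'' w'' x))"
  by (rule C2_fun_corner) (rule bary_affine)+

lemma C2_fun_bary_product: "C2_fun (\<lambda>x. b1 x * b2 x * b3 x)"
proof -
  have cube: "C2_fun (\<lambda>x. (a * b1 x + b * b2 x + c * b3 x) ^ 3)" for a b c
  proof -
    have eq: "a * b1 x + b * b2 x + c * b3 x = (a *\<^sub>R grad p1 p2 p3 + b *\<^sub>R grad p2 p3 p1 + c *\<^sub>R grad p3 p1 p2) \<bullet> x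
        + (a * b1 0 + b * b2 0 + c * b3 0)" for x
      unfolding bary_affine[of p1 p2 p3 x] bary_affine[of p2 p3 p1 x] bary_affine[of p3 p1 p2 x]
      by (simp add: inner_add_left algebra_simps)
    have cube_eq: "(\<lambda>x. (a * b1 x + b * b2 x + c * b3 x) ^ 3) = (\<lambda>x. ((a *\<^sub>R grad p1 p2 p3 + b *\<^sub>R grad p2 p3 p1 + c *\<^sub>R grad p3 p1 p2) \<bullet> x
        + (a * b1 0 + b * b2 0 + c * b3 0)) ^ 3)"
      by (rule ext, rule arg_cong[where f = "\<lambda>t. t ^ 3"], rule eq)
    show ?thesis unfolding cube_eq by (rule C2_fun_affine_cube)
  qed
  \<comment> \<open>Polarisation writes the product as a combination of four cubes of affine forms,
    whose smoothness is known.\<close>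
  have polar: "a * b * c = 1/24 * (1 * a + 1 * b + 1 * c)^3 + (-1/24) * (1 * a + 1 * b + (-1) * c)^3
     + (-1/24) * (1 * a + (-1) * b + 1 * c)^3 + (-1/24) * ((-1) * a + 1 * b + 1 * c)^3" for a b c :: real
  proof -
    have p: "24 * (a * b * c) = (a + b + c)^3 - (a + b - c)^3 - (a - b + c)^3 - (b + c - a)^3"
      by (simp add: power3_eq_cube algebra_simps)
    have e: "(-1) * a + 1 * b + 1 * c = b + c - a" "1 * a + (-1) * b + 1 * c = a - b + c" "1 * a + 1 * b + (-1) * c = a + b - c" "1 * a + 1 * b + 1 * c = a + b + c"
      by simp_all
    show ?thesis unfolding e using p by linarith
  qed
  show ?thesis unfolding polar[of "b1 _" "b2 _" "b3 _"] by (intro C2_fun_add C2_fun_cmult cube)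
qed

lemma C2_fun_E: "k < 28 \<Longrightarrow> C2_fun (E k)"
proof -
  have "\<forall>k<28. C2_fun (\<lambda>x. elementary (b1 x) (b2 x) (b3 x) ! k)"
    unfolding all_less_28 by (simp add: elementary_def corners_def C2_fun_bary_corner C2_fun_bary_product)
  then show "k < 28 \<Longrightarrow> C2_fun (E k)" unfolding E_def by blast
qed

lemma C2_fun_Fn: "C2_fun (Fn i)"
  unfolding Fn_def by (intro C2_fun_sum C2_fun_cmult C2_fun_E) simp

lemma continuous_Fn: "continuous_on S (Fn i)"
  using C2_fun_imp_C2_open[OF C2_fun_Fn[of i]] unfolding C2_open_def
  by (intro continuous_at_imp_continuous_on ballI differentiable_imp_continuous_within) blast

lemma scaled_spline_eq:
  assumes x: "x \<in> interior T" and i: "i < 28"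
  shows "area p1 p2 p3 / 15 * ws_c (Suc i) * simplex_spline (ws_knots p1 p2 p3 (Suc i)) x = Fn i x"
proof -
  interpret interior_point p1 p2 p3 "b1 x" "b2 x" "b3 x"
    using x nondegenerate bary_total[of x] by unfold_locales (simp_all add: interior_tri)
  have "pt_of p1 p2 p3 (b1 x, b2 x, b3 x) = x" using bary_reconstruct[of x] by (simp add: pt_of_def)
  then have "N (ws_triples!i) = \<bar>orient p1 p2 p3\<bar> / 30 * simplex_spline (ws_knots p1 p2 p3 (Suc i)) x"
    by (simp add: nspline_def ws_knots_eq[OF i])
  then have "area p1 p2 p3 / 15 * ws_c (Suc i) * simplex_spline (ws_knots p1 p2 p3 (Suc i)) x = ws_c (Suc i) * N (ws_triples!i)"
    by (simp add: area_eq)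
  also have "\<dots> = Fn i x"
    unfolding ws_value[OF i] by (simp add: Fn_def E_def sum_divide_distrib)
  finally show ?thesis .
qed

text \<open>A boundary point is a limit point of the interior, so the limit in \<open>ws_B\<close>
  is unique and equals the value of the continuous \<open>Fn\<close>.\<close>

lemma ws_B_eq:
  assumes x: "x \<in> T" and i: "i < 28"
  shows "ws_B p1 p2 p3 (Suc i) x = Fn i x"
proof (cases "x \<in> interior T")
  case True
  then show ?thesis using scaled_spline_eq[OF True i] by (simp add: ws_B_def Let_def)
next
  case False
  let ?h = "\<lambda>y. area p1 p2 p3 / 15 * ws_c (Suc i) * simplex_spline (ws_knots p1 p2 p3 (Suc i)) y"
  have "x islimpt interior T" using tri_closure x False by (auto simp: closure_def)
  then have nt: "at x within interior T \<noteq> bot" by (simp add: trivial_limit_within)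
  have "isCont (Fn i) x"
    using continuous_Fn[of UNIV i] by (simp add: continuous_on_eq_continuous_at)
  then have "(Fn i \<longlongrightarrow> Fn i x) (at x within interior T)"
    unfolding isCont_def by (rule tendsto_within_subset[OF _ subset_UNIV])
  moreover have "\<forall>\<^sub>F y in at x within interior T. Fn i y = ?h y"
    unfolding eventually_at_filter
    by (intro always_eventually allI impI) (rule scaled_spline_eq[OF _ i, symmetric])
  ultimately have "(?h \<longlongrightarrow> Fn i x) (at x within interior T)" by (rule Lim_transform_eventually)
  then have "Lim (at x within interior T) ?h = Fn i x" by (rule tendsto_Lim[OF nt])
  then show ?thesis using x False by (simp add: ws_B_def Let_def)
qed

text \<open>In the interior this is a quotient of volumes with a nonnegative weight; the sign passes
  to the closure.\<close>

lemma Fn_nonneg: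
  assumes "x \<in> T" "i < 28" shows "0 \<le> Fn i x"
proof -
  have "closed {x. 0 \<le> Fn i x}" by (intro closed_Collect_le continuous_Fn continuous_on_const)
  moreover have "interior T \<subseteq> {x. 0 \<le> Fn i x}"
  proof
    fix x assume x: "x \<in> interior T"
    have "0 \<le> area p1 p2 p3 / 15 * ws_c (Suc i) * simplex_spline (ws_knots p1 p2 p3 (Suc i)) x"
      by (intro mult_nonneg_nonneg simplex_spline_nonneg) (simp_all add: area_eq ws_c_def)
    then show "x \<in> {x. 0 \<le> Fn i x}" unfolding scaled_spline_eq[OF x assms(2)] by simp
  qed
  ultimately have "closure (interior T) \<subseteq> {x. 0 \<le> Fn i x}" by (simp add: closure_minimal)
  then show ?thesis using tri_closure assms(1) by blast
qed

section \<open>Reflected corners and chords as affine forms\<close>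

lemma corner_reflect:
  "corner (1/2) 0 u v w = (corner 0 2 v w u - (v - 2 * u) ^ 3) / 8"
  "corner 0 (1/2) u v w = (corner 2 0 w u v - (w - 2 * u) ^ 3) / 8"
  by (auto simp: corner_def max_def power3_eq_cube field_simps)

lemma corner_origin: "0 \<le> u \<Longrightarrow> corner 0 0 u v w = u ^ 3"
  by (simp add: corner_def)

text \<open>\<open>ws_lines\<close> doubles the coefficients to keep them integral. Division by 2
  makes the positive one 1 again, so the truncated cubes of these forms are corner
  functions.\<close>

definition lform :: "int \<times> int \<times> int \<Rightarrow> pt \<Rightarrow> real" where
  "lform = (\<lambda>(a, b, c) x. (of_int a * b1 x + of_int b * b2 x + of_int c * b3 x) / 2)"

definition lnormal :: "int \<times> int \<times> int \<Rightarrow> pt" where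
  "lnormal = (\<lambda>(a, b, c). (1/2) *\<^sub>R (of_int a *\<^sub>R grad p1 p2 p3 + of_int b *\<^sub>R grad p2 p3 p1 + of_int c *\<^sub>R grad p3 p1 p2))"

definition lconst :: "int \<times> int \<times> int \<Rightarrow> real" where
  "lconst t = lform t 0"

lemma lform_affine: "lform t x = lnormal t \<bullet> x + lconst t"
proof -
  obtain a b c where t: "t = (a, b, c)" by (metis prod_cases3)
  have "b1 x = grad p1 p2 p3 \<bullet> x + b1 0" "b2 x = grad p2 p3 p1 \<bullet> x + b2 0" "b3 x = grad p3 p1 p2 \<bullet> x + b3 0"
    by (rule bary_affine)+
  then show ?thesis
    by (simp only: t lform_def lnormal_def lconst_def prod.case) (simp add: inner_add_left algebra_simps add_divide_distrib)
qed

text \<open>The three gradients sum to zero, so only differences of coefficients matter, and their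
  determinant is the sum of the components of the cross product.\<close>

lemma cross2_lnormal:
  "cross2 (lnormal (s1, s2, s3)) (lnormal (t1, t2, t3)) =
    of_int ((s2 * t3 - s3 * t2) + (s3 * t1 - s1 * t3) + (s1 * t2 - s2 * t1)) / (4 * orient p1 p2 p3)"
proof -
  let ?D = "orient p1 p2 p3"
  define u v where "u = (vector [p2$2 - p3$2, p3$1 - p2$1] :: pt)" and "v = (vector [p3$2 - p1$2, p1$1 - p3$1] :: pt)"
  have D: "orient p2 p3 p1 = ?D" "orient p3 p1 p2 = ?D" by (simp_all add: orient_def algebra_simps)
  have g: "grad p1 p2 p3 = (1 / ?D) *\<^sub>R u" "grad p2 p3 p1 = (1 / ?D) *\<^sub>R v" "grad p3 p1 p2 = (1 / ?D) *\<^sub>R (- u - v)"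
    by (simp_all add: grad_def D u_def v_def vec_eq_iff forall_2 vector_2 diff_divide_distrib)
  have uv: "u$1 * v$2 - u$2 * v$1 = ?D" by (simp add: u_def v_def vector_2 orient_def algebra_simps)
  have n: "lnormal (a, b, c) = (1 / (2 * ?D)) *\<^sub>R (of_int (a - c) *\<^sub>R u + of_int (b - c) *\<^sub>R v)" for a b c
    unfolding lnormal_def g by (simp add: vec_eq_iff algebra_simps add_divide_distrib diff_divide_distrib)
  have "cross2 (lnormal (s1, s2, s3)) (lnormal (t1, t2, t3)) = (1 / (2 * ?D)) * (1 / (2 * ?D)) *
     (of_int ((s1 - s3) * (t2 - t3) - (s2 - s3) * (t1 - t3)) * (u$1 * v$2 - u$2 * v$1))"
    unfolding n cross2_def by (simp add: algebra_simps)
  also have "(s1 - s3) * (t2 - t3) - (s2 - s3) * (t1 - t3) = (s2 * t3 - s3 * t2) + (s3 * t1 - s1 * t3) + (s1 * t2 - s2 * t1)"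
    by (simp add: algebra_simps)
  finally have c: "cross2 (lnormal (s1, s2, s3)) (lnormal (t1, t2, t3)) = (1 / (2 * ?D)) * (1 / (2 * ?D)) *
     (of_int ((s2 * t3 - s3 * t2) + (s3 * t1 - s1 * t3) + (s1 * t2 - s2 * t1)) * ?D)" unfolding uv .
  have "1 / (2 * d) * (1 / (2 * d)) * (W * d) = W / (4 * d)" if "d \<noteq> 0" for W d :: real
    using that by simp
  then show ?thesis unfolding c using nondegenerate by blast
qed

text \<open>The factor \<open>w\<close> is the sum of the components of \<open>icross s t\<close>;
  it is nonzero because distinct chords have a nonzero cross product, all of whose components are
  multiples of \<open>w\<close>. It governs both the position of the intersection and
  transversality.\<close>

lemma concurrent_lines:
  assumes st: "s \<in> set ws_lines" "t \<in> set ws_lines" "s \<noteq> t" and x: "lform s x = 0" "lform t x = 0"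
  obtains w where "w \<noteq> 0" "icross s t = (i, j, k) \<Longrightarrow> of_int i = b1 x * w \<and> of_int j = b2 x * w \<and> of_int k = b3 x * w"
    "cross2 (lnormal s) (lnormal t) = w / (4 * orient p1 p2 p3)"
proof -
  obtain s1 s2 s3 t1 t2 t3 where e: "s = (s1, s2, s3)" "t = (t1, t2, t3)" by (metis prod_cases3)
  define w where "w = real_of_int ((s2 * t3 - s3 * t2) + (s3 * t1 - s1 * t3) + (s1 * t2 - s2 * t1))"
  have z: "of_int s1 * b1 x + of_int s2 * b2 x + of_int s3 * b3 x = 0" "of_int t1 * b1 x + of_int t2 * b2 x + of_int t3 * b3 x = 0"
    using x by (simp_all add: e lform_def)
  have pr: "real_of_int (s2 * t3 - s3 * t2) = b1 x * w" "real_of_int (s3 * t1 - s1 * t3) = b2 x * w" "real_of_int (s1 * t2 - s2 * t1) = b3 x * w"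
    using cross_proportional[OF z bary_total] by (simp_all add: w_def)
  have "w \<noteq> 0"
  proof
    assume "w = 0"
    then have "icross s t = (0, 0, 0)" using pr by (simp add: e icross_def flip: of_int_mult of_int_diff)
    then show False using ws_lines_cross st by blast
  qed
  moreover have "cross2 (lnormal s) (lnormal t) = w / (4 * orient p1 p2 p3)"
    unfolding e cross2_lnormal w_def ..
  moreover have "of_int i = b1 x * w \<and> of_int j = b2 x * w \<and> of_int k = b3 x * w" if "icross s t = (i, j, k)"
    using that pr by (simp add: e icross_def)
  ultimately show ?thesis using that by blast
qed

lemma lform_vertices: "lform (a, b, c) p1 = of_int a / 2" "lform (a, b, c) p2 = of_int b / 2" "lform (a, b, c) p3 = of_int c / 2"
  by (simp_all add: lform_def bary_vertices)

lemma lnormal_nonzero: assumes "t \<in> set ws_lines" shows "lnormal t \<noteq> 0"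
proof
  assume "lnormal t = 0"
  \<comment> \<open>With zero normal the form would take equal values at the vertices, but no chord
    has three equal coefficients.\<close>
  then have "lform t p1 = lform t p2" "lform t p2 = lform t p3" by (simp_all add: lform_affine)
  then show False using assms by (auto simp: ws_lines_def lform_vertices)
qed

text \<open>Subfamilies occur because the analysis at a point involves only the chords through
  it.\<close>

lemma line_family_subset:
  assumes "J \<subseteq> set ws_lines" shows "line_family J lnormal lconst"
proof
  show "finite J" using assms by (rule finite_subset) simp
  show "lnormal t \<noteq> 0" if "t \<in> J" for t using that assms lnormal_nonzero by blast
  show "cross2 (lnormal s) (lnormal t) \<noteq> 0"
    if st: "s \<in> J" "t \<in> J" "s \<noteq> t" "lnormal s \<bullet> x + lconst s = 0" "lnormal t \<bullet> x + lconst t = 0" for s t x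
  proof -
    have m: "s \<in> set ws_lines" "t \<in> set ws_lines" using st assms by auto
    have l: "lform s x = 0" "lform t x = 0" using st by (simp_all add: lform_affine)
    obtain i j k where "icross s t = (i, j, k)" by (metis prod_cases3)
    from concurrent_lines[OF m st(3) l] obtain w where "w \<noteq> 0" "cross2 (lnormal s) (lnormal t) = w / (4 * orient p1 p2 p3)" by metis
    then show ?thesis using nondegenerate by simp
  qed
qed

text \<open>If two chords meet in \<open>x\<close>, the integer vector \<open>icross s t\<close> is
  a nonzero multiple of its coordinates. This transfers the finite check
  \<open>ws_lines_concurrent\<close> to real points.\<close>

lemma concurrency_le_4:
  assumes x: "x \<in> interior T" shows "card {t \<in> set ws_lines. lform t x = 0} \<le> 4" (is "card ?J \<le> 4")
proof (cases "\<exists>s\<in>?J. \<exists>t\<in>?J. s \<noteq> t")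
  case False
  then have "card ?J \<le> Suc 0" by (subst card_le_Suc0_iff_eq) auto
  then show ?thesis by simp
next
  case True
  then obtain s t where st: "s \<in> set ws_lines" "t \<in> set ws_lines" "s \<noteq> t" "lform s x = 0" "lform t x = 0" by blast
  obtain i j k where c: "icross s t = (i, j, k)" by (metis prod_cases3)
  obtain w where w: "w \<noteq> 0" "of_int i = b1 x * w" "of_int j = b2 x * w" "of_int k = b3 x * w"
    using concurrent_lines[OF st, of i j k] c by metis
  have pos: "0 < b1 x" "0 < b2 x" "0 < b3 x" using x by (simp_all add: interior_tri)
  have "one_signed (i, j, k)"
  proof (cases "0 < w")
    case True
    then have "0 < real_of_int i" "0 < real_of_int j" "0 < real_of_int k" unfolding w using pos by simp_all
    then show ?thesis by (simp add: one_signed_def)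
  next
    case False
    then have "w < 0" using w(1) by simp
    then have "real_of_int i < 0" "real_of_int j < 0" "real_of_int k < 0" unfolding w using pos by (simp_all add: mult_less_0_iff)
    then show ?thesis by (simp add: one_signed_def)
  qed
  then have le: "length (filter (\<lambda>u. idot u (i, j, k) = 0) ws_lines) \<le> 4"
    using ws_lines_concurrent st c by metis
  have "?J \<subseteq> set (filter (\<lambda>u. idot u (i, j, k) = 0) ws_lines)"
  proof
    fix u assume u: "u \<in> ?J"
    obtain a b d where e: "u = (a, b, d)" by (metis prod_cases3)
    have z: "of_int a * b1 x + of_int b * b2 x + of_int d * b3 x = 0" using u by (simp add: e lform_def)
    have "real_of_int (idot u (i, j, k)) = (of_int a * b1 x + of_int b * b2 x + of_int d * b3 x) * w"
      unfolding e idot_def prod.case of_int_add of_int_mult w by (simp only: distrib_right mult.assoc)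
    then have "real_of_int (idot u (i, j, k)) = 0" unfolding z by simp
    then show "u \<in> set (filter (\<lambda>u. idot u (i, j, k) = 0) ws_lines)" using u by simp
  qed
  then have "card ?J \<le> card (set (filter (\<lambda>u. idot u (i, j, k) = 0) ws_lines))" by (intro card_mono) simp_all
  also have "\<dots> \<le> 4" using card_length le by (rule le_trans)
  finally show ?thesis .
qed

section \<open>Partition segments versus chords\<close>

definition grid_point :: "int \<times> int \<times> int \<Rightarrow> pt" where
  "grid_point = (\<lambda>(a, b, c). (of_int a / 3) *\<^sub>R p1 + (of_int b / 3) *\<^sub>R p2 + (of_int c / 3) *\<^sub>R p3)"

lemma ws_points_grid: "ws_points p1 p2 p3 \<subseteq> grid_point ` set ws_grid"
  by (simp add: ws_points_def ws_grid_def grid_point_def p12_def p13_def p21_def p23_def p31_def p32_def)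

lemma lform_grid_point:
  assumes "q \<in> set ws_grid" shows "lform t (grid_point q) = of_int (idot t q) / 6"
proof -
  obtain a b c where t: "t = (a, b, c)" by (metis prod_cases3)
  obtain i j k where q: "q = (i, j, k)" by (metis prod_cases3)
  have "i + j + k = 3" using assms by (auto simp: ws_grid_def q)
  then have "real_of_int i / 3 + real_of_int j / 3 + real_of_int k / 3 = 1" by (simp add: add_divide_distrib[symmetric] flip: of_int_add)
  note B = bary_combination_eq[OF this]
  show ?thesis
    unfolding t q lform_def grid_point_def prod.case B idot_def by (simp add: field_simps)
qed

text \<open>Any two of the nine points lie on a common side or chord, and a point of the open
  triangle lies on no side.\<close>

lemma ws_segments_on_lines:
  assumes x: "x \<in> ws_segments p1 p2 p3" "x \<in> interior T" shows "\<exists>t\<in>set ws_lines. lform t x = 0"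
proof -
  obtain a b where ab: "a \<in> ws_points p1 p2 p3" "b \<in> ws_points p1 p2 p3" "x \<in> closed_segment a b"
    using x(1) unfolding ws_segments_def by blast
  obtain q r where qr: "q \<in> set ws_grid" "r \<in> set ws_grid" "a = grid_point q" "b = grid_point r"
    using ab ws_points_grid by blast
  obtain t where t: "t \<in> set ((1,0,0) # (0,1,0) # (0,0,1) # ws_lines)" "idot t q = 0" "idot t r = 0"
    using ws_grid_lines qr by metis
  obtain u where u: "x = (1 - u) *\<^sub>R a + u *\<^sub>R b" using ab(3) by (auto simp: closed_segment_def)
  have "lform t x = (1 - u) * lform t a + u * lform t b"
    unfolding u lform_affine by (simp add: inner_add_right algebra_simps)
  then have 0: "lform t x = 0" using qr t by (simp add: lform_grid_point)
  moreover have "lform (1,0,0) x \<noteq> 0" "lform (0,1,0) x \<noteq> 0" "lform (0,0,1) x \<noteq> 0"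
    using x(2) by (simp_all add: lform_def interior_tri)
  ultimately show ?thesis using t(1) by auto
qed

text \<open>Every chord expresses one coordinate as \<open>r\<close> and \<open>s\<close> times the
  other two with ratios among 2, 1/2 and 0, so inside \<open>T\<close> it is a segment between two
  of the nine points.\<close>

lemma lines_in_ws_segments:
  assumes t: "t \<in> set ws_lines" and x: "x \<in> T" "lform t x = 0" shows "x \<in> ws_segments p1 p2 p3"
proof -
  have pos: "0 \<le> b1 x" "0 \<le> b2 x" "0 \<le> b3 x" using x by (simp_all add: mem_tri)
  have seg: "x \<in> ws_segments p1 p2 p3" if "a \<in> ws_points p1 p2 p3" "b \<in> ws_points p1 p2 p3" "x \<in> closed_segment a b" for a b
    using that unfolding ws_segments_def by blast
  have X: "b1 x *\<^sub>R p1 + b2 x *\<^sub>R p2 + b3 x *\<^sub>R p3 = x" "b2 x *\<^sub>R p2 + b3 x *\<^sub>R p3 + b1 x *\<^sub>R p1 = x" "b3 x *\<^sub>R p3 + b1 x *\<^sub>R p1 + b2 x *\<^sub>R p2 = x"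
    using bary_reconstruct[of x] by (simp_all add: add_ac)
  have S: "b1 x + b2 x + b3 x = 1" "b2 x + b3 x + b1 x = 1" "b3 x + b1 x + b2 x = 1" using bary_total[of x] by simp_all
  \<comment> \<open>On a side these ratios mark its two inner points and the far vertex.\<close>
  have frac: "(r / (1 + r), 1 / (1 + r)) \<in> {(2/3, 1/3), (1/3, 2/3), (0, 1)}" if r: "r \<in> {2, 1/2, 0}" for r :: real
  proof -
    consider "r = 2" | "r = 1/2" | "r = 0" using r by blast
    then show ?thesis
    proof cases
      case 2
      show ?thesis unfolding 2 by simp
    qed simp_all
  qed
  have pts_all: "\<forall>(p, q)\<in>{(2/3, 1/3), (1/3, 2/3), (0, 1)}. p *\<^sub>R p1 + q *\<^sub>R p2 \<in> ws_points p1 p2 p3 \<and>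
    p *\<^sub>R p1 + q *\<^sub>R p3 \<in> ws_points p1 p2 p3 \<and>
    p *\<^sub>R p2 + q *\<^sub>R p3 \<in> ws_points p1 p2 p3 \<and>
    p *\<^sub>R p2 + q *\<^sub>R p1 \<in> ws_points p1 p2 p3 \<and>
    p *\<^sub>R p3 + q *\<^sub>R p1 \<in> ws_points p1 p2 p3 \<and>
    p *\<^sub>R p3 + q *\<^sub>R p2 \<in> ws_points p1 p2 p3"
    by (simp add: ws_points_def p12_def p13_def p21_def p23_def p31_def p32_def add.commute)
  have pts: "p *\<^sub>R p1 + q *\<^sub>R p2 \<in> ws_points p1 p2 p3"
    "p *\<^sub>R p1 + q *\<^sub>R p3 \<in> ws_points p1 p2 p3"
    "p *\<^sub>R p2 + q *\<^sub>R p3 \<in> ws_points p1 p2 p3"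
    "p *\<^sub>R p2 + q *\<^sub>R p1 \<in> ws_points p1 p2 p3"
    "p *\<^sub>R p3 + q *\<^sub>R p1 \<in> ws_points p1 p2 p3"
    "p *\<^sub>R p3 + q *\<^sub>R p2 \<in> ws_points p1 p2 p3"
    if "(p, q) \<in> {(2/3, 1/3), (1/3, 2/3), (0, 1)}" for p q
    using bspec[OF pts_all that] by simp_all
  note mem = pts[OF frac]
  have side1: "x \<in> ws_segments p1 p2 p3" if "r \<in> {2, 1/2, 0}" "s \<in> {2, 1/2, 0}" "b1 x = r * b2 x + s * b3 x" for r s
    by (rule seg[OF mem(1)[OF that(1)] mem(2)[OF that(2)]])
       (use closed_segment_between_sides[of r s "b2 x" "b3 x" "b1 x" p1 p2 p3] that pos S X in auto)
  have side2: "x \<in> ws_segments p1 p2 p3" if "r \<in> {2, 1/2, 0}" "s \<in> {2, 1/2, 0}" "b2 x = r * b3 x + s * b1 x" for r s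
    by (rule seg[OF mem(3)[OF that(1)] mem(4)[OF that(2)]])
       (use closed_segment_between_sides[of r s "b3 x" "b1 x" "b2 x" p2 p3 p1] that pos S X in auto)
  have side3: "x \<in> ws_segments p1 p2 p3" if "r \<in> {2, 1/2, 0}" "s \<in> {2, 1/2, 0}" "b3 x = r * b1 x + s * b2 x" for r s
    by (rule seg[OF mem(5)[OF that(1)] mem(6)[OF that(2)]])
       (use closed_segment_between_sides[of r s "b1 x" "b2 x" "b3 x" p3 p1 p2] that pos S X in auto)
  have "t = (2, -4, -4) \<or> t = (2, -4, -1) \<or> t = (2, -4, 0) \<or> t = (2, -1, -4) \<or> t = (2, -1, -1) \<or> t = (2, 0, -4) \<or> t = (-4, 2, -4) \<or> t = (-1, 2, -4) \<or> t = (0, 2, -4) \<or> t = (-4, 2, -1) \<or> t = (-1, 2, -1) \<or> t = (-4, 2, 0) \<or> t = (-4, -4, 2) \<or> t = (-4, -1, 2) \<or> t = (-4, 0, 2) \<or> t = (-1, -4, 2) \<or> t = (-1, -1, 2) \<or> t = (0, -4, 2)"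
    using t by (simp add: ws_lines_def)
  then show ?thesis
  proof (elim disjE)
    assume t: "t = (2, -4, -4)"
    have "b1 x = 2 * b2 x + 2 * b3 x"
      using x(2) unfolding t lform_def by simp
    then show ?thesis by (intro side1[of 2 2]) simp_all
  next
    assume t: "t = (2, -4, -1)"
    have "b1 x = 2 * b2 x + (1/2) * b3 x"
      using x(2) unfolding t lform_def by simp
    then show ?thesis by (intro side1[of 2 "1/2"]) simp_all
  next
    assume t: "t = (2, -4, 0)"
    have "b1 x = 2 * b2 x + 0 * b3 x"
      using x(2) unfolding t lform_def by simp
    then show ?thesis by (intro side1[of 2 0]) simp_all
  next
    assume t: "t = (2, -1, -4)"
    have "b1 x = (1/2) * b2 x + 2 * b3 x"
      using x(2) unfolding t lform_def by simp
    then show ?thesis by (intro side1[of "1/2" 2]) simp_all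
  next
    assume t: "t = (2, -1, -1)"
    have "b1 x = (1/2) * b2 x + (1/2) * b3 x"
      using x(2) unfolding t lform_def by simp
    then show ?thesis by (intro side1[of "1/2" "1/2"]) simp_all
  next
    assume t: "t = (2, 0, -4)"
    have "b1 x = 0 * b2 x + 2 * b3 x"
      using x(2) unfolding t lform_def by simp
    then show ?thesis by (intro side1[of 0 2]) simp_all
  next
    assume t: "t = (-4, 2, -4)"
    have "b2 x = 2 * b3 x + 2 * b1 x"
      using x(2) unfolding t lform_def by simp
    then show ?thesis by (intro side2[of 2 2]) simp_all
  next
    assume t: "t = (-1, 2, -4)"
    have "b2 x = 2 * b3 x + (1/2) * b1 x"
      using x(2) unfolding t lform_def by simp
    then show ?thesis by (intro side2[of 2 "1/2"]) simp_all
  next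
    assume t: "t = (0, 2, -4)"
    have "b2 x = 2 * b3 x + 0 * b1 x"
      using x(2) unfolding t lform_def by simp
    then show ?thesis by (intro side2[of 2 0]) simp_all
  next
    assume t: "t = (-4, 2, -1)"
    have "b2 x = (1/2) * b3 x + 2 * b1 x"
      using x(2) unfolding t lform_def by simp
    then show ?thesis by (intro side2[of "1/2" 2]) simp_all
  next
    assume t: "t = (-1, 2, -1)"
    have "b2 x = (1/2) * b3 x + (1/2) * b1 x"
      using x(2) unfolding t lform_def by simp
    then show ?thesis by (intro side2[of "1/2" "1/2"]) simp_all
  next
    assume t: "t = (-4, 2, 0)"
    have "b2 x = 0 * b3 x + 2 * b1 x"
      using x(2) unfolding t lform_def by simp
    then show ?thesis by (intro side2[of 0 2]) simp_all
  next
    assume t: "t = (-4, -4, 2)"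
    have "b3 x = 2 * b1 x + 2 * b2 x"
      using x(2) unfolding t lform_def by simp
    then show ?thesis by (intro side3[of 2 2]) simp_all
  next
    assume t: "t = (-4, -1, 2)"
    have "b3 x = 2 * b1 x + (1/2) * b2 x"
      using x(2) unfolding t lform_def by simp
    then show ?thesis by (intro side3[of 2 "1/2"]) simp_all
  next
    assume t: "t = (-4, 0, 2)"
    have "b3 x = 2 * b1 x + 0 * b2 x"
      using x(2) unfolding t lform_def by simp
    then show ?thesis by (intro side3[of 2 0]) simp_all
  next
    assume t: "t = (-1, -4, 2)"
    have "b3 x = (1/2) * b1 x + 2 * b2 x"
      using x(2) unfolding t lform_def by simp
    then show ?thesis by (intro side3[of "1/2" 2]) simp_all
  next
    assume t: "t = (-1, -1, 2)"
    have "b3 x = (1/2) * b1 x + (1/2) * b2 x"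
      using x(2) unfolding t lform_def by simp
    then show ?thesis by (intro side3[of "1/2" "1/2"]) simp_all
  next
    assume t: "t = (0, -4, 2)"
    have "b3 x = 0 * b1 x + 2 * b2 x"
      using x(2) unfolding t lform_def by simp
    then show ?thesis by (intro side3[of 0 2]) simp_all
  qed
qed

section \<open>The elementary functions and the representation by chords\<close>

interpretation L: line_family "set ws_lines" lnormal lconst
  by (rule line_family_subset) simp

lemma L_l: "L.l t x = lform t x"
  by (simp add: L.l_def lform_affine)

text \<open>The indices are the positions in \<open>elementary\<close> of the corners that represent
  the chords, one orientation for each chord.\<close>

lemma tpow_lines: "map (\<lambda>t. tpow (lform t x)) ws_lines = map (\<lambda>k. E k x) [0, 1, 2, 3, 4, 6, 9, 10, 11, 12, 13, 15, 18, 19, 20, 21, 22, 24]"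
  by (simp add: ws_lines_def E_def elementary_def corners_def corner_tpow lform_def diff_divide_distrib add_divide_distrib)
    (simp add: algebra_simps)

lemma tsum_tpow_coefficient:
  "L.tsum (tpow_coefficient e) x = sum_list (map2 (*) (tpow_coefficients e) (map (\<lambda>k. E k x) [0, 1, 2, 3, 4, 6, 9, 10, 11, 12, 13, 15, 18, 19, 20, 21, 22, 24]))"
proof -
  have "L.tsum (tpow_coefficient e) x = sum_list (map (\<lambda>t. tpow_coefficient e t * tpow (lform t x)) ws_lines)"
    unfolding L.tsum_def L_l by (rule sum.distinct_set_conv_list[OF distinct_ws_lines])
  then show ?thesis unfolding sum_list_mult_map map_tpow_coefficient tpow_lines .
qed

text \<open>The restriction to \<open>T\<close> comes from the corners with both ratios 0: they
  equal cubes of coordinates only where these are nonnegative.\<close>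

lemma decomposition:
  assumes "x \<in> T"
  shows "(\<Sum>k<28. e k * E k x) = cubic_part e (b1 x) (b2 x) (b3 x) + L.tsum (tpow_coefficient e) x"
proof -
  have "0 \<le> b1 x" "0 \<le> b2 x" "0 \<le> b3 x" using assms by (simp_all add: mem_tri)
  then show ?thesis
    unfolding sum_28 tsum_tpow_coefficient tpow_coefficients_def cubic_part_def
    by (simp add: E_def elementary_def corners_def corner_reflect corner_origin) (simp add: algebra_simps diff_divide_distrib add_divide_distrib)
qed

lemma cubic_poly_linear_forms:
  "cubic_poly (\<lambda>x. (a1 * b1 x + a2 * b2 x + a3 * b3 x) * (c1 * b1 x + c2 * b2 x + c3 * b3 x) * (d1 * b1 x + d2 * b2 x + d3 * b3 x))"
proof -
  let ?k = "\<lambda>a1 a2 a3. a1 * b1 0 + a2 * b2 0 + a3 * b3 0"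
  let ?g = "\<lambda>a1 a2 a3. a1 *\<^sub>R grad p1 p2 p3 + a2 *\<^sub>R grad p2 p3 p1 + a3 *\<^sub>R grad p3 p1 p2"
  have eq: "a1 * b1 x + a2 * b2 x + a3 * b3 x = ?k a1 a2 a3 + ?g a1 a2 a3 $ 1 * x$1 + ?g a1 a2 a3 $ 2 * x$2" for a1 a2 a3 x
  proof -
    have "b1 x = grad p1 p2 p3 \<bullet> x + b1 0" "b2 x = grad p2 p3 p1 \<bullet> x + b2 0" "b3 x = grad p3 p1 p2 \<bullet> x + b3 0"
      by (rule bary_affine)+
    then have "a1 * b1 x + a2 * b2 x + a3 * b3 x = a1 * (grad p1 p2 p3 \<bullet> x + b1 0) + a2 * (grad p2 p3 p1 \<bullet> x + b2 0) + a3 * (grad p3 p1 p2 \<bullet> x + b3 0)"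
      by (simp only:)
    then show ?thesis by (simp add: inner_vec_def sum_2 algebra_simps)
  qed
  have "(\<lambda>x. (a1 * b1 x + a2 * b2 x + a3 * b3 x) * (c1 * b1 x + c2 * b2 x + c3 * b3 x) * (d1 * b1 x + d2 * b2 x + d3 * b3 x))
    = (\<lambda>x. (?k a1 a2 a3 + ?g a1 a2 a3 $ 1 * x$1 + ?g a1 a2 a3 $ 2 * x$2) * (?k c1 c2 c3 + ?g c1 c2 c3 $ 1 * x$1 + ?g c1 c2 c3 $ 2 * x$2)
        * (?k d1 d2 d3 + ?g d1 d2 d3 $ 1 * x$1 + ?g d1 d2 d3 $ 2 * x$2))"
    by (rule ext) (intro arg_cong2[where f = "(*)"] eq)
  then show ?thesis by (simp only: cubic_poly_mult3)
qed

lemma cubic_poly_cubic_part: "cubic_poly (\<lambda>x. cubic_part e (b1 x) (b2 x) (b3 x))"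
proof -
  note M = cubic_poly_linear_forms
  have cube: "cubic_poly (\<lambda>x. m * ((a1 * b1 x + a2 * b2 x + a3 * b3 x) ^ 3))" for m a1 a2 a3
    unfolding power3_eq_cube by (intro cubic_poly_cmult M)
  have "cubic_poly (\<lambda>x. e 8 * (1 * b1 x + 0 * b2 x + 0 * b3 x) ^ 3 + e 17 * (0 * b1 x + 1 * b2 x + 0 * b3 x) ^ 3
    + e 26 * (0 * b1 x + 0 * b2 x + 1 * b3 x) ^ 3
    + e 27 * ((1 * b1 x + 0 * b2 x + 0 * b3 x) * (0 * b1 x + 1 * b2 x + 0 * b3 x) * (0 * b1 x + 0 * b2 x + 1 * b3 x))
    + (- e 5 / 8) * ((- 2) * b1 x + 1 * b2 x + 0 * b3 x) ^ 3 + (- e 7 / 8) * ((- 2) * b1 x + 0 * b2 x + 1 * b3 x) ^ 3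
    + (- e 14 / 8) * (0 * b1 x + (- 2) * b2 x + 1 * b3 x) ^ 3 + (- e 16 / 8) * (1 * b1 x + (- 2) * b2 x + 0 * b3 x) ^ 3
    + (- e 23 / 8) * (1 * b1 x + 0 * b2 x + (- 2) * b3 x) ^ 3 + (- e 25 / 8) * (0 * b1 x + 1 * b2 x + (- 2) * b3 x) ^ 3)"
    by (intro cubic_poly_add cube) (intro cubic_poly_cmult M)
  then show ?thesis
    by (rule back_subst[where P = cubic_poly]) (simp add: cubic_part_def fun_eq_iff add_divide_distrib)
qed

text \<open>Local uniqueness makes the 18 chord coefficients vanish. The cubic part is then zero on
  the open triangle, hence everywhere, and ten of its values determine the remaining
  coefficients.\<close>

lemma E_independent:
  assumes zero: "\<And>x. x \<in> interior T \<Longrightarrow> (\<Sum>k<28. e k * E k x) = 0" and k: "k < 28"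
  shows "e k = 0"
proof -
  let ?P = "\<lambda>x. cubic_part e (b1 x) (b2 x) (b3 x)" and ?a = "tpow_coefficient e"
  have dec: "?P x + L.tsum ?a x = 0" if "x \<in> interior T" for x
  proof -
    have "x \<in> T" using that interior_subset by blast
    from decomposition[OF this, of e] show ?thesis using zero[OF that] by simp
  qed
  have a0: "?a t = 0" if t: "t \<in> set ws_lines" for t
  proof -
    obtain i j k where y: "idot t (i, j, k) = 0" "0 < i" "0 < j" "0 < k"
      using bspec[OF ws_lines_interior t] by auto
    obtain a b c where e: "t = (a, b, c)" by (metis prod_cases3)
    define s where "s = real_of_int (i + j + k)"
    have s: "0 < s" using y by (simp add: s_def)
    have s1: "of_int i / s + of_int j / s + of_int k / s = 1"
      using s by (simp add: s_def add_divide_distrib[symmetric])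
    define x where "x = (of_int i / s) *\<^sub>R p1 + (of_int j / s) *\<^sub>R p2 + (of_int k / s) *\<^sub>R p3"
    note B = bary_combination_eq[OF s1, folded x_def]
    have x: "x \<in> interior T" using y s by (simp add: interior_tri B)
    have "real_of_int (idot t (i, j, k)) = 0" using y by simp
    then have "real_of_int a * real_of_int i + real_of_int b * real_of_int j + real_of_int c * real_of_int k = 0"
      by (simp add: e idot_def)
    moreover have "lform t x = (real_of_int a * real_of_int i + real_of_int b * real_of_int j + real_of_int c * real_of_int k) / (2 * s)"
      unfolding e lform_def prod.case B using s by (simp add: field_simps)
    ultimately have "L.l t x = 0" by (simp add: L_l)
    moreover have "\<forall>\<^sub>F y in nhds x. ?P y + L.tsum ?a y = 0"
      using eventually_nhds_in_open[OF open_interior x] by (rule eventually_mono) (rule dec)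
    ultimately show ?thesis using L.local_form_coefficients_zero[OF cubic_poly_cubic_part _ t] by blast
  qed
  then have "map ?a ws_lines = replicate 18 0"
    by (intro nth_equalityI) (simp_all add: ws_lines_def[THEN arg_cong, of length])
  then have c0: "tpow_coefficients e = replicate 18 0" unfolding map_tpow_coefficient .
  have ts: "L.tsum ?a x = 0" for x unfolding L.tsum_def using a0 by simp
  have P0: "?P x = 0" for x
  proof (rule cubic_poly_eq_zero[OF cubic_poly_cubic_part open_interior])
    have "p1 \<in> T" by (simp add: mem_tri bary_vertices)
    then show "interior T \<noteq> {}" using tri_closure by auto
    show "?P x = 0" if "x \<in> interior T" for x using dec[OF that] ts by simp
  qed
  have P: "cubic_part e a b c = 0" if "a + b + c = 1" for a b c
    using P0[of "a *\<^sub>R p1 + b *\<^sub>R p2 + c *\<^sub>R p3"] bary_combination_eq[OF that] by simp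
  have "list_all (\<lambda>k. e k = 0) [0,1,2,3,4,5,6,7,8,9,10,11,12,13,14,15,16,17,18,19,20,21,22,23,24,25,26,27]"
  proof -
    \<comment> \<open>The sample points may lie outside the triangle, since the cubic vanishes on
      the whole plane; only the coordinate sum 1 matters.\<close>
    note eqs = P[of 1 0 0, simplified cubic_part_def] P[of 0 1 0, simplified cubic_part_def] P[of 0 0 1, simplified cubic_part_def]
      P[of 2 "-1" 0, simplified cubic_part_def] P[of "-1" 2 0, simplified cubic_part_def] P[of 2 0 "-1", simplified cubic_part_def]
      P[of "-1" 0 2, simplified cubic_part_def] P[of 0 2 "-1", simplified cubic_part_def] P[of 0 "-1" 2, simplified cubic_part_def]
      P[of 1 1 "-1", simplified cubic_part_def]
    have z: "e 5 = 0" "e 7 = 0" "e 8 = 0" "e 14 = 0" "e 16 = 0" "e 17 = 0" "e 23 = 0" "e 25 = 0" "e 26 = 0" "e 27 = 0"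
      using eqs by (simp_all; linarith)+
    show ?thesis using c0 z by (simp add: tpow_coefficients_def numeral_eq_Suc)
  qed
  then show ?thesis using k unfolding all_less_28[symmetric] by blast
qed

definition in_span :: "(pt \<Rightarrow> real) \<Rightarrow> bool" where
  "in_span f \<longleftrightarrow> (\<exists>e. \<forall>x\<in>T. f x = (\<Sum>k<28. e k * E k x))"

lemma in_span_cong: "in_span f \<Longrightarrow> (\<And>x. x \<in> T \<Longrightarrow> g x = f x) \<Longrightarrow> in_span g"
  unfolding in_span_def by simp

lemma in_span_E: assumes "k < 28" shows "in_span (E k)"
  unfolding in_span_def
proof (intro exI ballI)
  fix x
  show "E k x = (\<Sum>j<28. (if j = k then 1 else 0) * E j x)"
    using assms by (simp add: if_distrib[of "\<lambda>u. u * _"] cong: if_cong)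
qed

lemma in_span_add:
  assumes "in_span f" "in_span g" shows "in_span (\<lambda>x. f x + g x)"
proof -
  obtain d e where "\<forall>x\<in>T. f x = (\<Sum>k<28. d k * E k x)" "\<forall>x\<in>T. g x = (\<Sum>k<28. e k * E k x)"
    using assms unfolding in_span_def by blast
  then have "\<forall>x\<in>T. f x + g x = (\<Sum>k<28. (d k + e k) * E k x)" by (simp add: distrib_right sum.distrib)
  then show ?thesis unfolding in_span_def by (rule exI[where P = "\<lambda>e. \<forall>x\<in>T. f x + g x = (\<Sum>k<28. e k * E k x)"])
qed

lemma in_span_cmult:
  assumes "in_span f" shows "in_span (\<lambda>x. m * f x)"
proof -
  obtain d where "\<forall>x\<in>T. f x = (\<Sum>k<28. d k * E k x)" using assms unfolding in_span_def by blast
  then have "\<forall>x\<in>T. m * f x = (\<Sum>k<28. (m * d k) * E k x)" by (simp add: sum_distrib_left mult.assoc)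
  then show ?thesis unfolding in_span_def by (rule exI[where P = "\<lambda>e. \<forall>x\<in>T. m * f x = (\<Sum>k<28. e k * E k x)"])
qed

lemma in_span_sum:
  assumes "\<And>i. i \<in> I \<Longrightarrow> in_span (f i)" shows "in_span (\<lambda>x. \<Sum>i\<in>I. f i x)"
proof -
  have 0: "in_span (\<lambda>x. 0)" unfolding in_span_def by (rule exI[of _ "\<lambda>k. 0"]) simp
  show ?thesis using assms by (induction I rule: infinite_finite_induct) (simp_all add: 0 in_span_add)
qed

lemma in_span_tpow:
  assumes "t \<in> set ws_lines" shows "in_span (\<lambda>x. tpow (lform t x))"
proof -
  obtain j where j: "j < length ws_lines" "t = ws_lines ! j" using assms by (auto simp: in_set_conv_nth)
  let ?ks = "[0, 1, 2, 3, 4, 6, 9, 10, 11, 12, 13, 15, 18, 19, 20, 21, 22, 24] :: nat list"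
  have len: "length ws_lines = length ?ks" by (simp add: ws_lines_def)
  have "tpow (lform t x) = E (?ks ! j) x" for x
  proof -
    have "tpow (lform t x) = map (\<lambda>t. tpow (lform t x)) ws_lines ! j" using j by (simp only: nth_map)
    also have "\<dots> = map (\<lambda>k. E k x) ?ks ! j" unfolding tpow_lines ..
    also have "\<dots> = E (?ks ! j) x" by (rule nth_map) (use j(1) in \<open>simp only: len\<close>)
    finally show ?thesis .
  qed
  moreover have "?ks ! j < 28"
  proof -
    have "?ks ! j \<in> set ?ks" using j len by (intro nth_mem) simp
    then show ?thesis by auto
  qed
  ultimately show ?thesis using in_span_E by simp
qed

lemma in_span_tsum: "in_span (L.tsum a)"
  unfolding L.tsum_def L_l by (intro in_span_sum in_span_cmult in_span_tpow)

lemma in_span_monomials: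
  "in_span (\<lambda>x. b1 x ^ 3)" "in_span (\<lambda>x. b2 x ^ 3)" "in_span (\<lambda>x. b3 x ^ 3)" "in_span (\<lambda>x. b1 x * b2 x * b3 x)"
  "in_span (\<lambda>x. b1 x ^ 2 * b2 x)" "in_span (\<lambda>x. b1 x * b2 x ^ 2)" "in_span (\<lambda>x. b2 x ^ 2 * b3 x)"
  "in_span (\<lambda>x. b2 x * b3 x ^ 2)" "in_span (\<lambda>x. b3 x ^ 2 * b1 x)" "in_span (\<lambda>x. b3 x * b1 x ^ 2)"
proof -
  have ev: "E 8 x = b1 x ^ 3" "E 17 x = b2 x ^ 3" "E 26 x = b3 x ^ 3" "E 27 x = b1 x * b2 x * b3 x" if "x \<in> T" for x
    using that by (simp_all add: E_def elementary_def corners_def corner_origin mem_tri)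
  have "in_span (E 8)" "in_span (E 17)" "in_span (E 26)" "in_span (E 27)" by (simp_all add: in_span_E)
  note c = this[THEN in_span_cong]
  show c: "in_span (\<lambda>x. b1 x ^ 3)" "in_span (\<lambda>x. b2 x ^ 3)" "in_span (\<lambda>x. b3 x ^ 3)" "in_span (\<lambda>x. b1 x * b2 x * b3 x)"
    by (rule c(1), simp add: ev, rule c(2), simp add: ev, rule c(3), simp add: ev, rule c(4), simp add: ev)
  have pair: "in_span (\<lambda>x. E i x + (-8) * E j x)" if "i < 28" "j < 28" for i j
    using that by (intro in_span_add in_span_cmult in_span_E)
  \<comment> \<open>A corner and its reflected partner differ by a full cube; the factor 8 undoes
    the scaling in \<open>corner_reflect\<close>.\<close>
  have d: "E 15 x + (-8) * E 5 x = (b2 x - 2 * b1 x) ^ 3" "E 20 x + (-8) * E 7 x = (b3 x - 2 * b1 x) ^ 3"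
    "E 24 x + (-8) * E 14 x = (b3 x - 2 * b2 x) ^ 3" "E 2 x + (-8) * E 16 x = (b1 x - 2 * b2 x) ^ 3"
    "E 6 x + (-8) * E 23 x = (b1 x - 2 * b3 x) ^ 3" "E 11 x + (-8) * E 25 x = (b2 x - 2 * b3 x) ^ 3" for x
    by (simp_all add: E_def elementary_def corners_def corner_reflect diff_divide_distrib)
  have D: "in_span (\<lambda>x. (b2 x - 2 * b1 x) ^ 3)" "in_span (\<lambda>x. (b3 x - 2 * b1 x) ^ 3)" "in_span (\<lambda>x. (b3 x - 2 * b2 x) ^ 3)"
    "in_span (\<lambda>x. (b1 x - 2 * b2 x) ^ 3)" "in_span (\<lambda>x. (b1 x - 2 * b3 x) ^ 3)" "in_span (\<lambda>x. (b2 x - 2 * b3 x) ^ 3)"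
    using pair[of 15 5] pair[of 20 7] pair[of 24 14] pair[of 2 16] pair[of 6 23] pair[of 11 25] unfolding d by simp_all
  \<comment> \<open>The cubes of \<open>v - 2 * u\<close>, \<open>u - 2 * v\<close>,
    \<open>u\<close> and \<open>v\<close> span the binary cubic forms.\<close>
  have solve: "u^2 * v = 1/9 * (v - 2 * u)^3 + 1/18 * (u - 2 * v)^3 + 1/3 * v^3 + 5/6 * u^3" for u v :: real
    by (simp add: power2_eq_square power3_eq_cube algebra_simps)
  have mono: "in_span (\<lambda>x. f x ^ 2 * g x)"
    if "in_span (\<lambda>x. (g x - 2 * f x) ^ 3)" "in_span (\<lambda>x. (f x - 2 * g x) ^ 3)" "in_span (\<lambda>x. f x ^ 3)" "in_span (\<lambda>x. g x ^ 3)" for f g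
    unfolding solve using that by (intro in_span_add in_span_cmult)
  show "in_span (\<lambda>x. b1 x ^ 2 * b2 x)" "in_span (\<lambda>x. b2 x ^ 2 * b3 x)" "in_span (\<lambda>x. b3 x ^ 2 * b1 x)"
    by (intro mono c D)+
  have "in_span (\<lambda>x. b2 x ^ 2 * b1 x)" "in_span (\<lambda>x. b3 x ^ 2 * b2 x)" "in_span (\<lambda>x. b1 x ^ 2 * b3 x)"
    by (intro mono c D)+
  then show "in_span (\<lambda>x. b1 x * b2 x ^ 2)" "in_span (\<lambda>x. b2 x * b3 x ^ 2)" "in_span (\<lambda>x. b3 x * b1 x ^ 2)"
    by (simp_all add: mult.commute)
qed

lemma in_span_linear_forms:
  "in_span (\<lambda>x. (a1 * b1 x + a2 * b2 x + a3 * b3 x) * (c1 * b1 x + c2 * b2 x + c3 * b3 x) * (d1 * b1 x + d2 * b2 x + d3 * b3 x))"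
proof -
  have e: "(a1 * u + a2 * v + a3 * w) * (c1 * u + c2 * v + c3 * w) * (d1 * u + d2 * v + d3 * w) =
    (a1*c1*d1) * u^3 + (a2*c2*d2) * v^3 + (a3*c3*d3) * w^3
    + (a1*c2*d3 + a1*c3*d2 + a2*c1*d3 + a2*c3*d1 + a3*c1*d2 + a3*c2*d1) * (u * v * w)
    + (a1*c1*d2 + a1*c2*d1 + a2*c1*d1) * (u^2 * v) + (a1*c2*d2 + a2*c1*d2 + a2*c2*d1) * (u * v^2)
    + (a2*c2*d3 + a2*c3*d2 + a3*c2*d2) * (v^2 * w) + (a2*c3*d3 + a3*c2*d3 + a3*c3*d2) * (v * w^2)
    + (a3*c3*d1 + a3*c1*d3 + a1*c3*d3) * (w^2 * u) + (a3*c1*d1 + a1*c3*d1 + a1*c1*d3) * (w * u^2)" for u v w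
    by (simp add: power2_eq_square power3_eq_cube algebra_simps)
  show ?thesis unfolding e[of "b1 _" "b2 _" "b3 _"] by (intro in_span_add in_span_cmult in_span_monomials)
qed

lemma in_span_cubic_poly:
  assumes "cubic_poly P" shows "in_span P"
proof -
  obtain a0 a1 a2 a3 a4 a5 a6 a7 a8 a9 where P: "\<And>x. P x = a0 + a1 * x$1 + a2 * x$2 + a3 * (x$1)^2 + a4 * (x$1 * x$2)
     + a5 * (x$2)^2 + a6 * (x$1)^3 + a7 * ((x$1)^2 * x$2) + a8 * (x$1 * (x$2)^2) + a9 * (x$2)^3"
    using assms unfolding cubic_poly_iff by blast
  \<comment> \<open>The form \<open>?o\<close> is constantly 1 and raises the lower monomials to
    degree three.\<close>
  let ?o = "\<lambda>x. 1 * b1 x + 1 * b2 x + 1 * b3 x"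
  let ?u = "\<lambda>x. p1$1 * b1 x + p2$1 * b2 x + p3$1 * b3 x" and ?v = "\<lambda>x. p1$2 * b1 x + p2$2 * b2 x + p3$2 * b3 x"
  have "?o x = 1" "?u x = x$1" "?v x = x$2" for x
    using bary_total[of x] arg_cong[OF bary_reconstruct[of x], of "\<lambda>v. v$1"] arg_cong[OF bary_reconstruct[of x], of "\<lambda>v. v$2"]
    by (simp_all add: mult.commute)
  then have "P x = a0 * (?o x * ?o x * ?o x) + a1 * (?u x * ?o x * ?o x) + a2 * (?v x * ?o x * ?o x) + a3 * (?u x * ?u x * ?o x)
    + a4 * (?u x * ?v x * ?o x) + a5 * (?v x * ?v x * ?o x) + a6 * (?u x * ?u x * ?u x) + a7 * (?u x * ?u x * ?v x)
    + a8 * (?u x * ?v x * ?v x) + a9 * (?v x * ?v x * ?v x)" for x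
    unfolding P by (simp add: power2_eq_square power3_eq_cube mult_ac)
  moreover have "in_span (\<lambda>x. a0 * (?o x * ?o x * ?o x) + a1 * (?u x * ?o x * ?o x) + a2 * (?v x * ?o x * ?o x) + a3 * (?u x * ?u x * ?o x)
    + a4 * (?u x * ?v x * ?o x) + a5 * (?v x * ?v x * ?o x) + a6 * (?u x * ?u x * ?u x) + a7 * (?u x * ?u x * ?v x)
    + a8 * (?u x * ?v x * ?v x) + a9 * (?v x * ?v x * ?v x))"
    by (intro in_span_add in_span_cmult in_span_linear_forms)
  ultimately show ?thesis by (rule in_span_cong[rotated])
qed

section \<open>Change of basis and partition of unity\<close>

lemma sum_Fn: "(\<Sum>i<28. d i * Fn i x) = (\<Sum>k<28. (\<Sum>i<28. d i * real_of_int (ws_matrix!i!k)) / 12 * E k x)"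
proof -
  have "(\<Sum>i<28. d i * Fn i x) = (\<Sum>i<28. \<Sum>k<28. d i * real_of_int (ws_matrix!i!k) / 12 * E k x)"
    unfolding Fn_def sum_distrib_left by (intro sum.cong refl) simp
  also have "\<dots> = (\<Sum>k<28. \<Sum>i<28. d i * real_of_int (ws_matrix!i!k) / 12 * E k x)" by (rule sum.swap)
  also have "\<dots> = (\<Sum>k<28. (\<Sum>i<28. d i * real_of_int (ws_matrix!i!k)) / 12 * E k x)"
    by (simp add: sum_distrib_right sum_divide_distrib)
  finally show ?thesis .
qed

lemma sum_ws_B:
  assumes "x \<in> T" shows "(\<Sum>i=1..28. c i * ws_B p1 p2 p3 i x) = (\<Sum>i<28. c (Suc i) * Fn i x)"
proof -
  have "(\<Sum>i=1..28. c i * ws_B p1 p2 p3 i x) = (\<Sum>i<28. c (Suc i) * ws_B p1 p2 p3 (Suc i) x)"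
    using sum.atLeast1_atMost_eq[of "\<lambda>i. c i * ws_B p1 p2 p3 i x" 28] by simp
  also have "\<dots> = (\<Sum>i<28. c (Suc i) * Fn i x)"
    by (intro sum.cong refl) (simp add: ws_B_eq[OF assms])
  finally show ?thesis .
qed

lemma ws_B_independent:
  assumes zero: "\<forall>x\<in>T. (\<Sum>i=1..28. c i * ws_B p1 p2 p3 i x) = 0" and i: "i \<in> {1..28}"
  shows "c i = 0"
proof -
  let ?e = "\<lambda>k. (\<Sum>i<28. c (Suc i) * real_of_int (ws_matrix!i!k)) / 12"
  have e: "?e k = 0" if "k < 28" for k
  proof (rule E_independent[OF _ that])
    fix x assume "x \<in> interior T"
    then have x: "x \<in> T" using interior_subset by blast
    show "(\<Sum>k<28. ?e k * E k x) = 0" using zero x sum_ws_B[OF x, of c] unfolding sum_Fn by simp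
  qed
  obtain j where j: "i = Suc j" "j < 28" using i by (cases i) auto
  \<comment> \<open>The factor 12 clears the denominator in \<open>Fn\<close>; the inverse matrix
    then isolates one coefficient.\<close>
  have "0 = (\<Sum>k<28. (12 * ?e k) * real_of_int (ws_inverse!k!j))" using e by simp
  also have "\<dots> = (\<Sum>k<28. \<Sum>i<28. c (Suc i) * (real_of_int (ws_matrix!i!k) * real_of_int (ws_inverse!k!j)))"
    by (simp add: sum_distrib_right mult.assoc)
  also have "\<dots> = (\<Sum>i<28. c (Suc i) * (\<Sum>k<28. real_of_int (ws_matrix!i!k) * real_of_int (ws_inverse!k!j)))"
    unfolding sum_distrib_left by (rule sum.swap)
  also have "\<dots> = (\<Sum>i<28. c (Suc i) * (if i = j then 19440 else 0))"
    by (intro sum.cong refl) (simp add: inverse_product(2) j(2))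
  also have "\<dots> = (\<Sum>i<28. if i = j then c (Suc j) * 19440 else 0)" by (intro sum.cong) auto
  also have "\<dots> = c i * 19440" using j by simp
  finally show ?thesis by simp
qed

lemma in_span_ws_B:
  assumes "in_span f" shows "\<exists>c. \<forall>x\<in>T. f x = (\<Sum>i=1..28. c i * ws_B p1 p2 p3 i x)"
proof -
  obtain e where e: "\<And>x. x \<in> T \<Longrightarrow> f x = (\<Sum>k<28. e k * E k x)" using assms unfolding in_span_def by blast
  \<comment> \<open>The inverse matrix over its denominator 1620; \<open>i - 1\<close> converts from
    the numbering 1 to 28.\<close>
  define c where "c = (\<lambda>i. (\<Sum>k<28. e k * real_of_int (ws_inverse!k!(i - 1))) / 1620)"
  have "(\<Sum>i<28. c (Suc i) * real_of_int (ws_matrix!i!j)) / 12 = e j" if j: "j < 28" for j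
  proof -
    have "(\<Sum>i<28. c (Suc i) * real_of_int (ws_matrix!i!j)) =
        (\<Sum>i<28. \<Sum>k<28. e k * (real_of_int (ws_inverse!k!i) * real_of_int (ws_matrix!i!j)) / 1620)"
      unfolding c_def by (simp add: sum_distrib_right sum_divide_distrib mult.assoc)
    also have "\<dots> = (\<Sum>k<28. \<Sum>i<28. e k * (real_of_int (ws_inverse!k!i) * real_of_int (ws_matrix!i!j)) / 1620)"
      by (rule sum.swap)
    also have "\<dots> = (\<Sum>k<28. e k * (\<Sum>i<28. real_of_int (ws_inverse!k!i) * real_of_int (ws_matrix!i!j)) / 1620)"
      by (simp add: sum_distrib_left sum_divide_distrib)
    also have "\<dots> = (\<Sum>k<28. e k * (if k = j then 19440 else 0) / 1620)"
      by (intro sum.cong refl) (simp add: inverse_product(1) j)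
    also have "\<dots> = (\<Sum>k<28. if k = j then e j * 12 else 0)" by (intro sum.cong) auto
    also have "\<dots> = e j * 12" using j by simp
    finally show ?thesis by simp
  qed
  then have "f x = (\<Sum>i=1..28. c i * ws_B p1 p2 p3 i x)" if "x \<in> T" for x
    unfolding sum_ws_B[OF that] sum_Fn e[OF that] by (intro sum.cong refl) simp
  then show ?thesis by blast
qed

text \<open>Column sums 6 and -48 of a reflected pair cancel as 6 - 48/8, so all chord coefficients
  vanish; the cubic part is the expansion of the cube of \<open>b1 x + b2 x + b3 x\<close>.\<close>

lemma partition_of_unity:
  assumes x: "x \<in> T" shows "(\<Sum>i=1..28. ws_B p1 p2 p3 i x) = 1"
proof -
  define e :: "nat \<Rightarrow> real" where "e = (\<lambda>k. [0, 0, 6, 0, 0, -48, 6, -48, 96, 0, 0, 6, 0, 0, -48, 6, -48, 96, 0, 0, 6, 0, 0, -48, 6, -48, 96, 72] ! k / 12)"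
  have "(\<Sum>i=1..28. ws_B p1 p2 p3 i x) = (\<Sum>k<28. e k * E k x)"
    using sum_ws_B[OF x, of "\<lambda>i. 1"] sum_Fn[of "\<lambda>i. 1" x] by (simp add: e_def column_sums)
  also have "\<dots> = cubic_part e (b1 x) (b2 x) (b3 x) + L.tsum (tpow_coefficient e) x" by (rule decomposition[OF x])
  also have "L.tsum (tpow_coefficient e) x = 0"
    unfolding tsum_tpow_coefficient by (simp add: tpow_coefficients_def e_def)
  also have "cubic_part e (b1 x) (b2 x) (b3 x) = (b1 x + b2 x + b3 x) ^ 3"
    unfolding cubic_part_def e_def by (simp add: power3_eq_cube algebra_simps add_divide_distrib diff_divide_distrib)
  finally show ?thesis by (simp add: bary_total)
qed

section \<open>Membership in the spline space and the converse inclusion\<close>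

lemma closed_tri: "closed T"
  unfolding tri_def by (intro compact_imp_closed finite_imp_compact_convex_hull) simp

text \<open>A component of the complement avoids every chord, so each chord form keeps its sign
  there and its truncated cube is a cube or zero.\<close>

lemma ws_B_in_space:
  assumes i: "i < 28" shows "ws_B p1 p2 p3 (Suc i) \<in> S32_WS3 p1 p2 p3"
proof -
  let ?B = "ws_B p1 p2 p3 (Suc i)"
  have C2: "C2_on T ?B"
    unfolding C2_on_def
    by (intro exI[of _ "Fn i"] exI[of _ UNIV]) (simp add: C2_fun_imp_C2_open[OF C2_fun_Fn] ws_B_eq[OF _ i])
  have "\<exists>q. cubic_poly q \<and> (\<forall>x\<in>P. ?B x = q x)" if P: "P \<in> ws_polygons p1 p2 p3" for P
  proof -
    obtain C where C: "C \<in> components (T - ws_segments p1 p2 p3)" "P = closure C" using P unfolding ws_polygons_def by blast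
    have CT: "C \<subseteq> T - ws_segments p1 p2 p3" and conn: "connected C"
      using C(1) by (rule in_components_subset, rule in_components_connected)
    define e where "e = (\<lambda>k. real_of_int (ws_matrix!i!k) / 12)"
    have sign: "(\<forall>x\<in>C. 0 < lform t x) \<or> (\<forall>x\<in>C. lform t x < 0)" if t: "t \<in> set ws_lines" for t
    proof -
      have nz: "lform t x \<noteq> 0" if "x \<in> C" for x using lines_in_ws_segments[OF t, of x] CT that by blast
      have "open {x. 0 < lform t x}" "open {x. lform t x < 0}"
        using L.open_pos[of t] L.open_neg[of t] unfolding L_l .
      from connectedD[OF conn this] nz show ?thesis by force
    qed
    define q where "q = (\<lambda>x. cubic_part e (b1 x) (b2 x) (b3 x) + (\<Sum>t\<in>set ws_lines. if \<forall>x\<in>C. 0 < lform t x then tpow_coefficient e t * lform t x ^ 3 else 0))"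
    have "cubic_poly (\<lambda>x. if \<forall>x\<in>C. 0 < lform t x then tpow_coefficient e t * lform t x ^ 3 else 0)" for t
    proof (cases "\<forall>x\<in>C. 0 < lform t x")
      case True
      show ?thesis unfolding if_P[OF True] by (rule cubic_poly_cmult) (rule L.l_cube[of t, unfolded L_l])
    next
      case False
      show ?thesis unfolding if_not_P[OF False] by (rule cubic_poly_zero)
    qed
    then have cq: "cubic_poly q" unfolding q_def by (intro cubic_poly_add cubic_poly_cubic_part cubic_poly_sum)
    have "Fn i x = q x" if x: "x \<in> C" for x
    proof -
      have "Fn i x = cubic_part e (b1 x) (b2 x) (b3 x) + L.tsum (tpow_coefficient e) x"
        using decomposition[of x e] x CT unfolding Fn_def e_def by blast
      also have "L.tsum (tpow_coefficient e) x = (\<Sum>t\<in>set ws_lines. if \<forall>x\<in>C. 0 < lform t x then tpow_coefficient e t * lform t x ^ 3 else 0)"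
        unfolding L.tsum_def L_l
      proof (rule sum.cong[OF refl])
        fix t assume "t \<in> set ws_lines"
        from sign[OF this] x show "tpow_coefficient e t * tpow (lform t x) = (if \<forall>x\<in>C. 0 < lform t x then tpow_coefficient e t * lform t x ^ 3 else 0)"
          by (auto simp: tpow_def max_def)
      qed
      finally show ?thesis unfolding q_def .
    qed
    then have "C \<subseteq> {x. Fn i x = q x}" by blast
    moreover have "closed {x. Fn i x = q x}"
      by (intro closed_Collect_eq continuous_Fn cubic_poly_continuous cq)
    ultimately have eq: "P \<subseteq> {x. Fn i x = q x}" unfolding C(2) by (rule closure_minimal)
    have "P \<subseteq> T" unfolding C(2) by (rule closure_minimal) (use CT closed_tri in auto)
    then have "\<forall>x\<in>P. ?B x = q x" using eq ws_B_eq[OF _ i] by fastforce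
    then show ?thesis using cq by blast
  qed
  then show ?thesis using C2 unfolding S32_WS3_def by blast
qed

text \<open>Zero coefficients embed the result of the analysis at one point into the full family,
  where the patching takes place.\<close>

lemma local_form_restrict:
  assumes J: "J \<subseteq> set ws_lines" and loc: "line_family.local_form J lnormal lconst g x p a"
  shows "L.local_form g x p (\<lambda>t. if t \<in> J then a t else 0)"
proof -
  interpret J: line_family J lnormal lconst by (rule line_family_subset[OF J])
  have "L.tsum (\<lambda>t. if t \<in> J then a t else 0) y = J.tsum a y" for y
  proof -
    have "L.tsum (\<lambda>t. if t \<in> J then a t else 0) y = (\<Sum>t\<in>set ws_lines. if t \<in> J then a t * tpow (lform t y) else 0)"
      unfolding L.tsum_def L_l by (intro sum.cong) auto
    also have "\<dots> = (\<Sum>t\<in>set ws_lines \<inter> J. a t * tpow (lform t y))" by (simp add: sum.If_cases)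
    also have "set ws_lines \<inter> J = J" using J by blast
    finally show ?thesis by (simp add: J.tsum_def J.l_def lform_affine)
  qed
  then show ?thesis using loc unfolding L.local_form_def J.local_form_def by simp
qed

lemma space_in_span:
  assumes f: "f \<in> S32_WS3 p1 p2 p3" shows "in_span f"
proof -
  obtain g U where g: "T \<subseteq> U" "C2_open U g" "\<And>x. x \<in> T \<Longrightarrow> g x = f x"
    using f unfolding S32_WS3_def C2_on_def by blast
  have poly: "\<exists>q. cubic_poly q \<and> (\<forall>x\<in>P. f x = q x)" if "P \<in> ws_polygons p1 p2 p3" for P
    using f that unfolding S32_WS3_def by blast
  have loc: "\<exists>p a. L.local_form g x p a" if x: "x \<in> interior T" for x
  proof -
    \<comment> \<open>Only the chords through \<open>x\<close> matter; a small ball avoids all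
      others.\<close>
    define J where "J = {t \<in> set ws_lines. lform t x = 0}"
    have J: "J \<subseteq> set ws_lines" by (auto simp: J_def)
    interpret J: line_family J lnormal lconst by (rule line_family_subset[OF J])
    have Jl: "J.l t y = lform t y" for t y by (simp add: J.l_def lform_affine)
    have "\<forall>\<^sub>F y in nhds x. \<forall>t\<in>set ws_lines - J. lform t y \<noteq> 0"
    proof (intro eventually_ball_finite ballI)
      fix t assume "t \<in> set ws_lines - J"
      then have "L.l t x \<noteq> 0" by (simp add: J_def L_l)
      from L.eventually_sign[OF this] show "\<forall>\<^sub>F y in nhds x. lform t y \<noteq> 0"
        unfolding L_l by (rule eventually_mono) simp
    qed simp
    then have "\<forall>\<^sub>F y in nhds x. y \<in> interior T \<and> (\<forall>t\<in>set ws_lines - J. lform t y \<noteq> 0)"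
      using eventually_nhds_in_open[OF open_interior x] by eventually_elim blast
    then obtain d where d: "0 < d" "\<And>y. dist y x < d \<Longrightarrow> y \<in> interior T \<and> (\<forall>t\<in>set ws_lines - J. lform t y \<noteq> 0)"
      unfolding eventually_nhds_metric by blast
    have ball: "ball x d \<subseteq> interior T" using d(2) by (auto simp: dist_commute)
    have "\<exists>p a. J.local_form g x p a"
    proof (rule J.local_form_vertex[OF g(2) d(1)])
      show "ball x d \<subseteq> U" using ball interior_subset g(1) by blast
      show "J.l t x = 0" if "t \<in> J" for t using that by (simp add: Jl J_def)
      show "card J \<le> 4" unfolding J_def by (rule concurrency_le_4[OF x])
      fix C assume C: "convex C" "C \<subseteq> ball x d" "\<forall>t\<in>J. \<forall>z\<in>C. J.l t z \<noteq> 0"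
      show "\<exists>q. cubic_poly q \<and> (\<forall>z\<in>C. g z = q z)"
      proof (cases "C = {}")
        case True
        then show ?thesis using cubic_poly_zero by blast
      next
        case False
        have Cint: "C \<subseteq> interior T" using C(2) ball by blast
        have "lform t z \<noteq> 0" if z: "z \<in> C" and t: "t \<in> set ws_lines" for t z
        proof (cases "t \<in> J")
          case True
          then show ?thesis using C(3) z by (simp add: Jl)
        next
          case False
          have "dist z x < d" using C(2) z by (auto simp: dist_commute)
          then show ?thesis using d(2) t False by blast
        qed
        then have sub: "C \<subseteq> T - ws_segments p1 p2 p3"
          using ws_segments_on_lines Cint interior_subset by blast
        \<comment> \<open>A convex set off all segments lies in a single component, where the spline
          is one cubic.\<close>
        then obtain K where K: "K \<in> components (T - ws_segments p1 p2 p3)" "C \<subseteq> K"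
          using exists_component_superset[OF sub _ convex_connected[OF C(1)]] False by blast
        have "closure K \<in> ws_polygons p1 p2 p3" unfolding ws_polygons_def using K(1) by blast
        then obtain q where q: "cubic_poly q" "\<forall>z\<in>closure K. f z = q z" using poly by blast
        have "g z = q z" if "z \<in> C" for z
        proof -
          have "z \<in> T" using that sub by blast
          moreover have "z \<in> closure K" using that K(2) closure_subset by blast
          ultimately show ?thesis using g(3)[of z] q(2) by simp
        qed
        then show ?thesis using q(1) by blast
      qed
    qed
    then show ?thesis using local_form_restrict[OF J] by blast
  qed
  have ne: "interior T \<noteq> {}"
  proof -
    have "p1 \<in> T" by (simp add: mem_tri bary_vertices)
    then show ?thesis using tri_closure by auto
  qed
  have "convex (interior T)" unfolding tri_def by (intro convex_interior convex_convex_hull)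
  from L.patch[OF open_interior this ne loc]
  obtain p a where pa: "cubic_poly p" "\<And>x. x \<in> interior T \<Longrightarrow> g x = p x + L.tsum a x" by metis
  have gc: "continuous_on T g"
  proof -
    have "continuous_on U g" using g(2) unfolding C2_open_def
      by (intro continuous_at_imp_continuous_on ballI differentiable_imp_continuous_within) blast
    then show ?thesis using g(1) by (rule continuous_on_subset)
  qed
  have hc: "continuous_on T (\<lambda>x. p x + L.tsum a x)"
    by (intro continuous_on_add cubic_poly_continuous pa(1) L.tsum_continuous)
  have "f x = p x + L.tsum a x" if x: "x \<in> T" for x
  proof -
    \<comment> \<open>Both sides are continuous on \<open>T\<close>, so the identity extends from
      the dense interior.\<close>
    have cl: "closure (interior T) = T" using tri_closure closure_minimal[OF interior_subset closed_tri] by blast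
    have "g x - (p x + L.tsum a x) = 0"
    proof (rule continuous_constant_on_closure[of "interior T" "\<lambda>x. g x - (p x + L.tsum a x)"])
      show "continuous_on (closure (interior T)) (\<lambda>x. g x - (p x + L.tsum a x))"
        unfolding cl by (intro continuous_on_diff gc hc)
    qed (use pa(2) x cl in auto)
    then show ?thesis using g(3)[OF x] by simp
  qed
  moreover have "in_span (\<lambda>x. p x + L.tsum a x)" by (intro in_span_add in_span_cubic_poly pa(1) in_span_tsum)
  ultimately show ?thesis by (rule in_span_cong[rotated])
qed

end

theorem theorem3p1:
  fixes p1 p2 p3 :: "real^2"
  assumes "\<not> collinear {p1, p2, p3}"
  shows "(\<forall>i\<in>{1..28}. \<forall>x\<in>tri p1 p2 p3. 0 \<le> ws_B p1 p2 p3 i x)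
    \<and> (\<forall>i\<in>{1..28}. ws_B p1 p2 p3 i \<in> S32_WS3 p1 p2 p3)
    \<and> (\<forall>c :: nat \<Rightarrow> real. (\<forall>x\<in>tri p1 p2 p3. (\<Sum>i=1..28. c i * ws_B p1 p2 p3 i x) = 0)
          \<longrightarrow> (\<forall>i\<in>{1..28}. c i = 0))
    \<and> (\<forall>f\<in>S32_WS3 p1 p2 p3. \<exists>c :: nat \<Rightarrow> real.
          \<forall>x\<in>tri p1 p2 p3. f x = (\<Sum>i=1..28. c i * ws_B p1 p2 p3 i x))
    \<and> (\<forall>x\<in>tri p1 p2 p3. (\<Sum>i=1..28. ws_B p1 p2 p3 i x) = 1)"
proof -
  interpret triangle p1 p2 p3 by unfold_locales (rule orient_nonzero[OF assms])
  have idx: "\<exists>j<28. i = Suc j" if "i \<in> {1..28}" for i using that by (cases i) auto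
  show ?thesis
  proof (intro conjI ballI allI impI)
    fix i x assume i: "i \<in> {1..28::nat}" and x: "x \<in> T"
    obtain j where "j < 28" "i = Suc j" using idx[OF i] by blast
    then show "0 \<le> ws_B p1 p2 p3 i x" using Fn_nonneg[OF x] by (simp add: ws_B_eq[OF x])
  next
    fix i :: nat assume i: "i \<in> {1..28}"
    obtain j where "j < 28" "i = Suc j" using idx[OF i] by blast
    then show "ws_B p1 p2 p3 i \<in> S32_WS3 p1 p2 p3" using ws_B_in_space by simp
  next
    fix c :: "nat \<Rightarrow> real" and i :: nat
    assume "\<forall>x\<in>T. (\<Sum>i=1..28. c i * ws_B p1 p2 p3 i x) = 0" "i \<in> {1..28}"
    then show "c i = 0" by (rule ws_B_independent)
  next
    fix f assume "f \<in> S32_WS3 p1 p2 p3"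
    then show "\<exists>c. \<forall>x\<in>T. f x = (\<Sum>i=1..28. c i * ws_B p1 p2 p3 i x)" by (intro in_span_ws_B space_in_span)
  next
    fix x assume "x \<in> T"
    then show "(\<Sum>i=1..28. ws_B p1 p2 p3 i x) = 1" by (rule partition_of_unity)
  qed
qed

end
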